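(* Let $\mathcal{A}$ be a C$^*$-algebra (not necessarily unital), and let $\mathcal{M}$ be a Banach $\mathcal{A}$-bimodule. Suppose that $F:\mathcal{A}\to\mathcal{M}$ is a generalized derivation of the third type. Then $F$ is continuous. Consequently, every generalized derivation of the third type from $\mathcal{A}$ to $\mathcal{M}$ is a generalized derivation of the second type.
   Context: Let $\mathcal{A}$ be a Banach algebra and $\mathcal{M}$ a Banach $\mathcal{A}$-bimodule; the bidual $\mathcal{M}^{**}$ is regarded as a Banach $\mathcal{A}$-bimodule in the canonical way (extending the module operations of $\mathcal{M}$). A linear map $F:\mathcal{A}\to\mathcal{M}$ is a generalized derivation - \emph{of the second type} if there exists $\xi\in\mathcal{M}^{**}$ with $F(ab)=F(a)b+aF(b)-a\xi b$ for all $a,b\in\mathcal{A}$; - \emph{of the third type} if there exist two (not necessarily linear) mappings $G,H:\mathcal{A}\to\mathcal{M}$ with $F(ab)=G(a)b+aH(b)$ for all $a,b\in\mathcal{A}$. Generalized derivations are linear but not assumed to be continuous. *)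

theory Defs
  imports "HOL-Analysis.Analysis"
begin

section \<open>Complex normed spaces and C*-algebras\<close>

text \<open>
  HOL-Analysis only has real normed spaces and algebras. A complex structure is added on top of
  them; \<open>scaleR_scaleC\<close> makes the given real structure the restriction of the complex one.
\<close>

class complex_normed_vector = real_normed_vector +
  fixes scaleC :: "complex \<Rightarrow> 'a \<Rightarrow> 'a"  (infixr "*\<^sub>C" 75)
  assumes scaleC_add_right: "c *\<^sub>C (x + y) = c *\<^sub>C x + c *\<^sub>C y"
    and scaleC_add_left: "(c + d) *\<^sub>C x = c *\<^sub>C x + d *\<^sub>C x"
    and scaleC_scaleC: "c *\<^sub>C d *\<^sub>C x = (c * d) *\<^sub>C x"
    and scaleR_scaleC: "r *\<^sub>R x = complex_of_real r *\<^sub>C x"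
    and norm_scaleC: "norm (c *\<^sub>C x) = cmod c * norm x"

lemma vector_space_scaleC:
  "vector_space (scaleC :: complex \<Rightarrow> 'a \<Rightarrow> 'a::complex_normed_vector)"
proof
  show "1 *\<^sub>C x = x" for x :: 'a
    using scaleR_scaleC[of 1 x] by simp
qed (simp_all add: scaleC_add_right scaleC_add_left scaleC_scaleC)

lemma vector_space_mult_complex: "vector_space ((*) :: complex \<Rightarrow> complex \<Rightarrow> complex)"
  by standard (simp_all add: algebra_simps)

abbreviation clinear :: "('a::complex_normed_vector \<Rightarrow> 'b::complex_normed_vector) \<Rightarrow> bool"
  where "clinear \<equiv> Vector_Spaces.linear scaleC scaleC"

class complex_normed_algebra = complex_normed_vector + real_normed_algebra +
  assumes mult_scaleC_left: "(c *\<^sub>C x) * y = c *\<^sub>C (x * y)"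
    and mult_scaleC_right: "x * (c *\<^sub>C y) = c *\<^sub>C (x * y)"

class complex_banach_algebra = complex_normed_algebra + banach

text \<open>No unit is required, and the zero algebra is allowed.\<close>

class cstar_algebra = complex_banach_algebra +
  fixes adj :: "'a \<Rightarrow> 'a"
  assumes adj_adj: "adj (adj x) = x"
    and adj_add: "adj (x + y) = adj x + adj y"
    and adj_scaleC: "adj (c *\<^sub>C x) = cnj c *\<^sub>C adj x"
    and adj_mult: "adj (x * y) = adj y * adj x"
    and norm_adj_mult: "norm (adj x * x) = (norm x)\<^sup>2"


section \<open>The dual of a complex normed space\<close>

lemma clinear_functional_iff:
  fixes f :: "'m::complex_normed_vector \<Rightarrow> complex"
  shows "Vector_Spaces.linear scaleC (*) f \<longleftrightarrow>
    (\<forall>x y. f (x + y) = f x + f y) \<and> (\<forall>c x. f (c *\<^sub>C x) = c * f x)"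
  using vector_space_scaleC vector_space_mult_complex
  by (auto simp: Vector_Spaces.linear_iff)

text \<open>
  \<open>bounded_linear\<close> is the library's real notion; together with complex linearity it describes
  the continuous complex-linear functionals.
\<close>

typedef (overloaded) 'm cdual =
  "{f :: 'm::complex_normed_vector \<Rightarrow> complex.
      bounded_linear f \<and> Vector_Spaces.linear scaleC (*) f}"
  morphisms cdual_apply Abs_cdual
  by (rule exI[of _ "\<lambda>_. 0"]) (simp add: clinear_functional_iff)

setup_lifting type_definition_cdual

lemma cdual_apply_bounded_linear: "bounded_linear (cdual_apply f)"
  using cdual_apply[of f] by simp

lemma cdual_apply_add: "cdual_apply f (x + y) = cdual_apply f x + cdual_apply f y"
  using cdual_apply[of f] by (simp add: clinear_functional_iff)

lemma cdual_apply_scaleC: "cdual_apply f (c *\<^sub>C x) = c * cdual_apply f x"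
  using cdual_apply[of f] by (simp add: clinear_functional_iff)

lemma cdual_eqI: "(\<And>x. cdual_apply f x = cdual_apply g x) \<Longrightarrow> f = g"
  by (simp add: cdual_apply_inject[symmetric] fun_eq_iff)

lemma Abs_cdual_apply:
  assumes "\<And>x y. f (x + y) = f x + f y" "\<And>c x. f (c *\<^sub>C x) = c * f x"
    and "\<And>x. cmod (f x) \<le> norm x * K"
  shows "cdual_apply (Abs_cdual f) = f"
proof (rule Abs_cdual_inverse)
  have "bounded_linear f"
    by (rule bounded_linear_intro[where K = K])
      (simp_all add: assms scaleR_scaleC scaleR_conv_of_real)
  then show "f \<in> {f. bounded_linear f \<and> Vector_Spaces.linear scaleC (*) f}"
    by (simp add: clinear_functional_iff assms)
qed

instantiation cdual :: (complex_normed_vector) complex_normed_vector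
begin

lift_definition zero_cdual :: "'a cdual" is "\<lambda>_. 0"
  by (simp add: clinear_functional_iff)

lift_definition plus_cdual :: "'a cdual \<Rightarrow> 'a cdual \<Rightarrow> 'a cdual" is "\<lambda>f g x. f x + g x"
  by (auto simp: clinear_functional_iff bounded_linear_add algebra_simps)

lift_definition minus_cdual :: "'a cdual \<Rightarrow> 'a cdual \<Rightarrow> 'a cdual" is "\<lambda>f g x. f x - g x"
  by (auto simp: clinear_functional_iff bounded_linear_sub algebra_simps)

lift_definition uminus_cdual :: "'a cdual \<Rightarrow> 'a cdual" is "\<lambda>f x. - f x"
  by (auto simp: clinear_functional_iff bounded_linear_minus)

lift_definition scaleC_cdual :: "complex \<Rightarrow> 'a cdual \<Rightarrow> 'a cdual" is "\<lambda>c f x. c * f x"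
  by (auto simp: clinear_functional_iff distrib_left mult.left_commute intro: bounded_linear_const_mult)

lift_definition scaleR_cdual :: "real \<Rightarrow> 'a cdual \<Rightarrow> 'a cdual" is "\<lambda>r f x. complex_of_real r * f x"
  by (auto simp: clinear_functional_iff distrib_left mult.left_commute intro: bounded_linear_const_mult)

lift_definition norm_cdual :: "'a cdual \<Rightarrow> real" is onorm .

definition dist_cdual :: "'a cdual \<Rightarrow> 'a cdual \<Rightarrow> real"
  where "dist_cdual f g = norm (f - g)"

definition sgn_cdual :: "'a cdual \<Rightarrow> 'a cdual"
  where "sgn_cdual f = scaleR (inverse (norm f)) f"

definition uniformity_cdual_def:
  "(uniformity :: ('a cdual \<times> 'a cdual) filter) = (INF e\<in>{0 <..}. principal {(x, y). dist x y < e})"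

definition open_cdual :: "'a cdual set \<Rightarrow> bool"
  where "open_cdual S = (\<forall>x\<in>S. \<forall>\<^sub>F (x', y) in uniformity. x' = x \<longrightarrow> y \<in> S)"

instance
proof
  fix f g h :: "'a cdual" and c d :: complex and r s :: real and S :: "'a cdual set"
  show "f + g + h = f + (g + h)" "f + g = g + f" "0 + f = f" "- f + f = 0" "f - g = f + - g"
    by (transfer, simp add: algebra_simps)+
  show "r *\<^sub>R (f + g) = r *\<^sub>R f + r *\<^sub>R g" "(r + s) *\<^sub>R f = r *\<^sub>R f + s *\<^sub>R f"
    "r *\<^sub>R s *\<^sub>R f = (r * s) *\<^sub>R f" "1 *\<^sub>R f = f"
    by (transfer, simp add: algebra_simps)+
  show "c *\<^sub>C (f + g) = c *\<^sub>C f + c *\<^sub>C g" "(c + d) *\<^sub>C f = c *\<^sub>C f + d *\<^sub>C f"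
    "c *\<^sub>C d *\<^sub>C f = (c * d) *\<^sub>C f"
    by (transfer, simp add: algebra_simps)+
  show "r *\<^sub>R f = complex_of_real r *\<^sub>C f"
    by (transfer, simp)
  show "dist f g = norm (f - g)" "sgn f = inverse (norm f) *\<^sub>R f"
    by (simp_all only: dist_cdual_def sgn_cdual_def)
  show "uniformity = (INF e\<in>{0 <..}. principal {(x :: 'a cdual, y). dist x y < e})"
    by (simp only: uniformity_cdual_def)
  show "open S \<longleftrightarrow> (\<forall>x\<in>S. \<forall>\<^sub>F (x', y) in uniformity. x' = x \<longrightarrow> y \<in> S)"
    by (simp only: open_cdual_def)
  show "norm f = 0 \<longleftrightarrow> f = 0"
    by transfer (auto simp: onorm_eq_0)
  show "norm (f + g) \<le> norm f + norm g"
    by transfer (auto intro: onorm_triangle)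
  show norm_C: "norm (c *\<^sub>C f) = cmod c * norm f" for c
  proof transfer
    fix c :: complex and f :: "'a \<Rightarrow> complex"
    assume "bounded_linear f \<and> Vector_Spaces.linear (*\<^sub>C) (*) f"
    then have f: "bounded_linear f" by simp
    have le: "onorm (\<lambda>x. c * g x) \<le> cmod c * onorm g"
      if g: "bounded_linear g" for c and g :: "'a \<Rightarrow> complex"
      using onorm[OF g] onorm_pos_le[OF g]
      by (intro onorm_bound) (auto simp: norm_mult mult.assoc intro: mult_left_mono)
    show "onorm (\<lambda>x. c * f x) = cmod c * onorm f"
    proof (cases "c = 0")
      case False
      have "onorm (\<lambda>x. inverse c * (c * f x)) \<le> cmod (inverse c) * onorm (\<lambda>x. c * f x)"
        by (rule le[OF bounded_linear_const_mult[OF f]])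
      then have "cmod c * onorm f \<le> onorm (\<lambda>x. c * f x)"
        using False by (simp add: mult.assoc[symmetric] norm_inverse norm_divide field_simps)
      with le[OF f, of c] show ?thesis by simp
    qed (simp add: onorm_zero)
  qed
  have "r *\<^sub>R f = complex_of_real r *\<^sub>C f"
    by (transfer, simp)
  then show "norm (r *\<^sub>R f) = \<bar>r\<bar> * norm f"
    using norm_C[of "complex_of_real r"] by simp
qed

end

lemma cdual_apply_plus: "cdual_apply (f + g) x = cdual_apply f x + cdual_apply g x"
  by transfer simp

lemma cdual_apply_minus: "cdual_apply (f - g) x = cdual_apply f x - cdual_apply g x"
  by transfer simp

lemma scaleC_cdual_apply: "cdual_apply (c *\<^sub>C f) x = c * cdual_apply f x"
  by transfer simp

lemma norm_cdual_apply: "cmod (cdual_apply f x) \<le> norm f * norm x"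
  by transfer (simp add: onorm)

lemma norm_cdual_le:
  assumes "0 \<le> K" "\<And>x. cmod (cdual_apply f x) \<le> K * norm x"
  shows "norm f \<le> K"
  using assms by transfer (rule onorm_bound)

instance cdual :: (complex_normed_vector) banach
proof
  fix X :: "nat \<Rightarrow> 'a cdual"
  assume X: "Cauchy X"
  define Y where "Y n = Blinfun (cdual_apply (X n))" for n
  have Y: "blinfun_apply (Y n) = cdual_apply (X n)" for n
    by (simp add: Y_def bounded_linear_Blinfun_apply cdual_apply_bounded_linear)
  have "norm (Y m - Y n) \<le> norm (X m - X n)" for m n
    using norm_cdual_apply[of "X m - X n"]
    by (intro norm_blinfun_bound) (auto simp: blinfun.diff_left Y cdual_apply_minus)
  then have "Cauchy Y"
    using X unfolding Cauchy_def dist_norm by (meson le_less_trans)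
  then obtain l where l: "Y \<longlonglongrightarrow> l"
    using Cauchy_convergent convergent_def by blast
  have lim: "(\<lambda>n. cdual_apply (X n) x) \<longlonglongrightarrow> blinfun_apply l x" for x
    using blinfun.tendsto[OF l tendsto_const[of x]] by (simp add: Y)
  define L where "L = Abs_cdual (blinfun_apply l)"
  have L: "cdual_apply L = blinfun_apply l"
    unfolding L_def
  proof (rule Abs_cdual_apply)
    show "blinfun_apply l (x + y) = blinfun_apply l x + blinfun_apply l y" for x y
      by (rule blinfun.add_right)
    show "blinfun_apply l (c *\<^sub>C x) = c * blinfun_apply l x" for c x
    proof (rule LIMSEQ_unique[OF lim])
      show "(\<lambda>n. cdual_apply (X n) (c *\<^sub>C x)) \<longlonglongrightarrow> c * blinfun_apply l x"
        unfolding cdual_apply_scaleC by (rule tendsto_mult[OF tendsto_const lim])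
    qed
    show "cmod (blinfun_apply l x) \<le> norm x * norm l" for x
      using norm_blinfun[of l x] by (simp add: mult.commute)
  qed
  have "norm (X n - L) \<le> norm (Y n - l)" for n
    using norm_blinfun[of "Y n - l"]
    by (intro norm_cdual_le) (auto simp: cdual_apply_minus L Y blinfun.diff_left)
  then have "(\<lambda>n. norm (X n - L)) \<longlonglongrightarrow> 0"
    using tendsto_norm_zero[OF LIM_zero[OF l]]
    by (rule_tac tendsto_sandwich[OF _ _ tendsto_const]) (auto intro!: always_eventually)
  then have "X \<longlonglongrightarrow> L"
    by (rule LIM_zero_cancel[OF tendsto_norm_zero_cancel])
  then show "convergent X"
    by (rule convergentI)
qed

definition bidual_embed :: "'m::complex_normed_vector \<Rightarrow> 'm cdual cdual"
  where "bidual_embed x = Abs_cdual (\<lambda>f. cdual_apply f x)"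

lemma bidual_embed_apply: "cdual_apply (bidual_embed x) f = cdual_apply f x"
proof -
  have "cdual_apply (Abs_cdual (\<lambda>f. cdual_apply f x)) = (\<lambda>f. cdual_apply f x)"
    by (rule Abs_cdual_apply[where K = "norm x"])
      (simp_all add: cdual_apply_plus scaleC_cdual_apply norm_cdual_apply)
  then show ?thesis by (simp add: bidual_embed_def)
qed


section \<open>Banach bimodules\<close>

text \<open>
  The actions are only required to be jointly continuous, i.e. bounded by some constant \<open>K\<close>;
  this includes the contractive case \<open>K = 1\<close>.
\<close>

locale banach_bimodule =
  fixes lact :: "'a::complex_banach_algebra \<Rightarrow> 'm::{complex_normed_vector, banach} \<Rightarrow> 'm"
    and ract :: "'m \<Rightarrow> 'a \<Rightarrow> 'm"
  assumes lact_linear_left: "\<And>x. clinear (\<lambda>a. lact a x)"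
    and lact_linear_right: "\<And>a. clinear (lact a)"
    and ract_linear_left: "\<And>a. clinear (\<lambda>x. ract x a)"
    and ract_linear_right: "\<And>x. clinear (ract x)"
    and lact_mult: "\<And>a b x. lact (a * b) x = lact a (lact b x)"
    and ract_mult: "\<And>a b x. ract x (a * b) = ract (ract x a) b"
    and lact_ract: "\<And>a b x. ract (lact a x) b = lact a (ract x b)"
    and lact_bounded: "\<exists>K. \<forall>a x. norm (lact a x) \<le> K * norm a * norm x"
    and ract_bounded: "\<exists>K. \<forall>a x. norm (ract x a) \<le> K * norm x * norm a"

text \<open>
  The dual bimodule has \<open>(a f)(x) = f(x a)\<close> and \<open>(f a)(x) = f(a x)\<close>: each action on the dual
  comes from the opposite action on the module.
\<close>

definition dual_lact ::
    "('m::complex_normed_vector \<Rightarrow> 'a \<Rightarrow> 'm) \<Rightarrow> 'a \<Rightarrow> 'm cdual \<Rightarrow> 'm cdual"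
  where "dual_lact ract a f = Abs_cdual (\<lambda>x. cdual_apply f (ract x a))"

definition dual_ract ::
    "('a \<Rightarrow> 'm::complex_normed_vector \<Rightarrow> 'm) \<Rightarrow> 'm cdual \<Rightarrow> 'a \<Rightarrow> 'm cdual"
  where "dual_ract lact f a = Abs_cdual (\<lambda>x. cdual_apply f (lact a x))"

definition bidual_lact ::
    "('a \<Rightarrow> 'm::complex_normed_vector \<Rightarrow> 'm) \<Rightarrow> 'a \<Rightarrow> 'm cdual cdual \<Rightarrow> 'm cdual cdual"
  where "bidual_lact lact = dual_lact (dual_ract lact)"

definition bidual_ract ::
    "('m::complex_normed_vector \<Rightarrow> 'a \<Rightarrow> 'm) \<Rightarrow> 'm cdual cdual \<Rightarrow> 'a \<Rightarrow> 'm cdual cdual"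
  where "bidual_ract ract = dual_ract (dual_lact ract)"

lemma clinearI:
  fixes f :: "'a::complex_normed_vector \<Rightarrow> 'b::complex_normed_vector"
  assumes "\<And>x y. f (x + y) = f x + f y" "\<And>c x. f (c *\<^sub>C x) = c *\<^sub>C f x"
  shows "clinear f"
  by (simp add: Vector_Spaces.linear_iff assms vector_space_scaleC)

lemma clinear_add: "clinear f \<Longrightarrow> f (x + y) = f x + f y"
  by (auto simp: Vector_Spaces.linear_iff)

lemma clinear_scaleC: "clinear f \<Longrightarrow> f (c *\<^sub>C x) = c *\<^sub>C f x"
  by (auto simp: Vector_Spaces.linear_iff)

context banach_bimodule
begin

lemma lact_bound: "\<exists>K\<ge>0. \<forall>a x. norm (lact a x) \<le> K * norm a * norm x"
proof -
  obtain K where K: "norm (lact a x) \<le> K * norm a * norm x" for a x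
    using lact_bounded by blast
  have "norm (lact a x) \<le> \<bar>K\<bar> * norm a * norm x" for a x
    using K[of a x] by (rule order_trans) (intro mult_right_mono, auto)
  then show ?thesis by (intro exI[of _ "\<bar>K\<bar>"]) simp
qed

lemma ract_bound: "\<exists>K\<ge>0. \<forall>a x. norm (ract x a) \<le> K * norm x * norm a"
proof -
  obtain K where K: "norm (ract x a) \<le> K * norm x * norm a" for a x
    using ract_bounded by blast
  have "norm (ract x a) \<le> \<bar>K\<bar> * norm x * norm a" for a x
    using K[of x a] by (rule order_trans) (intro mult_right_mono, auto)
  then show ?thesis by (intro exI[of _ "\<bar>K\<bar>"]) simp
qed

lemma dual_lact_apply: "cdual_apply (dual_lact ract a f) x = cdual_apply f (ract x a)"
proof -
  obtain K where K: "K \<ge> 0" "\<And>a x. norm (ract x a) \<le> K * norm x * norm a"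
    using ract_bound by blast
  have "cdual_apply (Abs_cdual (\<lambda>x. cdual_apply f (ract x a))) = (\<lambda>x. cdual_apply f (ract x a))"
  proof (rule Abs_cdual_apply)
    show "cmod (cdual_apply f (ract x a)) \<le> norm x * (norm f * K * norm a)" for x
      using order_trans[OF norm_cdual_apply mult_left_mono[OF K(2) norm_ge_zero]]
      by (simp add: algebra_simps)
  qed (simp_all add: clinear_add[OF ract_linear_left] clinear_scaleC[OF ract_linear_left]
        cdual_apply_add cdual_apply_scaleC)
  then show ?thesis by (simp add: dual_lact_def)
qed

lemma dual_ract_apply: "cdual_apply (dual_ract lact f a) x = cdual_apply f (lact a x)"
proof -
  obtain K where K: "K \<ge> 0" "\<And>a x. norm (lact a x) \<le> K * norm a * norm x"
    using lact_bound by blast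
  have "cdual_apply (Abs_cdual (\<lambda>x. cdual_apply f (lact a x))) = (\<lambda>x. cdual_apply f (lact a x))"
  proof (rule Abs_cdual_apply)
    show "cmod (cdual_apply f (lact a x)) \<le> norm x * (norm f * K * norm a)" for x
      using order_trans[OF norm_cdual_apply mult_left_mono[OF K(2) norm_ge_zero]]
      by (simp add: algebra_simps)
  qed (simp_all add: clinear_add[OF lact_linear_right] clinear_scaleC[OF lact_linear_right]
        cdual_apply_add cdual_apply_scaleC)
  then show ?thesis by (simp add: dual_ract_def)
qed

theorem dual_bimodule: "banach_bimodule (dual_lact ract) (dual_ract lact)"
proof (rule banach_bimodule.intro)
  show "clinear (\<lambda>a. dual_lact ract a f)" "clinear (dual_lact ract a)"
    "clinear (\<lambda>f. dual_ract lact f a)" "clinear (dual_ract lact f)" for a f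
    by (auto intro!: clinearI cdual_eqI simp: dual_lact_apply dual_ract_apply cdual_apply_plus
        scaleC_cdual_apply cdual_apply_add cdual_apply_scaleC
        clinear_add[OF ract_linear_right] clinear_scaleC[OF ract_linear_right]
        clinear_add[OF lact_linear_left] clinear_scaleC[OF lact_linear_left])
  show "dual_lact ract (a * b) f = dual_lact ract a (dual_lact ract b f)"
    "dual_ract lact f (a * b) = dual_ract lact (dual_ract lact f a) b"
    "dual_ract lact (dual_lact ract a f) b = dual_lact ract a (dual_ract lact f b)" for a b f
    by (auto intro!: cdual_eqI simp: dual_lact_apply dual_ract_apply ract_mult lact_mult lact_ract)
  obtain K where K: "K \<ge> 0" "\<And>a x. norm (ract x a) \<le> K * norm x * norm a"
    using ract_bound by blast
  have "norm (dual_lact ract a f) \<le> K * norm a * norm f" for a f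
  proof (rule norm_cdual_le)
    show "cmod (cdual_apply (dual_lact ract a f) x) \<le> K * norm a * norm f * norm x" for x
      unfolding dual_lact_apply
      using order_trans[OF norm_cdual_apply mult_left_mono[OF K(2) norm_ge_zero]]
      by (simp add: algebra_simps)
  qed (simp add: K(1))
  then show "\<exists>K. \<forall>a f. norm (dual_lact ract a f) \<le> K * norm a * norm f" by blast
  obtain K where K: "K \<ge> 0" "\<And>a x. norm (lact a x) \<le> K * norm a * norm x"
    using lact_bound by blast
  have "norm (dual_ract lact f a) \<le> K * norm f * norm a" for a f
  proof (rule norm_cdual_le)
    show "cmod (cdual_apply (dual_ract lact f a) x) \<le> K * norm f * norm a * norm x" for x
      unfolding dual_ract_apply
      using order_trans[OF norm_cdual_apply mult_left_mono[OF K(2) norm_ge_zero]]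
      by (simp add: algebra_simps)
  qed (simp add: K(1))
  then show "\<exists>K. \<forall>a f. norm (dual_ract lact f a) \<le> K * norm f * norm a" by blast
qed

theorem bidual_bimodule: "banach_bimodule (bidual_lact lact) (bidual_ract ract)"
  unfolding bidual_lact_def bidual_ract_def
  by (rule banach_bimodule.dual_bimodule[OF dual_bimodule])

lemma bidual_lact_apply:
  "cdual_apply (bidual_lact lact a \<xi>) f = cdual_apply \<xi> (dual_ract lact f a)"
  unfolding bidual_lact_def by (rule banach_bimodule.dual_lact_apply[OF dual_bimodule])

lemma bidual_ract_apply:
  "cdual_apply (bidual_ract ract \<xi> a) f = cdual_apply \<xi> (dual_lact ract a f)"
  unfolding bidual_ract_def by (rule banach_bimodule.dual_ract_apply[OF dual_bimodule])

theorem bidual_embed_lact: "bidual_lact lact a (bidual_embed x) = bidual_embed (lact a x)"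
  by (rule cdual_eqI) (simp add: bidual_lact_apply bidual_embed_apply dual_ract_apply)

theorem bidual_embed_ract: "bidual_ract ract (bidual_embed x) a = bidual_embed (ract x a)"
  by (rule cdual_eqI) (simp add: bidual_ract_apply bidual_embed_apply dual_lact_apply)

end


section \<open>Generalized derivations\<close>

definition generalized_derivation_second ::
    "('a::complex_banach_algebra \<Rightarrow> 'm::{complex_normed_vector, banach} \<Rightarrow> 'm) \<Rightarrow>
     ('m \<Rightarrow> 'a \<Rightarrow> 'm) \<Rightarrow> ('a \<Rightarrow> 'm) \<Rightarrow> bool"
  where "generalized_derivation_second lact ract F \<longleftrightarrow>
    clinear F \<and>
    (\<exists>\<xi> :: 'm cdual cdual. \<forall>a b.
      bidual_embed (F (a * b)) =
        bidual_embed (ract (F a) b) + bidual_embed (lact a (F b))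
          - bidual_lact lact a (bidual_ract ract \<xi> b))"

definition generalized_derivation_third ::
    "('a::complex_banach_algebra \<Rightarrow> 'm::{complex_normed_vector, banach} \<Rightarrow> 'm) \<Rightarrow>
     ('m \<Rightarrow> 'a \<Rightarrow> 'm) \<Rightarrow> ('a \<Rightarrow> 'm) \<Rightarrow> bool"
  where "generalized_derivation_third lact ract F \<longleftrightarrow>
    clinear F \<and>
    (\<exists>G H :: 'a \<Rightarrow> 'm. \<forall>a b. F (a * b) = ract (G a) b + lact a (H b))"

end

theory Submission
  imports Defs "HOL-Computational_Algebra.Polynomial"
begin

text \<open>
  The set \<open>J\<close> of all \<open>t\<close> such that \<open>z \<mapsto> F (s z)\<close> and \<open>z \<mapsto> F (z s)\<close> are bounded for both \<open>s = t\<close> and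
  \<open>s = adj t\<close> is a closed two-sided self-adjoint ideal. A gliding hump argument shows that a
  sequence of mutually orthogonal self-adjoint elements must meet \<open>J\<close>. Hence every self-adjoint
  element has finite spectrum modulo \<open>J\<close>, and \<open>A / J\<close> contains no infinite orthogonal sequence of
  projections, so it is spanned by finitely many corners \<open>e A f\<close> with \<open>e\<close>, \<open>f\<close> minimal, each at most
  one-dimensional. On \<open>J\<close> the bilinear map \<open>(t, z) \<mapsto> F (t z)\<close> is separately, hence jointly, bounded;
  factoring self-adjoint elements of \<open>J\<close> as products within \<open>J\<close> bounds \<open>F\<close> on \<open>J\<close>, and the finitely
  many corners extend the bound to \<open>A\<close>. Finally \<open>\<xi>\<close> is a weak-star cluster point of \<open>F\<close> along a
  bounded approximate unit. All of this rests on a continuous functional calculus obtained without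
  Gelfand theory: Chebyshev polynomials of a self-adjoint \<open>h\<close> of norm below \<open>1\<close> act contractively because
  \<open>h\<close> is the real part of a unitary multiplier.
\<close>

section \<open>Uniform boundedness on a closed subspace\<close>

text \<open>The obstacle is that \<open>G\<close> and \<open>H\<close> are arbitrary maps, neither
  linear nor continuous. They still help in two ways. Splitting a triple product in two ways removes
  them and leaves an identity in \<open>F\<close> alone, which makes \<open>J\<close> an ideal. And
  \<open>H s\<close> is one fixed vector for each \<open>s\<close>: if the \<open>a n\<close> are
  orthogonal and \<open>s\<close> is the sum of the \<open>a n * x n\<close>, then
  \<open>a n * s = a n * a n * x n\<close>, so \<open>F (a n * a n * x n)\<close> is
  \<open>ract (G (a n)) s + lact (a n) (H s)\<close>. Its size is governed by a constant of
  \<open>n\<close> and one constant of the sequence \<open>x\<close>; if all the maps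
  \<open>z \<mapsto> F (a n * a n * z)\<close> were unbounded, some \<open>x\<close> would beat
  both. The quotient by \<open>J\<close> is never built as an algebra: its projections and corners
  are handled through representatives and congruences, its spectra through the functions
  \<open>f\<close> with \<open>f(h)\<close> in \<open>J\<close>. Sequences orthogonal only modulo
  \<open>J\<close> are not lifted to orthogonal ones; a weighted series turns them into an infinite
  spectrum instead.\<close>

lemma uniform_boundedness:
  fixes T :: "'i \<Rightarrow> 'a::banach \<Rightarrow> 'b::real_normed_vector"
  assumes V: "subspace V" "closed V"
    and add: "\<And>i x y. i \<in> I \<Longrightarrow> x \<in> V \<Longrightarrow> y \<in> V \<Longrightarrow> T i (x + y) = T i x + T i y"
    and scale: "\<And>i c x. i \<in> I \<Longrightarrow> x \<in> V \<Longrightarrow> T i (c *\<^sub>R x) = c *\<^sub>R T i x"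
    and bounded: "\<And>i. i \<in> I \<Longrightarrow> \<exists>C. \<forall>x\<in>V. norm (T i x) \<le> C * norm x"
    and pointwise: "\<And>x. x \<in> V \<Longrightarrow> \<exists>C. \<forall>i\<in>I. norm (T i x) \<le> C"
  shows "\<exists>C\<ge>0. \<forall>i\<in>I. \<forall>x\<in>V. norm (T i x) \<le> C * norm x"
proof (rule ccontr)
  assume unbounded: "\<not> ?thesis"
  have diff: "T i (x - y) = T i x - T i y" if "i \<in> I" "x \<in> V" "y \<in> V" for i x y
    using add[OF that(1), of x "(-1) *\<^sub>R y"] scale[OF that(1,3), of "-1"] that V
    by (simp add: subspace_neg)
  \<comment> \<open>If all \<open>T i\<close> were bounded by \<open>m\<close> on a ball of
    \<open>V\<close> around \<open>x\<close>, differences with the centre would bound them uniformly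
    in every direction.\<close>
  have large: "\<exists>y\<in>V. \<exists>i\<in>I. norm (y - x) \<le> r \<and> norm (T i y) > m" if "x \<in> V" "r > 0" for x and r m :: real
  proof (rule ccontr)
    assume "\<not> ?thesis"
    then have m: "norm (T i y) \<le> m" if "y \<in> V" "i \<in> I" "norm (y - x) \<le> r" for y i
      using that by force
    have "norm (T i z) \<le> (2 * \<bar>m\<bar> / r) * norm z" if "i \<in> I" "z \<in> V" for i z
    proof (cases "z = 0")
      case True
      then show ?thesis using scale[OF that, of 0] by simp
    next
      case False
      define c where "c = r / norm z"
      have "c > 0" using False \<open>r > 0\<close> by (simp add: c_def)
      have cz: "c *\<^sub>R z \<in> V" "x + c *\<^sub>R z \<in> V"
        using V that \<open>x \<in> V\<close> by (auto simp: subspace_scale subspace_add)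
      have "norm (T i (c *\<^sub>R z)) = norm (T i (x + c *\<^sub>R z) - T i x)"
        using diff[of i "x + c *\<^sub>R z" x] cz that \<open>x \<in> V\<close> by simp
      also have "\<dots> \<le> norm (T i (x + c *\<^sub>R z)) + norm (T i x)" by (rule norm_triangle_ineq4)
      also have "\<dots> \<le> \<bar>m\<bar> + \<bar>m\<bar>"
        using m[of "x + c *\<^sub>R z" i] m[of x i] cz that \<open>x \<in> V\<close> \<open>r > 0\<close> False
        by (simp add: c_def)
      finally have "c * norm (T i z) \<le> 2 * \<bar>m\<bar>" using scale[OF that, of c] \<open>c > 0\<close> by simp
      then show ?thesis using \<open>r > 0\<close> False by (simp add: c_def field_simps)
    qed
    then show False using unbounded \<open>r > 0\<close> by (metis abs_ge_zero divide_nonneg_pos zero_le_mult_iff zero_le_numeral)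
  qed
  \<comment> \<open>A pair is a centre and a radius. From stage 1 on some \<open>T i\<close> exceeds
    \<open>n\<close> on the whole ball, so the common point of the nested balls contradicts
    \<open>pointwise\<close>.\<close>
  define Q where "Q n p \<longleftrightarrow> fst p \<in> V \<and> 0 < snd p \<and> snd p \<le> (1/2)^n \<and>
      (n > 0 \<longrightarrow> (\<exists>i\<in>I. \<forall>y\<in>V. norm (y - fst p) \<le> snd p \<longrightarrow> norm (T i y) > real n))"
    for n :: nat and p :: "'a \<times> real"
  have "\<exists>f. \<forall>n. Q n (f n) \<and> cball (fst (f (Suc n))) (snd (f (Suc n))) \<subseteq> cball (fst (f n)) (snd (f n))"
  proof (rule dependent_nat_choice)
    show "\<exists>p. Q 0 p"
      by (rule exI[of _ "(0, 1)"]) (use V in \<open>simp add: Q_def subspace_0\<close>)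
  next
    fix p n
    assume "Q n p"
    then have p: "fst p \<in> V" "0 < snd p" "snd p \<le> (1/2)^n" by (auto simp: Q_def)
    obtain y i where y: "y \<in> V" "i \<in> I" "norm (y - fst p) \<le> snd p / 2" "norm (T i y) > real (Suc n)"
      using large[OF p(1), of "snd p / 2" "real (Suc n)"] p(2) by auto
    obtain C where C: "\<And>x. x \<in> V \<Longrightarrow> norm (T i x) \<le> C * norm x" using bounded[OF y(2)] by blast
    \<comment> \<open>Within this distance the value of \<open>T i\<close> drops by at most half of
      its excess over \<open>Suc n\<close>; the \<open>+ 1\<close> keeps the denominator positive
      when \<open>C = 0\<close>.\<close>
    define \<delta> where "\<delta> = (norm (T i y) - real (Suc n)) / (2 * (\<bar>C\<bar> + 1))"
    have \<delta>: "\<delta> > 0" using y(4) by (simp add: \<delta>_def)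
    define s where "s = min \<delta> (snd p / 2)"
    have s: "0 < s" "s \<le> \<delta>" "s \<le> snd p / 2" using \<delta> p by (auto simp: s_def)
    have "norm (T i z) > real (Suc n)" if z: "z \<in> V" "norm (z - y) \<le> s" for z
    proof -
      have "norm (T i (y - z)) \<le> C * norm (y - z)" using C V y z by (simp add: subspace_diff)
      also have "\<dots> \<le> (\<bar>C\<bar> + 1) * \<delta>"
        using z(2) s(2) by (intro mult_mono) (auto simp: norm_minus_commute)
      also have "\<dots> = (norm (T i y) - real (Suc n)) / 2"
      proof -
        have half: "D * (x / (2 * D)) = x / 2" if "D > 0" for D x :: real using that by simp
        show ?thesis unfolding \<delta>_def by (rule half) (use abs_ge_zero[of C] in linarith)
      qed
      also have "\<dots> < norm (T i y) - real (Suc n)" using y(4) by simp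
      finally show ?thesis using norm_triangle_ineq2[of "T i y" "T i z"] unfolding diff[OF y(2,1) z(1)] by linarith
    qed
    moreover have "cball y s \<subseteq> cball (fst p) (snd p)"
    proof
      fix w assume "w \<in> cball y s"
      then show "w \<in> cball (fst p) (snd p)"
        using y(3) s dist_triangle[of "fst p" w y] by (simp add: dist_norm norm_minus_commute)
    qed
    ultimately show "\<exists>q. Q (Suc n) q \<and> cball (fst q) (snd q) \<subseteq> cball (fst p) (snd p)"
      using y s p by (intro exI[of _ "(y, s)"]) (auto simp: Q_def)
  qed
  then obtain f where f: "\<And>n. Q n (f n)"
    and nest: "\<And>n. cball (fst (f (Suc n))) (snd (f (Suc n))) \<subseteq> cball (fst (f n)) (snd (f n))"
    by blast
  define S where "S n = cball (fst (f n)) (snd (f n)) \<inter> V" for n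
  have "\<exists>a. \<forall>n. a \<in> S n"
  proof (rule decreasing_closed_nest)
    show "closed (S n)" for n using V(2) unfolding S_def by (intro closed_Int closed_cball)
    show "S n \<noteq> {}" for n using f[of n] by (force simp: S_def Q_def)
    show "S n \<subseteq> S m" if "m \<le> n" for m n
      using that by (rule lift_Suc_antimono_le[rotated]) (use nest in \<open>auto simp: S_def\<close>)
    show "\<exists>n. \<forall>x\<in>S n. \<forall>y\<in>S n. dist x y < e" if "e > 0" for e
    proof -
      have "\<exists>n. (1/2::real)^n < e / 2" using that by (intro real_arch_pow_inv) auto
      then obtain n where n: "(1/2::real)^n < e / 2" by blast
      have "dist x y < e" if "x \<in> S n" "y \<in> S n" for x y
        using that f[of n] n dist_triangle3[of x y "fst (f n)"] unfolding S_def Q_def by auto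
      then show ?thesis by blast
    qed
  qed blast
  then obtain a where a: "\<And>n. a \<in> S n" by blast
  then have "a \<in> V" by (auto simp: S_def)
  then obtain C where C: "\<And>i. i \<in> I \<Longrightarrow> norm (T i a) \<le> C" using pointwise by blast
  obtain n :: nat where n: "real n > \<bar>C\<bar>" using reals_Archimedean2 by blast
  then have "n > 0" by (cases n) auto
  then obtain i where "i \<in> I" "\<forall>y\<in>V. norm (y - fst (f n)) \<le> snd (f n) \<longrightarrow> norm (T i y) > real n"
    using f[of n] by (auto simp: Q_def)
  then have "norm (T i a) > real n" using a[of n] by (auto simp: S_def dist_norm norm_minus_commute)
  then show False using C[OF \<open>i \<in> I\<close>] n by linarith
qed

section \<open>Elementary facts on C*-algebras\<close>

lemma scaleC_zero [simp]:
  fixes x :: "'a::complex_normed_vector"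
  shows "0 *\<^sub>C x = 0" "c *\<^sub>C (0 :: 'a) = 0"
  using norm_scaleC[of 0 x] norm_scaleC[of c "0 :: 'a"] by simp_all

lemma scaleC_one [simp]: "1 *\<^sub>C (x :: 'a::complex_normed_vector) = x"
  using scaleR_scaleC[of 1 x] by simp

lemma scaleC_minus_right: "c *\<^sub>C (- x) = - (c *\<^sub>C (x :: 'a::complex_normed_vector))"
  using scaleC_add_right[of c x "- x"] by (simp add: eq_neg_iff_add_eq_0 add.commute)

lemma scaleC_minus_left: "(- c) *\<^sub>C x = - (c *\<^sub>C (x :: 'a::complex_normed_vector))"
  using scaleC_add_left[of c "- c" x] by (simp add: eq_neg_iff_add_eq_0 add.commute)

lemma scaleC_diff_right: "c *\<^sub>C (x - y) = c *\<^sub>C x - c *\<^sub>C (y :: 'a::complex_normed_vector)"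
  using scaleC_add_right[of c x "- y"] by (simp add: scaleC_minus_right)

lemma scaleC_scaleR: "c *\<^sub>C (r *\<^sub>R x) = r *\<^sub>R (c *\<^sub>C (x :: 'a::complex_normed_vector))"
  by (simp add: scaleR_scaleC scaleC_scaleC mult.commute)

declare adj_adj [simp] adj_add [simp] adj_mult [simp]

lemma adj_scaleR [simp]: "adj (r *\<^sub>R x) = r *\<^sub>R adj (x :: 'a::cstar_algebra)"
  by (simp add: scaleR_scaleC adj_scaleC)

lemma adj_zero [simp]: "adj (0 :: 'a::cstar_algebra) = 0"
  using adj_scaleR[of 0 0] by simp

lemma adj_minus [simp]: "adj (- x) = - adj (x :: 'a::cstar_algebra)"
  using adj_scaleR[of "-1" x] by simp

lemma adj_diff [simp]: "adj (x - y) = adj x - adj (y :: 'a::cstar_algebra)"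
  using adj_add[of x "- y"] by simp

lemma norm_adj [simp]: "norm (adj x) = norm (x :: 'a::cstar_algebra)"
proof -
  have le: "norm x \<le> norm (adj x)" for x :: 'a
  proof (cases "x = 0")
    case False
    have "norm x * norm x \<le> norm (adj x) * norm x"
      using norm_mult_ineq[of "adj x" x] by (simp add: norm_adj_mult power2_eq_square)
    then show ?thesis using False by simp
  qed simp
  show ?thesis using le[of x] le[of "adj x"] by simp
qed

lemma norm_mult_adj: "norm (x * adj x) = (norm (x :: 'a::cstar_algebra))\<^sup>2"
  using norm_adj_mult[of "adj x"] by simp

lemma bounded_linear_adj: "bounded_linear (adj :: 'a::cstar_algebra \<Rightarrow> 'a)"
  by (rule bounded_linear_intro[where K = 1]) auto

lemma adj_sum: "adj (sum f S) = (\<Sum>i\<in>S. adj (f i :: 'a::cstar_algebra))"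
  using linear_sum[OF bounded_linear.linear[OF bounded_linear_adj]] .

text \<open>Testing on \<open>adj x\<close> recovers the norm by the C*-identity. Thus estimates of
  left multiplication operators, the only place where a unit is at hand, become estimates of
  elements.\<close>

lemma norm_le_of_mult_left:
  fixes x :: "'a::cstar_algebra"
  assumes "0 \<le> M" "\<And>z. norm (x * z) \<le> M * norm z"
  shows "norm x \<le> M"
proof (cases "x = 0")
  case True
  then show ?thesis using \<open>0 \<le> M\<close> by simp
next
  case False
  have "norm x * norm x \<le> M * norm x"
    using assms(2)[of "adj x"] by (simp add: norm_mult_adj power2_eq_square)
  then show ?thesis using False by simp
qed

section \<open>Polynomials in a self-adjoint element\<close>

text \<open>
  Without a unit in the algebra, a polynomial in \<open>h\<close> is only an operator on it; the constant term
  acts as a multiple of the identity.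
\<close>

definition act_poly :: "('v::real_vector \<Rightarrow> 'v) \<Rightarrow> real poly \<Rightarrow> 'v \<Rightarrow> 'v"
  where "act_poly X p = fold_coeffs (\<lambda>a f z. a *\<^sub>R z + X (f z)) p (\<lambda>_. 0)"

lemma act_poly_0 [simp]: "act_poly X 0 z = 0"
  by (simp add: act_poly_def)

lemma act_poly_pCons [simp]:
  assumes "linear X"
  shows "act_poly X (pCons a p) z = a *\<^sub>R z + X (act_poly X p z)"
proof (cases "p = 0 \<and> a = 0")
  case True
  then show ?thesis using linear_0[OF assms] by simp
next
  case False
  then show ?thesis by (auto simp: act_poly_def)
qed

lemma act_poly_add:
  assumes "linear X"
  shows "act_poly X (p + q) z = act_poly X p z + act_poly X q z"
  by (induction p q rule: poly_induct2) (simp_all add: assms linear_add algebra_simps)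

lemma act_poly_smult:
  assumes "linear X"
  shows "act_poly X (smult c p) z = c *\<^sub>R act_poly X p z"
  by (induction p) (simp_all add: assms linear_add linear_scale algebra_simps)

lemma act_poly_diff:
  assumes "linear X"
  shows "act_poly X (p - q) z = act_poly X p z - act_poly X q z"
  using act_poly_add[OF assms, of "p - q" q z] by simp

lemma act_poly_mult:
  assumes "linear X"
  shows "act_poly X (p * q) z = act_poly X p (act_poly X q z)"
  by (induction p) (simp_all add: assms act_poly_add act_poly_smult)

lemma linear_act_poly:
  assumes "linear X"
  shows "linear (act_poly X p)"
proof (rule linearI)
  show "act_poly X p (x + y) = act_poly X p x + act_poly X p y" for x y
    by (induction p) (simp_all add: assms linear_add algebra_simps)
  show "act_poly X p (c *\<^sub>R x) = c *\<^sub>R act_poly X p x" for c x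
    by (induction p) (simp_all add: assms linear_add linear_scale algebra_simps)
qed

lemma act_poly_commute:
  assumes "linear X" "linear Y" "\<And>z. Y (X z) = X (Y z)"
  shows "Y (act_poly X p z) = act_poly X p (Y z)"
  by (induction p)
    (simp_all add: assms linear_0 linear_add[OF assms(2)] linear_scale[OF assms(2)])

lemma act_poly_pcompose_scale:
  assumes "linear X"
  shows "act_poly X (pcompose p [:0, r:]) z = act_poly (\<lambda>z. r *\<^sub>R X z) p z"
proof -
  have [simp]: "linear (\<lambda>z. r *\<^sub>R X z)"
    using assms by (intro linearI) (simp_all add: linear_add linear_scale algebra_simps)
  show ?thesis
    by (induction p)
      (simp_all add: pcompose_pCons assms act_poly_add act_poly_smult act_poly_mult linear_0 linear_scale)
qed

lemma linear_mult_left: "linear ((*) (h :: 'a::real_normed_algebra))"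
  by (intro linearI) (simp_all add: distrib_left)

lemma act_poly_real: "act_poly ((*) x) p z = poly p x * (z :: real)"
  by (induction p) (simp_all add: linear_mult_left distrib_right mult.assoc)

text \<open>
  Coefficients in the basis of Chebyshev polynomials. On coefficient sequences, multiplication by
  the variable is \<open>cheb_shift\<close>, since \<open>2 x T\<^sub>k = T\<^sub>k\<^sub>+\<^sub>1 + T\<^sub>k\<^sub>-\<^sub>1\<close> for \<open>k \<ge> 1\<close> and \<open>x T\<^sub>0 = T\<^sub>1\<close>.
\<close>

definition cheb_shift :: "(nat \<Rightarrow> real) \<Rightarrow> nat \<Rightarrow> real"
  where "cheb_shift b k =
    (if k = 0 then b 1 / 2 else if k = 1 then b 0 + b 2 / 2 else (b (k - 1) + b (k + 1)) / 2)"

lemma sum_cheb_shift: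
  assumes X: "linear X" "X (T 0) = T 1" "\<And>k. X (T (Suc k)) = (1/2) *\<^sub>R (T (Suc (Suc k)) + T k)"
    and b: "\<And>k. k > n \<Longrightarrow> b k = 0"
  shows "X (\<Sum>k\<le>n. b k *\<^sub>R T k) = (\<Sum>k\<le>Suc n. cheb_shift b k *\<^sub>R T k)"
proof -
  have "X (\<Sum>k\<le>n. b k *\<^sub>R T k) = (\<Sum>k\<le>n. b k *\<^sub>R X (T k))"
    by (simp add: linear_sum[OF X(1)] linear_scale[OF X(1)])
  also have "\<dots> = (\<Sum>k\<le>Suc n. b k *\<^sub>R X (T k))" using b by simp
  also have "\<dots> = b 0 *\<^sub>R T 1 + (\<Sum>k\<le>n. (b (Suc k) / 2) *\<^sub>R (T (Suc (Suc k)) + T k))"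
    by (subst sum.atMost_Suc_shift) (simp add: X)
  also have "\<dots> = b 0 *\<^sub>R T 1 + (\<Sum>k\<le>n. (b (Suc k) / 2) *\<^sub>R T (Suc (Suc k)))
      + (\<Sum>k\<le>n. (b (Suc k) / 2) *\<^sub>R T k)"
    by (simp add: scaleR_add_right sum.distrib)
  also have "(\<Sum>k\<le>n. (b (Suc k) / 2) *\<^sub>R T k) = (\<Sum>k\<le>Suc n. (b (Suc k) / 2) *\<^sub>R T k)"
    using b by simp
  also have "b 0 *\<^sub>R T 1 + (\<Sum>k\<le>n. (b (Suc k) / 2) *\<^sub>R T (Suc (Suc k)))
      = (\<Sum>k\<le>Suc n. (if k = 0 then 0 else if k = 1 then b 0 else b (k - 1) / 2) *\<^sub>R T k)"
  proof (cases n)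
    case 0
    then show ?thesis using b by simp
  next
    case (Suc m)
    have "(\<Sum>k\<le>n. (b (Suc k) / 2) *\<^sub>R T (Suc (Suc k))) = (\<Sum>k\<le>m. (b (Suc k) / 2) *\<^sub>R T (Suc (Suc k)))"
      using Suc b by simp
    then show ?thesis unfolding Suc by (simp only: sum.atMost_Suc_shift[of _ "Suc m"] sum.atMost_Suc_shift[of _ m]) simp
  qed
  also have "\<dots> + (\<Sum>k\<le>Suc n. (b (Suc k) / 2) *\<^sub>R T k) = (\<Sum>k\<le>Suc n. cheb_shift b k *\<^sub>R T k)"
    unfolding sum.distrib[symmetric]
    by (intro sum.cong refl)
      (auto simp: cheb_shift_def scaleR_add_left[symmetric] add_divide_distrib numeral_2_eq_2)
  finally show ?thesis .
qed

text \<open>Horner's scheme carried out in the Chebyshev basis.\<close>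

definition cheb_coeff :: "real poly \<Rightarrow> nat \<Rightarrow> real"
  where "cheb_coeff p =
    fold_coeffs (\<lambda>a b k. (if k = 0 then a else 0) + cheb_shift b k) p (\<lambda>_. 0)"

lemma cheb_coeff_0 [simp]: "cheb_coeff 0 k = 0"
  by (simp add: cheb_coeff_def)

lemma cheb_coeff_pCons:
  "cheb_coeff (pCons a p) k = (if k = 0 then a else 0) + cheb_shift (cheb_coeff p) k"
proof (cases "p = 0 \<and> a = 0")
  case True
  then show ?thesis by (simp add: cheb_shift_def)
next
  case False
  then show ?thesis by (auto simp: cheb_coeff_def)
qed

lemma cheb_coeff_eq_0: "k > degree p \<Longrightarrow> cheb_coeff p k = 0"
proof (induction p arbitrary: k)
  case (pCons a p)
  show ?case
  proof (cases "p = 0")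
    case True
    then show ?thesis using pCons.prems by (auto simp: cheb_coeff_pCons cheb_shift_def)
  next
    case False
    then have "k > Suc (degree p)" using pCons.prems by simp
    then show ?thesis by (simp add: cheb_coeff_pCons cheb_shift_def pCons.IH)
  qed
qed simp

lemma act_poly_chebyshev:
  assumes X: "linear X" "X (T 0) = T 1" "\<And>k. X (T (Suc k)) = (1/2) *\<^sub>R (T (Suc (Suc k)) + T k)"
  shows "act_poly X p (T 0) = (\<Sum>k\<le>degree p. cheb_coeff p k *\<^sub>R T k)"
proof (induction p)
  case (pCons a p)
  show ?case
  proof (cases "p = 0")
    case True
    then show ?thesis using X(1) linear_0[OF X(1)] by (simp add: cheb_coeff_pCons cheb_shift_def)
  next
    case False
    have "act_poly X (pCons a p) (T 0) = a *\<^sub>R T 0 + (\<Sum>k\<le>Suc (degree p). cheb_shift (cheb_coeff p) k *\<^sub>R T k)"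
      using X pCons.IH by (simp del: sum.atMost_Suc add: sum_cheb_shift[OF X] cheb_coeff_eq_0)
    also have "a *\<^sub>R T 0 = (\<Sum>k\<le>Suc (degree p). (if k = 0 then a else 0) *\<^sub>R T k)"
      by (subst sum.atMost_Suc_shift) simp
    finally show ?thesis using False
      by (simp del: sum.atMost_Suc add: cheb_coeff_pCons sum.distrib[symmetric] scaleR_add_left)
  qed
qed simp

corollary poly_cos: "poly p (cos \<theta>) = (\<Sum>k\<le>degree p. cheb_coeff p k * cos (real k * \<theta>))"
proof -
  have "cos \<theta> * cos (real (Suc k) * \<theta>) = (1/2) *\<^sub>R (cos (real (Suc (Suc k)) * \<theta>) + cos (real k * \<theta>))" for k
    using cos_times_cos[of "real (Suc k) * \<theta>" \<theta>] by (simp add: algebra_simps)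
  then show ?thesis
    using act_poly_chebyshev[of "(*) (cos \<theta>)" "\<lambda>k. cos (real k * \<theta>)" p]
    by (simp add: linear_mult_left act_poly_real)
qed

text \<open>The sum is the real part of a geometric sum of powers of an \<open>n\<close>-th root of
  unity other than 1.\<close>

lemma sum_cos_equidistant:
  assumes "0 < m" "m < n"
  shows "(\<Sum>j<n. cos (real m * (2 * pi * real j / real n))) = 0"
proof -
  define w where "w = cis (2 * pi * real m / real n)"
  have "w \<noteq> 1"
  proof
    assume "w = 1"
    then have "cos (2 * pi * real m / real n) = 1" by (simp add: w_def complex_eq_iff)
    then obtain k :: int where k: "2 * pi * real m / real n = of_int k * 2 * pi"
      unfolding cos_one_2pi_int by blast
    then have "(2 * pi) * (real m / real n) = (2 * pi) * of_int k" by (simp add: mult_ac)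
    then have "real m / real n = of_int k" by (subst (asm) mult_cancel_left) simp
    moreover have "0 < real m / real n" "real m / real n < 1" using assms by auto
    ultimately show False by simp
  qed
  have "w ^ n = cis (real n * (2 * pi * real m / real n))" by (simp only: w_def Complex.DeMoivre)
  also have "real n * (2 * pi * real m / real n) = 2 * pi * real m" using assms by simp
  also have "cis (2 * pi * real m) = 1" by (rule cis_multiple_2pi) simp
  finally have "w ^ n = 1" .
  have "(\<Sum>j<n. w ^ j) = 0"
    using \<open>w \<noteq> 1\<close> \<open>w ^ n = 1\<close> by (simp add: geometric_sum)
  then have "Re (\<Sum>j<n. w ^ j) = 0" by simp
  then show ?thesis by (simp add: w_def Complex.DeMoivre algebra_simps)
qed

text \<open>Discrete orthogonality of cosines exhibits the coefficient as an average of
  \<open>poly p (cos \<theta>) * cos (k * \<theta>)\<close> over equidistant nodes, doubled for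
  \<open>k > 0\<close> because the mean of a squared cosine is 1/2.\<close>

lemma cheb_coeff_bound:
  assumes M: "\<And>t. \<bar>t\<bar> \<le> 1 \<Longrightarrow> \<bar>poly p t\<bar> \<le> M"
  shows "\<bar>cheb_coeff p k\<bar> \<le> 2 * M"
proof (cases "k \<le> degree p")
  case False
  then show ?thesis using M[of 0] by (simp add: cheb_coeff_eq_0)
next
  case k: True
  define d where "d = degree p"
  \<comment> \<open>With \<open>k\<close> and \<open>l\<close> at most \<open>d\<close>, the
    frequency \<open>k + l\<close> stays below \<open>n\<close>, so distinct cosines do not
    alias.\<close>
  define n where "n = 2 * d + 1"
  define \<theta> where "\<theta> j = 2 * pi * real j / real n" for j
  define S where "S m = (\<Sum>j<n. cos (real m * \<theta> j))" for m
  have S: "S m = (if m = 0 then real n else 0)" if "m < n" for m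
    using sum_cos_equidistant[of m n] that by (auto simp: S_def \<theta>_def)
  have cc: "(\<Sum>j<n. cos (real k * \<theta> j) * cos (real l * \<theta> j)) =
      (if l = k then (if k = 0 then real n else real n / 2) else 0)" if l: "l \<le> d" for l
  proof -
    have "cos (real k * \<theta> j) * cos (real l * \<theta> j) =
        (cos (real (max k l - min k l) * \<theta> j) + cos (real (k + l) * \<theta> j)) / 2" for j
    proof (cases "k \<le> l")
      case True
      then show ?thesis using cos_times_cos[of "real l * \<theta> j" "real k * \<theta> j"]
        by (simp add: of_nat_diff algebra_simps)
    next
      case False
      then show ?thesis using cos_times_cos[of "real k * \<theta> j" "real l * \<theta> j"]
        by (simp add: of_nat_diff algebra_simps)
    qed
    then have "(\<Sum>j<n. cos (real k * \<theta> j) * cos (real l * \<theta> j)) = (S (max k l - min k l) + S (k + l)) / 2"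
      by (simp only: S_def sum_divide_distrib[symmetric] sum.distrib)
    then show ?thesis
      using S[of "max k l - min k l"] S[of "k + l"] k l
      by (auto simp: n_def d_def max_def min_def split: if_splits)
  qed
  have "(\<Sum>j<n. cos (real k * \<theta> j) * poly p (cos (\<theta> j))) =
      (\<Sum>l\<le>d. cheb_coeff p l * (\<Sum>j<n. cos (real k * \<theta> j) * cos (real l * \<theta> j)))"
    unfolding poly_cos d_def[symmetric] sum_distrib_left
    by (subst sum.swap) (simp add: mult.left_commute)
  also have "\<dots> = (\<Sum>l\<le>d. if l = k then cheb_coeff p k * (if k = 0 then real n else real n / 2) else 0)"
    by (intro sum.cong refl) (simp add: cc)
  also have "\<dots> = cheb_coeff p k * (if k = 0 then real n else real n / 2)"
    using k by (simp add: d_def)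
  finally have eq: "cheb_coeff p k * (if k = 0 then real n else real n / 2) =
      (\<Sum>j<n. cos (real k * \<theta> j) * poly p (cos (\<theta> j)))" ..
  have "\<bar>\<Sum>j<n. cos (real k * \<theta> j) * poly p (cos (\<theta> j))\<bar> \<le> (\<Sum>j<n. M)"
  proof (rule order_trans[OF sum_abs sum_mono])
    fix j
    show "\<bar>cos (real k * \<theta> j) * poly p (cos (\<theta> j))\<bar> \<le> M"
      using mult_mono[OF abs_cos_le_one[of "real k * \<theta> j"] M[OF abs_cos_le_one[of "\<theta> j"]]]
      by (simp add: abs_mult)
  qed
  then have "\<bar>cheb_coeff p k\<bar> * (if k = 0 then real n else real n / 2) \<le> real n * M"
    unfolding eq[symmetric] by (simp add: abs_mult split: if_splits)
  moreover have "0 \<le> M" using M[of 0] by simp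
  moreover have "real n > 0" by (simp add: n_def)
  ultimately show ?thesis by (cases "k = 0") (simp_all add: field_simps)
qed

section \<open>Continuous functional calculus\<close>

text \<open>Here \<open>k\<close> is 1 minus the square root of \<open>1 - h * h\<close>: unlike the
  root itself it lies in the algebra, and squaring \<open>1 - k\<close> gives the stated equation.
  It is the fixed point of \<open>k \<mapsto> (h * h + k * k) / 2\<close>, a contraction with
  constant \<open>norm h\<close> on the self-adjoint elements of norm at most \<open>norm h\<close>
  commuting with \<open>h\<close>.\<close>

lemma sqrt_one_minus_square:
  fixes h :: "'a::cstar_algebra"
  assumes h: "adj h = h" "norm h < 1"
  shows "\<exists>k. adj k = k \<and> h * k = k * h \<and> h * h + k * k = 2 *\<^sub>R k"
proof -
  define S where "S = {k :: 'a. adj k = k \<and> h * k = k * h \<and> norm k \<le> norm h}"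
  define \<phi> where "\<phi> k = (1/2) *\<^sub>R (h * h + k * k)" for k
  have "closed S"
    unfolding S_def
    by (intro closed_Collect_conj closed_Collect_eq closed_Collect_le continuous_intros
        linear_continuous_on bounded_linear_adj)
  then have "complete S" by (simp add: complete_eq_closed)
  moreover have "S \<noteq> {}" by (auto simp: S_def intro!: exI[of _ 0])
  moreover have "\<phi> ` S \<subseteq> S"
  proof safe
    fix k assume k: "k \<in> S"
    have "norm (\<phi> k) \<le> (1/2) * (norm h * norm h + norm k * norm k)"
      unfolding \<phi>_def using norm_triangle_ineq[of "h * h" "k * k"] norm_mult_ineq[of h h] norm_mult_ineq[of k k]
      by simp
    also have "\<dots> \<le> (1/2) * (norm h * 1 + norm h * 1)"
      using k h by (intro mult_left_mono add_mono mult_mono) (auto simp: S_def)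
    finally have "norm (\<phi> k) \<le> norm h" by simp
    moreover have "h * (k * k) = (k * k) * h"
      using k by (simp add: S_def) (metis mult.assoc)
    ultimately show "\<phi> k \<in> S"
      using k h by (simp add: S_def \<phi>_def algebra_simps)
  qed
  moreover have "dist (\<phi> x) (\<phi> y) \<le> norm h * dist x y" if "x \<in> S" "y \<in> S" for x y
  proof -
    have "\<phi> x - \<phi> y = (1/2) *\<^sub>R (x * (x - y) + (x - y) * y)"
      by (simp add: \<phi>_def algebra_simps)
    then have "norm (\<phi> x - \<phi> y) \<le> (1/2) * (norm x * norm (x - y) + norm (x - y) * norm y)"
      using norm_triangle_ineq[of "x * (x - y)" "(x - y) * y"] norm_mult_ineq[of x "x - y"]
        norm_mult_ineq[of "x - y" y] by simp
    also have "\<dots> \<le> (1/2) * (norm h * norm (x - y) + norm (x - y) * norm h)"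
      using that by (intro mult_left_mono add_mono mult_mono) (auto simp: S_def)
    finally show ?thesis by (simp add: dist_norm)
  qed
  ultimately have "\<exists>!k\<in>S. \<phi> k = k" using h(2) by (intro Banach_fix[of S "norm h" \<phi>]) simp_all
  then obtain k where k: "k \<in> S" "\<phi> k = k" by blast
  have "2 *\<^sub>R \<phi> k = h * h + k * k" by (simp add: \<phi>_def)
  then show ?thesis using k by (auto simp: S_def)
qed

text \<open>
  With \<open>s = (1 - h\<^sup>2)\<^sup>1\<^sup>/\<^sup>2\<close> the operators \<open>U = h + i s\<close> and \<open>V = h - i s\<close> are
  mutually inverse isometries, and \<open>T\<^sub>k(h) = (U\<^sup>k + V\<^sup>k) / 2\<close>.
\<close>

lemma chebyshev_sequence:
  fixes h z :: "'a::cstar_algebra"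
  assumes h: "adj h = h" "norm h < 1"
  obtains T where "T 0 = z" "\<And>k::nat. norm (T k) \<le> norm z" "h * T 0 = T 1"
    "\<And>k. h * T (Suc k) = (1/2) *\<^sub>R (T (Suc (Suc k)) + T k)"
proof -
  obtain k where k: "adj k = k" "h * k = k * h" "h * h + k * k = 2 *\<^sub>R k"
    using sqrt_one_minus_square[OF h] by blast
  \<comment> \<open>\<open>W c\<close> is multiplication by \<open>h + c (1 - k)\<close>, where
    \<open>1 - k\<close> plays the role of \<open>s\<close>.\<close>
  define W where "W c z = h * z + c *\<^sub>C (z - k * z)" for c z
  have W_inv: "W (-c) (W c z) = z" if "c * c = -1" for c z
  proof -
    have "W (-c) (W c z) = (h * h) * z - (c * c) *\<^sub>C (z - 2 *\<^sub>R k * z + (k * k) * z) - c *\<^sub>C ((h * k) * z - (k * h) * z)"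
      by (simp add: W_def algebra_simps scaleC_minus_left scaleC_add_right scaleC_diff_right
          scaleC_scaleC mult_scaleC_right mult_scaleC_left scaleR_2)
    also have "\<dots> = (h * h) * z + (z - 2 *\<^sub>R k * z + (k * k) * z)"
      by (simp add: that k scaleC_minus_left)
    also have "\<dots> = z + (h * h + k * k - 2 *\<^sub>R k) * z" by (simp add: algebra_simps)
    finally show ?thesis by (simp add: k)
  qed
  \<comment> \<open>For \<open>cnj c = - c\<close>, the adjoint of \<open>W c\<close> is its inverse
    \<open>W (-c)\<close>; the C*-identity then makes \<open>W c\<close> isometric.\<close>
  have W_norm: "norm (W c z) = norm z" if c: "c * c = -1" "cnj c = - c" for c z
  proof -
    have "adj (W c z) * w = adj z * W (-c) w" for w
      by (simp add: W_def algebra_simps h k(1) c adj_scaleC scaleC_minus_left mult_scaleC_left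
          mult_scaleC_right scaleC_diff_right)
    then have "adj (W c z) * W c z = adj z * z" by (simp add: W_inv c)
    then have "(norm (W c z))\<^sup>2 = (norm z)\<^sup>2"
      by (simp only: norm_adj_mult[symmetric])
    then show ?thesis by simp
  qed
  have ii: "\<i> * \<i> = -1" "cnj \<i> = - \<i>" "- \<i> * - \<i> = -1" "cnj (- \<i>) = - (- \<i>)" by simp_all
  define U where "U = W \<i>"
  define V where "V = W (- \<i>)"
  have UV: "U (V z) = z" "V (U z) = z" for z
    using W_inv[OF ii(1)] W_inv[OF ii(3)] by (simp_all add: U_def V_def)
  have norms: "norm (U z) = norm z" "norm (V z) = norm z" for z
    using W_norm[OF ii(1,2)] W_norm[OF ii(3,4)] by (simp_all add: U_def V_def)
  have hUV: "h * z = (1/2) *\<^sub>R (U z + V z)" for z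
    by (simp add: U_def V_def W_def scaleC_minus_left scaleR_2[symmetric])
  have pow_norms: "norm ((U ^^ n) z) = norm z" "norm ((V ^^ n) z) = norm z" for n z
    by (induction n) (simp_all add: norms)
  define T where "T n = (1/2) *\<^sub>R ((U ^^ n) z + (V ^^ n) z)" for n
  show ?thesis
  proof (rule that[of T])
    show "T 0 = z" by (simp add: T_def scaleR_2[symmetric])
    show "norm (T n) \<le> norm z" for n
      using norm_triangle_ineq[of "(U ^^ n) z" "(V ^^ n) z"] by (simp add: T_def pow_norms)
    show "h * T 0 = T 1" by (simp add: \<open>T 0 = z\<close> hUV T_def)
    show "h * T (Suc n) = (1/2) *\<^sub>R (T (Suc (Suc n)) + T n)" for n
    proof -
      have "h * T (Suc n) = (1/2) *\<^sub>R (h * (U ^^ Suc n) z + h * (V ^^ Suc n) z)"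
        by (simp add: T_def distrib_left)
      also have "\<dots> = (1/2) *\<^sub>R (T (Suc (Suc n)) + T n)"
        unfolding hUV by (simp add: T_def UV algebra_simps)
      finally show ?thesis .
    qed
  qed
qed

section \<open>The norm of a polynomial in a self-adjoint element\<close>

abbreviation act_elem :: "'a::cstar_algebra \<Rightarrow> real poly \<Rightarrow> 'a \<Rightarrow> 'a"
  where "act_elem h \<equiv> act_poly ((*) h)"

text \<open>A sum of \<open>degree p + 1\<close> Chebyshev terms, each with coefficient at most
  \<open>2 * M\<close> and a vector no longer than \<open>z\<close>.\<close>

lemma norm_act_elem_crude:
  fixes h z :: "'a::cstar_algebra"
  assumes h: "adj h = h" "norm h < 1"
    and M: "\<And>t. \<bar>t\<bar> \<le> 1 \<Longrightarrow> \<bar>poly p t\<bar> \<le> M"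
  shows "norm (act_elem h p z) \<le> 2 * real (degree p + 1) * M * norm z"
proof -
  obtain T where T: "T 0 = z" "\<And>k::nat. norm (T k) \<le> norm z" "h * T 0 = T 1"
    "\<And>k. h * T (Suc k) = (1/2) *\<^sub>R (T (Suc (Suc k)) + T k)"
    by (rule chebyshev_sequence[OF h, of z], rule that) assumption+
  have "act_elem h p z = (\<Sum>k\<le>degree p. cheb_coeff p k *\<^sub>R T k)"
    using act_poly_chebyshev[of "(*) h" T p] T by (simp add: linear_mult_left)
  also have "norm \<dots> \<le> (\<Sum>k\<le>degree p. 2 * M * norm z)"
    using T(2) cheb_coeff_bound[OF M]
    by (intro sum_norm_le) (auto intro!: mult_mono simp: M order_trans[OF abs_ge_zero cheb_coeff_bound[OF M]])
  finally show ?thesis by (simp add: algebra_simps)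
qed

lemma act_elem_mult_right: "act_elem h p x * w = act_elem h p (x * w)"
  by (induction p) (simp_all add: linear_mult_left distrib_right mult.assoc)

lemma adj_act_elem_mult:
  fixes h z w :: "'a::cstar_algebra"
  assumes "adj h = h"
  shows "adj (act_elem h p z) * w = adj z * act_elem h p w"
proof (induction p arbitrary: w)
  case (pCons a p)
  then show ?case
    using act_poly_commute[of "(*) h" "(*) h" p w]
    by (simp add: linear_mult_left distrib_left distrib_right assms mult.assoc act_elem_mult_right)
qed simp

text \<open>The operator \<open>p(h)\<close> is symmetric, so the C*-identity moves one factor
  across onto the other.\<close>

lemma norm_act_elem_square:
  fixes h z :: "'a::cstar_algebra"
  assumes "adj h = h"
  shows "(norm (act_elem h p z))\<^sup>2 \<le> norm z * norm (act_elem h (p * p) z)"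
proof -
  have "(norm (act_elem h p z))\<^sup>2 = norm (adj z * act_elem h (p * p) z)"
    by (simp add: norm_adj_mult[symmetric] adj_act_elem_mult[OF assms] act_poly_mult linear_mult_left)
  then show ?thesis using norm_mult_ineq[of "adj z"] by simp
qed

lemma exceeds_linear_growth:
  fixes q c :: real
  assumes q: "q > 1"
  obtains n0 :: nat where "\<And>n. n \<ge> n0 \<Longrightarrow> 2 * (real n * c + 1) < q ^ n"
proof -
  have lim: "(\<lambda>n. 2 * (c * (real n * (1/q)^n) + (1/q)^n)) \<longlonglongrightarrow> 2 * (c * 0 + 0)"
    using q by (intro tendsto_intros powser_times_n_limit_0 LIMSEQ_power_zero) auto
  then have "\<forall>\<^sub>F n in sequentially. 2 * (c * (real n * (1/q)^n) + (1/q)^n) < 1"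
    by (rule order_tendstoD) simp
  then obtain n0 where n0: "\<And>n. n \<ge> n0 \<Longrightarrow> 2 * (c * (real n * (1/q)^n) + (1/q)^n) < 1"
    unfolding eventually_sequentially by blast
  show ?thesis
  proof (rule that[of n0])
    fix n assume "n \<ge> n0"
    have "2 * (c * (real n * (1/q)^n) + (1/q)^n) * q ^ n < 1 * q ^ n"
      using n0[OF \<open>n \<ge> n0\<close>] q by (intro mult_strict_right_mono) auto
    moreover have "2 * (c * (real n * (1/q)^n) + (1/q)^n) * q ^ n = 2 * (real n * c + 1)"
      using q by (simp add: power_one_over field_simps)
    ultimately show "2 * (real n * c + 1) < q ^ n" by simp
  qed
qed

text \<open>
  The factor \<open>2 (degree p + 1)\<close> of the crude bound disappears by applying it to high
  powers of the polynomial.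
\<close>

lemma norm_act_elem_le_contraction:
  fixes h z :: "'a::cstar_algebra"
  assumes h: "adj h = h" "norm h < 1"
    and M: "\<And>t. \<bar>t\<bar> \<le> 1 \<Longrightarrow> \<bar>poly p t\<bar> \<le> M"
  shows "norm (act_elem h p z) \<le> M * norm z"
proof (rule ccontr)
  assume contra: "\<not> ?thesis"
  have "0 \<le> M" using M[of 0] by simp
  have "z \<noteq> 0" using contra linear_0[OF linear_act_poly[OF linear_mult_left], of h p] by auto
  define r where "r = norm (act_elem h p z) / norm z"
  have "r > M" using contra \<open>z \<noteq> 0\<close> by (simp add: r_def field_simps)
  \<comment> \<open>Every use of \<open>norm_act_elem_square\<close> doubles the exponent, hence the
    powers of two.\<close>
  have pow: "r ^ (2 ^ m) \<le> norm (act_elem h (p ^ (2 ^ m)) z) / norm z" for m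
  proof (induction m)
    case (Suc m)
    have "r ^ (2 ^ Suc m) = (r ^ (2 ^ m))\<^sup>2" by (simp add: power_mult[symmetric] mult.commute)
    also have "\<dots> \<le> (norm (act_elem h (p ^ (2 ^ m)) z) / norm z)\<^sup>2"
      using Suc \<open>0 \<le> M\<close> \<open>r > M\<close> by (intro power_mono) auto
    also have "\<dots> \<le> (norm z * norm (act_elem h (p ^ (2 ^ m) * p ^ (2 ^ m)) z)) / (norm z)\<^sup>2"
      unfolding power_divide using norm_act_elem_square[OF h(1)] by (intro divide_right_mono) auto
    also have "p ^ (2 ^ m) * p ^ (2 ^ m) = p ^ (2 ^ Suc m)"
      by (simp add: power_add[symmetric] mult_2)
    finally show ?case using \<open>z \<noteq> 0\<close> by (simp add: power2_eq_square)
  qed (simp add: r_def)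
  have crude: "r ^ (2 ^ m) \<le> 2 * (real (2 ^ m) * real (degree p) + 1) * M ^ (2 ^ m)" for m
  proof -
    have "\<bar>poly (p ^ (2 ^ m)) t\<bar> \<le> M ^ (2 ^ m)" if "\<bar>t\<bar> \<le> 1" for t
      using M[OF that] by (simp add: power_abs power_mono)
    then have "norm (act_elem h (p ^ (2 ^ m)) z) \<le> 2 * real (degree (p ^ (2 ^ m)) + 1) * M ^ (2 ^ m) * norm z"
      by (rule norm_act_elem_crude[OF h])
    then have "norm (act_elem h (p ^ (2 ^ m)) z) / norm z \<le> 2 * real (degree (p ^ (2 ^ m)) + 1) * M ^ (2 ^ m)"
      using \<open>z \<noteq> 0\<close> by (simp add: field_simps)
    also have "\<dots> \<le> 2 * real (2 ^ m * degree p + 1) * M ^ (2 ^ m)"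
    proof (intro mult_right_mono mult_left_mono)
      have "degree (p ^ (2 ^ m)) \<le> 2 ^ m * degree p"
        using degree_power_le[of p "2 ^ m"] by (simp only: mult.commute)
      then show "real (degree (p ^ (2 ^ m)) + 1) \<le> real (2 ^ m * degree p + 1)"
        by (simp only: of_nat_le_iff add_le_cancel_right)
    qed (use \<open>0 \<le> M\<close> in simp_all)
    also have "real (2 ^ m * degree p + 1) = real (2 ^ m) * real (degree p) + 1"
      by (simp only: of_nat_add of_nat_mult of_nat_1)
    finally show ?thesis using pow[of m] by (rule order_trans[rotated])
  qed
  show False
  proof (cases "M = 0")
    case True
    then show False using crude[of 0] \<open>r > M\<close> by simp
  next
    case False
    with \<open>0 \<le> M\<close> have "M > 0" by simp
    have "r / M > 1" using \<open>M > 0\<close> \<open>r > M\<close> by simp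
    then obtain n0 where n0: "\<And>n. n \<ge> n0 \<Longrightarrow> 2 * (real n * real (degree p) + 1) < (r / M) ^ n"
      by (rule exceeds_linear_growth[where c = "real (degree p)"]) blast
    have "n0 \<le> 2 ^ n0" using less_exp[of n0] by simp
    from n0[OF this] have "2 * (real (2 ^ n0) * real (degree p) + 1) < r ^ (2 ^ n0) / M ^ (2 ^ n0)"
      by (simp only: power_divide)
    then have "2 * (real (2 ^ n0) * real (degree p) + 1) * M ^ (2 ^ n0) < r ^ (2 ^ n0)"
      using \<open>M > 0\<close> by (simp only: pos_less_divide_eq zero_less_power)
    then show False using crude[of n0] by linarith
  qed
qed

lemma norm_act_elem_le:
  fixes h z :: "'a::cstar_algebra"
  assumes h: "adj h = h"
    and M: "\<And>t. \<bar>t\<bar> \<le> norm h + 1 \<Longrightarrow> \<bar>poly p t\<bar> \<le> M"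
  shows "norm (act_elem h p z) \<le> M * norm z"
proof -
  define R where "R = norm h + 1"
  have "R > 0" by (simp add: R_def add_nonneg_pos)
  define g where "g = (1/R) *\<^sub>R h"
  have "norm g < 1" using \<open>R > 0\<close> by (simp add: g_def R_def)
  have "(\<lambda>z. R *\<^sub>R (g * z)) = (*) h" using \<open>R > 0\<close> by (simp add: g_def)
  then have "act_elem h p z = act_elem g (pcompose p [:0, R:]) z"
    by (simp add: act_poly_pcompose_scale linear_mult_left)
  also have "norm \<dots> \<le> M * norm z"
  proof (rule norm_act_elem_le_contraction)
    fix t :: real assume "\<bar>t\<bar> \<le> 1"
    then have "\<bar>R * t\<bar> \<le> R * 1" unfolding abs_mult using \<open>R > 0\<close> by (intro mult_mono) auto
    then show "\<bar>poly (pcompose p [:0, R:]) t\<bar> \<le> M"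
      using M[of "R * t"] by (simp add: poly_pcompose R_def mult.commute)
  qed (use \<open>norm g < 1\<close> h in \<open>simp_all add: g_def\<close>)
  finally show ?thesis .
qed

text \<open>
  \<open>poly_elem h q\<close> is the value at \<open>h\<close> of the polynomial \<open>t q(t)\<close>; only polynomials without
  constant term have a value in a nonunital algebra.
\<close>

definition poly_elem :: "'a::cstar_algebra \<Rightarrow> real poly \<Rightarrow> 'a"
  where "poly_elem h q = act_elem h q h"

lemma poly_elem_mult: "poly_elem h q * z = act_elem h (pCons 0 q) z"
  by (simp add: poly_elem_def act_elem_mult_right linear_mult_left act_poly_commute)

lemma poly_elem_diff: "poly_elem h (p - q) = poly_elem h p - poly_elem h q"
  by (simp add: poly_elem_def act_poly_diff linear_mult_left)

lemma poly_elem_add: "poly_elem h (p + q) = poly_elem h p + poly_elem h q"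
  by (simp add: poly_elem_def act_poly_add linear_mult_left)

lemma poly_elem_smult: "poly_elem h (smult c p) = c *\<^sub>R poly_elem h p"
  by (simp add: poly_elem_def act_poly_smult linear_mult_left)

lemma poly_elem_prod: "poly_elem h p * poly_elem h q = poly_elem h (pCons 0 p * q)"
  by (simp only: poly_elem_mult) (simp only: poly_elem_def act_poly_mult[OF linear_mult_left])

lemma norm_poly_elem_mult_le:
  assumes h: "adj h = h"
    and M: "\<And>t. \<bar>t\<bar> \<le> norm h + 1 \<Longrightarrow> \<bar>c + t * poly q t\<bar> \<le> M"
  shows "norm (c *\<^sub>R z + poly_elem h q * z) \<le> M * norm z"
proof -
  have "c *\<^sub>R z + poly_elem h q * z = act_elem h (pCons c q) z"
    by (simp add: poly_elem_mult linear_mult_left)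
  also have "norm \<dots> \<le> M * norm z"
    using M by (intro norm_act_elem_le h) simp
  finally show ?thesis .
qed

lemma norm_poly_elem_le:
  assumes "adj h = h"
    and M: "\<And>t. \<bar>t\<bar> \<le> norm h + 1 \<Longrightarrow> \<bar>t * poly q t\<bar> \<le> M"
  shows "norm (poly_elem h q) \<le> M"
proof (rule norm_le_of_mult_left)
  show "0 \<le> M" using M[of 0] by simp
  show "norm (poly_elem h q * z) \<le> M * norm z" for z
    using norm_poly_elem_mult_le[OF assms(1), of 0 q M z] M by simp
qed

lemma poly_elem_in_subspace:
  assumes V: "subspace V" "h \<in> V" "\<And>y. y \<in> V \<Longrightarrow> h * y \<in> V"
  shows "poly_elem h q \<in> V"
  unfolding poly_elem_def
  by (induction q) (auto simp: linear_mult_left V subspace_0 subspace_add subspace_scale)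

lemma polynomial_approximation:
  fixes f :: "real \<Rightarrow> real"
  assumes f: "continuous_on UNIV f" "f 0 = 0" and e: "e > 0"
  shows "\<exists>q. \<forall>t. \<bar>t\<bar> \<le> R \<longrightarrow> \<bar>t * poly q t - f t\<bar> < e"
proof -
  \<comment> \<open>The absolute values keep \<open>0\<close> in \<open>S\<close> even for negative
    \<open>R\<close>.\<close>
  define S where "S = {- \<bar>R\<bar>..\<bar>R\<bar>}"
  have "\<exists>g. real_polynomial_function g \<and> (\<forall>x\<in>S. \<bar>f x - g x\<bar> < e / 2)"
  proof (rule Stone_Weierstrass_real_polynomial_function[of S f "e / 2"])
    show "compact S" by (simp add: S_def)
    show "continuous_on S f" using f(1) by (rule continuous_on_subset) simp
    show "0 < e / 2" using e by simp
  qed blast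
  then obtain g where g: "real_polynomial_function g" "\<And>x. x \<in> S \<Longrightarrow> \<bar>f x - g x\<bar> < e / 2" by blast
  obtain a n where gs: "g = (\<lambda>x. \<Sum>i\<le>n. a i * x ^ i)"
    using g(1) unfolding real_polynomial_function_iff_sum by blast
  define p where "p = (\<Sum>i\<le>n. monom (a i) i)"
  have p: "poly p = g" by (simp add: p_def gs fun_eq_iff poly_sum poly_monom)
  \<comment> \<open>Since \<open>f 0 = 0\<close>, the constant term is itself below
    \<open>e / 2\<close> and may be dropped.\<close>
  obtain c q where cq: "p = pCons c q" by (rule pCons_cases)
  have "g 0 = c" unfolding p[symmetric] cq by simp
  then have "\<bar>c\<bar> < e / 2" using g(2)[of 0] f(2) by (simp add: S_def)
  have "\<bar>t * poly q t - f t\<bar> < e" if "\<bar>t\<bar> \<le> R" for t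
  proof -
    have "t * poly q t = g t - c" unfolding p[symmetric] cq by simp
    moreover have "\<bar>f t - g t\<bar> < e / 2" using that by (intro g(2)) (auto simp: S_def)
    ultimately show ?thesis using \<open>\<bar>c\<bar> < e / 2\<close> by linarith
  qed
  then show ?thesis by blast
qed

text \<open>
  The value \<open>f(h)\<close>, meaningful for self-adjoint \<open>h\<close> and continuous \<open>f\<close> with \<open>f 0 = 0\<close>. The interval is
  larger than \<open>[-norm h, norm h]\<close> because \<open>chebyshev_sequence\<close> needs a norm below \<open>1\<close>.
\<close>

definition fun_calc :: "'a::cstar_algebra \<Rightarrow> (real \<Rightarrow> real) \<Rightarrow> 'a"
  where "fun_calc h f = (SOME x. \<forall>q M. (\<forall>t. \<bar>t\<bar> \<le> norm h + 1 \<longrightarrow> \<bar>t * poly q t - f t\<bar> \<le> M)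
      \<longrightarrow> norm (poly_elem h q - x) \<le> M)"

definition cont_null :: "(real \<Rightarrow> real) \<Rightarrow> bool"
  where "cont_null f \<longleftrightarrow> continuous_on UNIV f \<and> f 0 = 0"

text \<open>This justifies the choice made in \<open>fun_calc\<close>: the values of uniformly
  approximating polynomials form a Cauchy sequence, and its limit satisfies the inequality for all
  \<open>q\<close> and \<open>M\<close> at once.\<close>

lemma norm_poly_elem_diff_fun_calc:
  fixes h :: "'a::cstar_algebra"
  assumes h: "adj h = h" and f: "cont_null f"
    and M: "\<And>t. \<bar>t\<bar> \<le> norm h + 1 \<Longrightarrow> \<bar>t * poly q t - f t\<bar> \<le> M"
  shows "norm (poly_elem h q - fun_calc h f) \<le> M"
proof -
  have "\<exists>q. \<forall>n t. \<bar>t\<bar> \<le> norm h + 1 \<longrightarrow> \<bar>t * poly (q n) t - f t\<bar> < inverse (real (Suc n))"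
    using polynomial_approximation[of f "inverse (real (Suc n))" "norm h + 1" for n] f
    unfolding cont_null_def by (intro choice) simp
  then obtain q where q: "\<And>n t. \<bar>t\<bar> \<le> norm h + 1 \<Longrightarrow> \<bar>t * poly (q n) t - f t\<bar> < inverse (real (Suc n))"
    by blast
  have dist: "norm (poly_elem h p - poly_elem h (q n)) \<le> M + inverse (real (Suc n))"
    if p: "\<And>t. \<bar>t\<bar> \<le> norm h + 1 \<Longrightarrow> \<bar>t * poly p t - f t\<bar> \<le> M" for p M n
    unfolding poly_elem_diff[symmetric]
  proof (rule norm_poly_elem_le[OF h])
    fix t assume t: "\<bar>t\<bar> \<le> norm h + 1"
    show "\<bar>t * poly (p - q n) t\<bar> \<le> M + inverse (real (Suc n))"
      using p[OF t] q[OF t, of n] by (simp only: poly_diff right_diff_distrib)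
  qed
  have inv_lim: "(\<lambda>n. inverse (real (Suc n))) \<longlonglongrightarrow> 0" by (rule LIMSEQ_inverse_real_of_nat)
  have "Cauchy (\<lambda>n. poly_elem h (q n))"
  proof (rule CauchyI)
    fix e :: real assume "e > 0"
    then obtain N where N: "inverse (real (Suc N)) < e / 2"
      using reals_Archimedean[of "e / 2"] by auto
    have "norm (poly_elem h (q m) - poly_elem h (q n)) < e" if "m \<ge> N" "n \<ge> N" for m n
    proof -
      have le: "inverse (real (Suc k)) \<le> inverse (real (Suc N))" if "k \<ge> N" for k
        using that by simp
      have "norm (poly_elem h (q m) - poly_elem h (q n)) \<le> inverse (real (Suc m)) + inverse (real (Suc n))"
        by (rule dist, rule less_imp_le, rule q)
      then show ?thesis using le[OF that(1)] le[OF that(2)] N by linarith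
    qed
    then show "\<exists>N. \<forall>m\<ge>N. \<forall>n\<ge>N. norm (poly_elem h (q m) - poly_elem h (q n)) < e" by blast
  qed
  then obtain x where x: "(\<lambda>n. poly_elem h (q n)) \<longlonglongrightarrow> x"
    using Cauchy_convergent convergent_def by blast
  have "norm (poly_elem h p - x) \<le> M" if p: "\<And>t. \<bar>t\<bar> \<le> norm h + 1 \<Longrightarrow> \<bar>t * poly p t - f t\<bar> \<le> M" for p M
  proof (rule LIMSEQ_le)
    show "(\<lambda>n. norm (poly_elem h p - poly_elem h (q n))) \<longlonglongrightarrow> norm (poly_elem h p - x)"
      by (intro tendsto_intros x)
    show "(\<lambda>n. M + inverse (real (Suc n))) \<longlonglongrightarrow> M"
      using tendsto_add[OF tendsto_const inv_lim, of M] by simp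
    show "\<exists>N. \<forall>n\<ge>N. norm (poly_elem h p - poly_elem h (q n)) \<le> M + inverse (real (Suc n))"
      using dist[OF p] by blast
  qed
  then have "\<exists>x. \<forall>q M. (\<forall>t. \<bar>t\<bar> \<le> norm h + 1 \<longrightarrow> \<bar>t * poly q t - f t\<bar> \<le> M) \<longrightarrow> norm (poly_elem h q - x) \<le> M"
    by blast
  from someI_ex[OF this] show ?thesis using M unfolding fun_calc_def[symmetric] by blast
qed

lemma fun_calc_approximation:
  fixes h :: "'a::cstar_algebra"
  assumes h: "adj h = h" and f: "cont_null f" and "e > 0"
  obtains q where "\<And>t. \<bar>t\<bar> \<le> R \<Longrightarrow> \<bar>t * poly q t - f t\<bar> < e" "norm (poly_elem h q - fun_calc h f) \<le> e"
proof -
  obtain q where q: "\<And>t. \<bar>t\<bar> \<le> max R (norm h + 1) \<Longrightarrow> \<bar>t * poly q t - f t\<bar> < e"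
    using polynomial_approximation[of f e "max R (norm h + 1)"] f \<open>e > 0\<close> by (auto simp: cont_null_def)
  show ?thesis
  proof (rule that)
    show "norm (poly_elem h q - fun_calc h f) \<le> e"
      by (rule norm_poly_elem_diff_fun_calc[OF h f], rule less_imp_le, rule q) simp
  qed (simp add: q)
qed

text \<open>The interval of approximation grows with \<open>n\<close>. This adds pointwise
  convergence on the whole line, so that a point \<open>\<kappa>\<close> can be evaluated without
  first locating it in the interval.\<close>

lemma fun_calc_sequence:
  fixes h :: "'a::cstar_algebra"
  assumes h: "adj h = h" and f: "cont_null f"
  obtains q where "(\<lambda>n. poly_elem h (q n)) \<longlonglongrightarrow> fun_calc h f"
    "uniform_limit {-(norm h + 1)..norm h + 1} (\<lambda>n t. t * poly (q n) t) f sequentially"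
    "\<And>t. (\<lambda>n. t * poly (q n) t) \<longlonglongrightarrow> f t"
proof -
  have "\<exists>q. (\<forall>t. \<bar>t\<bar> \<le> norm h + 1 + real n \<longrightarrow> \<bar>t * poly q t - f t\<bar> < inverse (real (Suc n))) \<and>
      norm (poly_elem h q - fun_calc h f) \<le> inverse (real (Suc n))" for n
    by (rule fun_calc_approximation[OF h f, of "inverse (real (Suc n))" "norm h + 1 + real n"]) (auto simp del: of_nat_Suc)
  then have "\<exists>q. \<forall>n. (\<forall>t. \<bar>t\<bar> \<le> norm h + 1 + real n \<longrightarrow> \<bar>t * poly (q n) t - f t\<bar> < inverse (real (Suc n))) \<and>
      norm (poly_elem h (q n) - fun_calc h f) \<le> inverse (real (Suc n))"
    by (rule choice[OF allI])
  then obtain q where q: "\<And>n t. \<bar>t\<bar> \<le> norm h + 1 + real n \<Longrightarrow> \<bar>t * poly (q n) t - f t\<bar> < inverse (real (Suc n))"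
    and qn: "\<And>n. norm (poly_elem h (q n) - fun_calc h f) \<le> inverse (real (Suc n))"
    by blast
  have lim: "X \<longlonglongrightarrow> L" if "\<And>n. n \<ge> N \<Longrightarrow> norm (X n - L) \<le> inverse (real (Suc n))"
    for X :: "nat \<Rightarrow> 'b::real_normed_vector" and L N
    by (rule LIM_zero_cancel, rule tendsto_norm_zero_cancel,
        rule tendsto_sandwich[OF _ _ tendsto_const LIMSEQ_inverse_real_of_nat])
      (auto intro!: eventually_sequentiallyI[of N] that simp del: of_nat_Suc)
  show ?thesis
  proof (rule that[of q])
    show "(\<lambda>n. poly_elem h (q n)) \<longlonglongrightarrow> fun_calc h f" using qn by (rule lim)
    show "(\<lambda>n. t * poly (q n) t) \<longlonglongrightarrow> f t" for t
    proof -
      obtain N :: nat where "\<bar>t\<bar> \<le> real N" using real_arch_simple by blast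
      have "norm (t * poly (q n) t - f t) \<le> inverse (real (Suc n))" if "n \<ge> N" for n
      proof -
        have "real N \<le> real n" using that by simp
        then have "\<bar>t\<bar> \<le> norm h + 1 + real n" using \<open>\<bar>t\<bar> \<le> real N\<close> norm_ge_zero[of h] by linarith
        then show ?thesis using q[of t n] by (simp del: of_nat_Suc)
      qed
      then show ?thesis by (rule lim)
    qed
    show "uniform_limit {-(norm h + 1)..norm h + 1} (\<lambda>n t. t * poly (q n) t) f sequentially"
    proof (rule uniform_limitI)
      fix e :: real assume "e > 0"
      then obtain N where N: "inverse (real (Suc N)) < e" using reals_Archimedean by blast
      have "dist (t * poly (q n) t) (f t) < e" if "n \<ge> N" "t \<in> {-(norm h + 1)..norm h + 1}" for n t
      proof -
        have "\<bar>t * poly (q n) t - f t\<bar> < inverse (real (Suc n))" using that by (intro q) auto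
        also have "\<dots> \<le> inverse (real (Suc N))" using that by simp
        finally show ?thesis using N by (simp add: dist_real_def)
      qed
      then show "\<forall>\<^sub>F n in sequentially. \<forall>t\<in>{-(norm h + 1)..norm h + 1}. dist (t * poly (q n) t) (f t) < e"
        by (auto intro: eventually_sequentiallyI[of N])
    qed
  qed
qed

text \<open>Through this characterization the algebraic rules of the calculus are inherited from
  those of \<open>poly_elem\<close>.\<close>

lemma fun_calc_eqI:
  fixes h :: "'a::cstar_algebra"
  assumes h: "adj h = h" and f: "cont_null f"
    and x: "(\<lambda>n. poly_elem h (q n)) \<longlonglongrightarrow> x"
    and q: "uniform_limit {-(norm h + 1)..norm h + 1} (\<lambda>n t. t * poly (q n) t) f sequentially"
  shows "fun_calc h f = x"
proof (rule LIMSEQ_unique[OF _ x])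
  show "(\<lambda>n. poly_elem h (q n)) \<longlonglongrightarrow> fun_calc h f"
  proof (rule LIMSEQ_I)
    fix e :: real assume "e > 0"
    then have "\<forall>\<^sub>F n in sequentially. \<forall>t\<in>{-(norm h + 1)..norm h + 1}. dist (t * poly (q n) t) (f t) < e / 2"
      by (intro uniform_limitD[OF q]) auto
    then obtain N where "\<forall>n\<ge>N. \<forall>t\<in>{-(norm h + 1)..norm h + 1}. dist (t * poly (q n) t) (f t) < e / 2"
      unfolding eventually_sequentially by blast
    then have N: "\<bar>t * poly (q n) t - f t\<bar> < e / 2" if "n \<ge> N" "\<bar>t\<bar> \<le> norm h + 1" for n t
      using that unfolding dist_real_def by (simp add: abs_le_iff)
    have "norm (poly_elem h (q n) - fun_calc h f) \<le> e / 2" if "n \<ge> N" for n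
      by (rule norm_poly_elem_diff_fun_calc[OF h f], rule less_imp_le, rule N[OF that])
    then show "\<exists>no. \<forall>n\<ge>no. norm (poly_elem h (q n) - fun_calc h f) < e"
      using \<open>e > 0\<close> by (intro exI[of _ N]) force
  qed
qed

section \<open>Algebraic rules and norm estimates of the functional calculus\<close>

lemma cont_null_intros:
  "cont_null (\<lambda>t. t * poly q t)"
  "cont_null (\<lambda>t. t)"
  "cont_null f \<Longrightarrow> cont_null g \<Longrightarrow> cont_null (\<lambda>t. f t + g t)"
  "cont_null f \<Longrightarrow> cont_null g \<Longrightarrow> cont_null (\<lambda>t. f t - g t)"
  "cont_null f \<Longrightarrow> continuous_on UNIV g \<Longrightarrow> cont_null (\<lambda>t. f t * g t)"
  "continuous_on UNIV g \<Longrightarrow> cont_null f \<Longrightarrow> cont_null (\<lambda>t. g t * f t)"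
  "cont_null f \<Longrightarrow> cont_null (\<lambda>t. c * f t)"
  by (auto simp: cont_null_def intro!: continuous_intros)

lemma fun_calc_poly:
  fixes h :: "'a::cstar_algebra"
  assumes "adj h = h"
  shows "fun_calc h (\<lambda>t. t * poly q t) = poly_elem h q"
  by (rule fun_calc_eqI[OF assms cont_null_intros(1), of "\<lambda>_. q"]) (auto simp: uniform_limit_const)

lemma fun_calc_id:
  fixes h :: "'a::cstar_algebra"
  assumes "adj h = h"
  shows "fun_calc h (\<lambda>t. t) = h"
  using fun_calc_poly[OF assms, of 1] by (simp add: poly_elem_def linear_mult_left one_pCons)

lemma bounded_cont_null: "cont_null f \<Longrightarrow> bounded (f ` {a..b})"
  unfolding cont_null_def
  by (intro compact_imp_bounded compact_continuous_image) (auto intro: continuous_on_subset)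

context
  fixes h :: "'a::cstar_algebra"
  assumes h: "adj h = h"
begin

lemma fun_calc_add:
  assumes f: "cont_null f" and g: "cont_null g"
  shows "fun_calc h (\<lambda>t. f t + g t) = fun_calc h f + fun_calc h g"
proof -
  obtain p where p: "(\<lambda>n. poly_elem h (p n)) \<longlonglongrightarrow> fun_calc h f"
    "uniform_limit {-(norm h + 1)..norm h + 1} (\<lambda>n t. t * poly (p n) t) f sequentially"
    by (rule fun_calc_sequence[OF h f]) blast
  obtain q where q: "(\<lambda>n. poly_elem h (q n)) \<longlonglongrightarrow> fun_calc h g"
    "uniform_limit {-(norm h + 1)..norm h + 1} (\<lambda>n t. t * poly (q n) t) g sequentially"
    by (rule fun_calc_sequence[OF h g]) blast
  show ?thesis
  proof (rule fun_calc_eqI[OF h])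
    show "(\<lambda>n. poly_elem h (p n + q n)) \<longlonglongrightarrow> fun_calc h f + fun_calc h g"
      unfolding poly_elem_add by (intro tendsto_add p q)
    show "uniform_limit {-(norm h + 1)..norm h + 1} (\<lambda>n t. t * poly (p n + q n) t) (\<lambda>t. f t + g t) sequentially"
      using uniform_limit_add[OF p(2) q(2)] by (simp add: distrib_left)
  qed (intro cont_null_intros f g)
qed

lemma fun_calc_scale:
  assumes f: "cont_null f"
  shows "fun_calc h (\<lambda>t. c * f t) = c *\<^sub>R fun_calc h f"
proof -
  obtain p where p: "(\<lambda>n. poly_elem h (p n)) \<longlonglongrightarrow> fun_calc h f"
    "uniform_limit {-(norm h + 1)..norm h + 1} (\<lambda>n t. t * poly (p n) t) f sequentially"
    by (rule fun_calc_sequence[OF h f]) blast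
  show ?thesis
  proof (rule fun_calc_eqI[OF h])
    show "(\<lambda>n. poly_elem h (smult c (p n))) \<longlonglongrightarrow> c *\<^sub>R fun_calc h f"
      unfolding poly_elem_smult by (intro tendsto_intros p)
    show "uniform_limit {-(norm h + 1)..norm h + 1} (\<lambda>n t. t * poly (smult c (p n)) t) (\<lambda>t. c * f t) sequentially"
      using bounded_linear.uniform_limit[OF bounded_linear_mult_right[of c] p(2)]
      by (simp add: mult.left_commute)
  qed (intro cont_null_intros f)
qed

lemma fun_calc_diff:
  assumes f: "cont_null f" and g: "cont_null g"
  shows "fun_calc h (\<lambda>t. f t - g t) = fun_calc h f - fun_calc h g"
  using fun_calc_add[of "\<lambda>t. f t - g t" g] f g by (simp add: cont_null_intros)

lemma fun_calc_mult:
  assumes f: "cont_null f" and g: "cont_null g"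
  shows "fun_calc h (\<lambda>t. f t * g t) = fun_calc h f * fun_calc h g"
proof -
  obtain p where p: "(\<lambda>n. poly_elem h (p n)) \<longlonglongrightarrow> fun_calc h f"
    "uniform_limit {-(norm h + 1)..norm h + 1} (\<lambda>n t. t * poly (p n) t) f sequentially"
    by (rule fun_calc_sequence[OF h f]) blast
  obtain q where q: "(\<lambda>n. poly_elem h (q n)) \<longlonglongrightarrow> fun_calc h g"
    "uniform_limit {-(norm h + 1)..norm h + 1} (\<lambda>n t. t * poly (q n) t) g sequentially"
    by (rule fun_calc_sequence[OF h g]) blast
  show ?thesis
  proof (rule fun_calc_eqI[OF h])
    show "(\<lambda>n. poly_elem h (pCons 0 (p n) * q n)) \<longlonglongrightarrow> fun_calc h f * fun_calc h g"
      unfolding poly_elem_prod[symmetric] by (intro tendsto_mult p q)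
    show "uniform_limit {-(norm h + 1)..norm h + 1} (\<lambda>n t. t * poly (pCons 0 (p n) * q n) t)
        (\<lambda>t. f t * g t) sequentially"
      using uniform_lim_mult[OF p(2) q(2) bounded_cont_null[OF f] bounded_cont_null[OF g]]
      by (simp add: mult_ac)
  qed (use f g in \<open>intro cont_null_intros, simp_all add: cont_null_def\<close>)
qed

text \<open>The scalar \<open>c\<close> acts as a multiple of the identity; with
  \<open>c = 1\<close> this estimates operators such as \<open>1 - f(h)\<close> in the absence of a
  unit.\<close>

lemma norm_fun_calc_mult_le:
  assumes f: "cont_null f" and M: "\<And>t. \<bar>t\<bar> \<le> norm h + 1 \<Longrightarrow> \<bar>c + f t\<bar> \<le> M"
  shows "norm (c *\<^sub>R z + fun_calc h f * z) \<le> M * norm z"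
proof (rule field_le_epsilon)
  fix e :: real assume "e > 0"
  define d where "d = e / (2 * norm z + 1)"
  have "d > 0" using \<open>e > 0\<close> by (simp add: d_def add_nonneg_pos)
  obtain q where q: "\<And>t. \<bar>t\<bar> \<le> norm h + 1 \<Longrightarrow> \<bar>t * poly q t - f t\<bar> < d" "norm (poly_elem h q - fun_calc h f) \<le> d"
    by (rule fun_calc_approximation[OF h f \<open>d > 0\<close>, of "norm h + 1"]) blast
  have 1: "norm (c *\<^sub>R z + poly_elem h q * z) \<le> (M + d) * norm z"
  proof (rule norm_poly_elem_mult_le[OF h])
    fix t assume "\<bar>t\<bar> \<le> norm h + 1"
    from q(1)[OF this] M[OF this] show "\<bar>c + t * poly q t\<bar> \<le> M + d" by linarith
  qed
  have 2: "norm ((poly_elem h q - fun_calc h f) * z) \<le> d * norm z"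
    using norm_mult_ineq[of "poly_elem h q - fun_calc h f" z] q(2) mult_right_mono[OF q(2) norm_ge_zero[of z]]
    by linarith
  have split: "c *\<^sub>R z + fun_calc h f * z = (c *\<^sub>R z + poly_elem h q * z) - (poly_elem h q - fun_calc h f) * z"
    by (simp add: algebra_simps)
  have "norm (c *\<^sub>R z + fun_calc h f * z) \<le> (M + d) * norm z + d * norm z"
    unfolding split by (rule order_trans[OF norm_triangle_ineq4 add_mono[OF 1 2]])
  also have "\<dots> = M * norm z + d * (2 * norm z)" by (simp add: algebra_simps)
  also have "d * (2 * norm z) \<le> e"
    using \<open>e > 0\<close> norm_ge_zero[of z] unfolding d_def by (simp add: divide_simps add_nonneg_pos)
  finally show "norm (c *\<^sub>R z + fun_calc h f * z) \<le> M * norm z + e" by simp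
qed

lemma norm_fun_calc_le:
  assumes f: "cont_null f" and M: "\<And>t. \<bar>t\<bar> \<le> norm h + 1 \<Longrightarrow> \<bar>f t\<bar> \<le> M"
  shows "norm (fun_calc h f) \<le> M"
proof (rule norm_le_of_mult_left)
  show "0 \<le> M" using M[of 0] by simp
  show "norm (fun_calc h f * z) \<le> M * norm z" for z
    using norm_fun_calc_mult_le[OF f, of 0 M z] M by simp
qed

lemma fun_calc_in_subspace:
  assumes f: "cont_null f"
    and V: "subspace V" "closed V" "h \<in> V" "\<And>y. y \<in> V \<Longrightarrow> h * y \<in> V"
  shows "fun_calc h f \<in> V"
proof -
  obtain q where q: "(\<lambda>n. poly_elem h (q n)) \<longlonglongrightarrow> fun_calc h f"
    by (rule fun_calc_sequence[OF h f]) blast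
  have "poly_elem h (q n) \<in> V" for n by (rule poly_elem_in_subspace[OF V(1,3,4)])
  then show ?thesis using closed_sequentially[OF V(2) _ q] by blast
qed

lemma adj_fun_calc:
  assumes f: "cont_null f"
  shows "adj (fun_calc h f) = fun_calc h f"
proof -
  \<comment> \<open>Self-adjointness alone is not preserved by multiplication by \<open>h\<close>;
    together with commutation it is.\<close>
  define V where "V = {y. adj y = y \<and> h * y = y * h}"
  have "fun_calc h f \<in> V"
  proof (rule fun_calc_in_subspace[OF f])
    show "subspace V" by (auto simp: V_def subspace_def algebra_simps)
    show "closed V" unfolding V_def
      by (intro closed_Collect_conj closed_Collect_eq continuous_intros linear_continuous_on bounded_linear_adj)
    show "h * y \<in> V" if "y \<in> V" for y using that h by (simp add: V_def) (metis mult.assoc)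
  qed (simp add: V_def h)
  then show ?thesis by (simp add: V_def)
qed

end

section \<open>Factorization and approximate units\<close>

text \<open>\<open>w\<close> is the product of the square root of its absolute value and its signed
  square root. Both are limits of polynomials in \<open>w\<close>, so they stay in
  \<open>V\<close>.\<close>

lemma self_adjoint_factorization:
  fixes w :: "'a::cstar_algebra"
  assumes w: "adj w = w"
    and V: "subspace V" "closed V" "w \<in> V" "\<And>y. y \<in> V \<Longrightarrow> w * y \<in> V"
  obtains u v where "w = u * v" "u \<in> V" "v \<in> V" "norm u \<le> sqrt (norm w + 1)" "norm v \<le> sqrt (norm w + 1)"
proof -
  define f where "f t = sqrt \<bar>t\<bar>" for t :: real
  \<comment> \<open>\<open>sqrt\<close> is odd on the negative axis, so this is the signed square
    root and \<open>f t * g t = t\<close>.\<close>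
  define g where "g t = max 0 (sqrt t) + min 0 (sqrt t)" for t :: real
  have cf: "cont_null f" and cg: "cont_null g"
    by (auto simp: cont_null_def f_def[abs_def] g_def[abs_def] intro!: continuous_intros)
  have g: "g t = sgn t * sqrt \<bar>t\<bar>" for t
    by (cases "t \<ge> 0") (auto simp: g_def sgn_if max_def min_def real_sqrt_minus)
  have "f t * g t = t" for t
    unfolding f_def g by (cases "t \<ge> 0") (auto simp: sgn_if)
  then have "fun_calc w f * fun_calc w g = w"
    using fun_calc_mult[OF w cf cg] fun_calc_id[OF w] by simp
  moreover have "norm (fun_calc w f) \<le> sqrt (norm w + 1)" "norm (fun_calc w g) \<le> sqrt (norm w + 1)"
    by (intro norm_fun_calc_le[OF w] cf cg; simp add: f_def g abs_mult abs_sgn_eq)+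
  moreover have "fun_calc w f \<in> V" "fun_calc w g \<in> V"
    by (rule fun_calc_in_subspace[OF w cf V], assumption)
      (rule fun_calc_in_subspace[OF w cg V], assumption)
  ultimately show ?thesis using that by metis
qed

lemma cartesian_decomposition:
  fixes x :: "'a::cstar_algebra"
  obtains y z where "x = y + \<i> *\<^sub>C z" "adj y = y" "adj z = z"
    "y = (1/2) *\<^sub>R (x + adj x)" "z = (1/2) *\<^sub>R ((- \<i>) *\<^sub>C (x - adj x))"
proof
  show "x = (1/2) *\<^sub>R (x + adj x) + \<i> *\<^sub>C ((1/2) *\<^sub>R ((- \<i>) *\<^sub>C (x - adj x)))"
    by (simp add: scaleC_scaleR scaleC_scaleC scaleR_add_right[symmetric] scaleR_2[symmetric])
  show "adj ((1/2) *\<^sub>R ((- \<i>) *\<^sub>C (x - adj x))) = (1/2) *\<^sub>R ((- \<i>) *\<^sub>C (x - adj x))"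
    by (simp add: adj_scaleC scaleC_minus_left scaleC_diff_right)
qed (simp_all add: add.commute)

text \<open>A substitute for \<open>x = 1 * x\<close>: identities additive in \<open>x\<close> need
  only be checked on products.\<close>

lemma sum_of_products:
  fixes x :: "'a::cstar_algebra"
  obtains a b c d where "x = a * b + c * d"
proof -
  obtain y z where x: "x = y + \<i> *\<^sub>C z" "adj y = y" "adj z = z"
    by (rule cartesian_decomposition)
  obtain a b where "y = a * b"
    by (rule self_adjoint_factorization[OF x(2) subspace_UNIV closed_UNIV UNIV_I UNIV_I]) blast
  obtain c d where "z = c * d"
    by (rule self_adjoint_factorization[OF x(3) subspace_UNIV closed_UNIV UNIV_I UNIV_I]) blast
  have "x = a * b + (\<i> *\<^sub>C c) * d" by (simp add: x(1) \<open>y = a * b\<close> \<open>z = c * d\<close> mult_scaleC_left)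
  then show ?thesis by (rule that)
qed

text \<open>By the C*-identity the squared error is the norm of \<open>(1 - e) h (1 - e)\<close>
  with \<open>h = x * adj x\<close>. This is the function \<open>t (1 - g t)^2\<close> of
  \<open>h\<close>, which vanishes for \<open>\<bar>t\<bar> \<ge> \<delta>\<close> and is at most
  \<open>\<delta>\<close> in absolute value elsewhere. The absolute value in \<open>g\<close> avoids
  an appeal to positivity of \<open>x * adj x\<close>.\<close>

lemma local_unit:
  fixes x :: "'a::cstar_algebra"
  assumes "\<epsilon> > 0"
  obtains f where "cont_null f" "\<And>z. norm (z - fun_calc (x * adj x) f * z) \<le> norm z"
    "norm (x - fun_calc (x * adj x) f * x) \<le> \<epsilon>"
proof -
  define h where "h = x * adj x"
  have h: "adj h = h" by (simp add: h_def)
  define \<delta> where "\<delta> = \<epsilon>\<^sup>2"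
  have "\<delta> > 0" using assms by (simp add: \<delta>_def)
  define g where "g t = min 1 (\<bar>t\<bar> / \<delta>)" for t :: real
  have cg: "cont_null g"
    using \<open>\<delta> > 0\<close> by (auto simp: cont_null_def g_def[abs_def] intro!: continuous_intros)
  define e where "e = fun_calc h g"
  have e: "adj e = e" unfolding e_def by (rule adj_fun_calc[OF h cg])
  have g01: "0 \<le> g t" "g t \<le> 1" for t using \<open>\<delta> > 0\<close> by (auto simp: g_def)
  have "norm (z - e * z) \<le> norm z" for z
  proof -
    have "norm (1 *\<^sub>R z + fun_calc h (\<lambda>t. (-1) * g t) * z) \<le> 1 * norm z"
      using g01 by (intro norm_fun_calc_mult_le[OF h] cont_null_intros cg) (auto simp: abs_le_iff)
    then show ?thesis unfolding fun_calc_scale[OF h cg] e_def by simp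
  qed
  moreover have "norm (x - e * x) \<le> \<epsilon>"
  proof -
    define k where "k = (\<lambda>t. (t - g t * t) - (t - g t * t) * g t)"
    have c1: "cont_null (\<lambda>t. g t * t)" and c2: "cont_null (\<lambda>t. t - g t * t)"
      and c3: "cont_null (\<lambda>t. (t - g t * t) * g t)"
      using cg by (auto simp: cont_null_def intro!: continuous_intros)
    have "fun_calc h k = (h - e * h) - (h - e * h) * e"
      unfolding k_def e_def
      by (simp add: fun_calc_diff[OF h] fun_calc_mult[OF h] fun_calc_id[OF h] c1 c2 c3 cg cont_null_intros(2))
    also have "\<dots> = (x - e * x) * adj (x - e * x)"
      by (simp add: h_def e algebra_simps)
    finally have "(norm (x - e * x))\<^sup>2 = norm (fun_calc h k)" by (simp only: norm_mult_adj)
    also have "\<dots> \<le> \<delta>"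
    proof (rule norm_fun_calc_le[OF h])
      show "cont_null k" unfolding k_def by (intro cont_null_intros(4) c2 c3)
      fix t
      have "k t = t * (1 - g t)\<^sup>2" by (simp add: k_def power2_eq_square algebra_simps)
      then have kt: "\<bar>k t\<bar> = \<bar>t\<bar> * (1 - g t)\<^sup>2" by (simp add: abs_mult)
      show "\<bar>k t\<bar> \<le> \<delta>"
      proof (cases "\<bar>t\<bar> \<ge> \<delta>")
        case True
        then have "g t = 1" using \<open>\<delta> > 0\<close> by (simp add: g_def)
        then show ?thesis using kt \<open>\<delta> > 0\<close> by simp
      next
        case False
        have "(1 - g t)\<^sup>2 \<le> 1" using g01[of t] by (simp add: power_le_one)
        then have "\<bar>t\<bar> * (1 - g t)\<^sup>2 \<le> \<delta> * 1" using False \<open>\<delta> > 0\<close> by (intro mult_mono) auto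
        then show ?thesis using kt by simp
      qed
    qed
    finally show ?thesis using assms by (simp add: \<delta>_def power2_le_iff_abs_le)
  qed
  ultimately show ?thesis using that[OF cg] unfolding e_def h_def by blast
qed

lemma left_approximate_unit:
  fixes X :: "'a::cstar_algebra set"
  assumes "finite X" "\<epsilon> > 0"
  shows "\<exists>e. (\<forall>z. norm (z - e * z) \<le> norm z) \<and> (\<forall>x\<in>X. norm (x - e * x) \<le> \<epsilon>)"
  using assms(1)
proof (induction X rule: finite_induct)
  case empty
  show ?case by (rule exI[of _ 0]) simp
next
  case (insert x X)
  then obtain e where e: "\<And>z. norm (z - e * z) \<le> norm z" "\<And>x. x \<in> X \<Longrightarrow> norm (x - e * x) \<le> \<epsilon>"
    by blast
  define y where "y = x - e * x"
  obtain f where f: "\<And>z. norm (z - f * z) \<le> norm z" "norm (y - f * y) \<le> \<epsilon>"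
    by (rule local_unit[OF assms(2), of y]) blast
  \<comment> \<open>Chosen so that \<open>1 - g = (1 - f) (1 - e)\<close>: contractions compose, the
    errors on \<open>X\<close> do not grow, and \<open>f\<close> is a local unit for what
    \<open>e\<close> leaves of \<open>x\<close>.\<close>
  define g where "g = e + f - f * e"
  have g: "z - g * z = (z - e * z) - f * (z - e * z)" for z
    by (simp add: g_def algebra_simps)
  have "norm (z - g * z) \<le> norm (z - e * z)" for z unfolding g by (rule f(1))
  moreover have "norm (x - g * x) \<le> \<epsilon>" using f(2) unfolding g y_def .
  ultimately show ?case using e by (intro exI[of _ g]) (auto intro: order_trans)
qed

text \<open>A left unit \<open>e\<close> and a right unit \<open>f\<close> are merged by
  \<open>1 - g = (1 - f) (1 - e)\<close>. As \<open>1 - e\<close> is contractive,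
  \<open>norm e \<le> 2\<close>, and likewise for \<open>f\<close>, which gives 2 + 2 + 4 = 8; the
  remaining factor enlarges an error at most threefold, hence \<open>\<epsilon> / 3\<close>.\<close>

lemma approximate_unit:
  fixes X :: "'a::cstar_algebra set"
  assumes "finite X" "\<epsilon> > 0"
  shows "\<exists>e. norm e \<le> 8 \<and> (\<forall>x\<in>X. norm (x - e * x) \<le> \<epsilon> \<and> norm (x - x * e) \<le> \<epsilon>)"
proof -
  have norm2: "norm e \<le> 2" if "\<And>z. norm (z - e * z) \<le> norm z" for e :: 'a
  proof (rule norm_le_of_mult_left)
    fix z
    have "norm (e * z) \<le> norm z + norm (z - e * z)"
      using norm_triangle_ineq4[of z "z - e * z"] by simp
    then show "norm (e * z) \<le> 2 * norm z" using that[of z] by simp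
  qed simp
  obtain e where e: "\<And>z. norm (z - e * z) \<le> norm z" "\<And>x. x \<in> X \<Longrightarrow> norm (x - e * x) \<le> \<epsilon> / 3"
    using left_approximate_unit[of X "\<epsilon> / 3"] assms by auto
  obtain f' where f': "\<And>z. norm (z - f' * z) \<le> norm z" "\<And>x. x \<in> adj ` X \<Longrightarrow> norm (x - f' * x) \<le> \<epsilon> / 3"
    using left_approximate_unit[of "adj ` X" "\<epsilon> / 3"] assms by auto
  define f where "f = adj f'"
  have n: "norm e \<le> 2" "norm f \<le> 2" using norm2[OF e(1)] norm2[OF f'(1)] by (simp_all add: f_def)
  have f: "norm (x - x * f) \<le> \<epsilon> / 3" if "x \<in> X" for x
  proof -
    have "adj (adj x - f' * adj x) = x - x * f" by (simp add: f_def)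
    then show ?thesis using f'(2)[of "adj x"] norm_adj[of "adj x - f' * adj x"] that by simp
  qed
  define g where "g = e + f - f * e"
  have "norm (f * e) \<le> 4"
    using norm_mult_ineq[of f e] mult_mono[OF n(2,1)] by simp
  then have "norm g \<le> 8"
    using n norm_triangle_ineq4[of "e + f" "f * e"] norm_triangle_ineq[of e f] by (simp add: g_def)
  moreover have "norm (x - g * x) \<le> \<epsilon>" if "x \<in> X" for x
  proof -
    have "x - g * x = (x - e * x) - f * (x - e * x)" by (simp add: g_def algebra_simps)
    then have "norm (x - g * x) \<le> norm (x - e * x) + norm (f * (x - e * x))"
      by (simp only: norm_triangle_ineq4)
    also have "norm (f * (x - e * x)) \<le> 2 * norm (x - e * x)"
      using norm_mult_ineq[of f "x - e * x"] mult_right_mono[OF n(2), of "norm (x - e * x)"] by simp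
    finally show ?thesis using e(2)[OF that] by simp
  qed
  moreover have "norm (x - x * g) \<le> \<epsilon>" if "x \<in> X" for x
  proof -
    have "x - x * g = (x - x * f) - (x - x * f) * e" by (simp add: g_def algebra_simps)
    then have "norm (x - x * g) \<le> norm (x - x * f) + norm ((x - x * f) * e)"
      by (simp only: norm_triangle_ineq4)
    also have "norm ((x - x * f) * e) \<le> norm (x - x * f) * 2"
      using norm_mult_ineq[of "x - x * f" e] mult_left_mono[OF n(1), of "norm (x - x * f)"] by simp
    finally show ?thesis using f[OF that] by simp
  qed
  ultimately show ?thesis by blast
qed

section \<open>Closed ideals with few orthogonal elements outside\<close>

locale closed_star_ideal =
  fixes J :: "'a::cstar_algebra set"
  assumes subspace: "subspace J" and closed: "closed J"
    and mult_left: "x \<in> J \<Longrightarrow> a * x \<in> J" and mult_right: "x \<in> J \<Longrightarrow> x * a \<in> J"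
    and scaleC_closed: "x \<in> J \<Longrightarrow> c *\<^sub>C x \<in> J" and adj_closed: "x \<in> J \<Longrightarrow> adj x \<in> J"
begin

lemma adj_iff: "adj x \<in> J \<longleftrightarrow> x \<in> J"
  using adj_closed[of x] adj_closed[of "adj x"] by auto

lemmas J_intros = subspace_0[OF subspace] subspace_add[OF subspace] subspace_diff[OF subspace]
  subspace_neg[OF subspace] subspace_scale[OF subspace] subspace_sum[OF subspace]
  mult_left mult_right scaleC_closed adj_closed

lemma fun_calc_in: "adj h = h \<Longrightarrow> cont_null f \<Longrightarrow> h \<in> J \<Longrightarrow> fun_calc h f \<in> J"
  by (rule fun_calc_in_subspace) (auto intro: subspace closed mult_left)

lemma mem_of_approx:
  assumes "\<And>e. e > 0 \<Longrightarrow> \<exists>y\<in>J. norm (x - y) \<le> e"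
  shows "x \<in> J"
proof -
  have "\<exists>y\<in>J. dist y x < e" if "e > 0" for e
  proof -
    have "\<exists>y\<in>J. norm (x - y) \<le> e / 2" using that by (intro assms) simp
    then obtain y where "y \<in> J" "norm (x - y) \<le> e / 2" by blast
    then show ?thesis using that by (auto simp: dist_norm norm_minus_commute intro!: bexI[of _ y])
  qed
  then have "x \<in> closure J" by (simp add: closure_approachable)
  then show ?thesis using closed by simp
qed

text \<open>\<open>x\<close> is a limit of elements \<open>f(x * adj x) * x\<close>, whose first
  factor lies in the ideal.\<close>

lemma mem_of_mult_adj:
  assumes "x * adj x \<in> J"
  shows "x \<in> J"
proof (rule mem_of_approx)
  fix e :: real assume "e > 0"
  then obtain f where f: "cont_null f" "norm (x - fun_calc (x * adj x) f * x) \<le> e"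
    by (rule local_unit[of e x]) blast
  have "fun_calc (x * adj x) f \<in> J" using assms f by (intro fun_calc_in) simp_all
  then show "\<exists>y\<in>J. norm (x - y) \<le> e" using f(2) mult_right by blast
qed

lemma mem_of_adj_mult: "adj x * x \<in> J \<Longrightarrow> x \<in> J"
  using mem_of_mult_adj[of "adj x"] by (simp add: adj_iff)

end

text \<open>Along a strictly monotone sequence, half the distance to the nearer neighbour is a
  radius that makes the open intervals disjoint. A decreasing sequence is reflected.\<close>

lemma separated_sequence:
  fixes S :: "real set"
  assumes "infinite S"
  obtains y :: "nat \<Rightarrow> real" and r :: "nat \<Rightarrow> real"
  where "range y \<subseteq> S" "\<And>n. r n > 0" "\<And>m n. m \<noteq> n \<Longrightarrow> r m + r n \<le> \<bar>y m - y n\<bar>"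
proof -
  define r where "r y n = (if n = 0 then \<bar>y 1 - y 0\<bar>
      else min \<bar>y n - y (n - 1)\<bar> \<bar>y (Suc n) - y n\<bar>) / 2" for y :: "nat \<Rightarrow> real" and n
  have r_less: "r y m + r y n \<le> \<bar>y m - y n\<bar>" if y: "strict_mono y" and "m < n" for y m n
  proof -
    have "r y m \<le> (y (Suc m) - y m) / 2"
      using strict_monoD[OF y, of m "Suc m"] by (cases m) (simp_all add: r_def)
    moreover have "r y n \<le> (y n - y (n - 1)) / 2"
      using strict_monoD[OF y, of "n - 1" n] \<open>m < n\<close> by (simp add: r_def)
    moreover have "y m < y (Suc m)" "y (n - 1) < y n" using \<open>m < n\<close> by (auto intro: strict_monoD[OF y])
    moreover have "n = Suc m \<or> y (Suc m) \<le> y (n - 1)"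
      using \<open>m < n\<close> strict_mono_leD[OF y, of "Suc m" "n - 1"] by linarith
    ultimately show ?thesis by (auto simp: abs_if)
  qed
  have r_mono: "r y n > 0" "m \<noteq> n \<Longrightarrow> r y m + r y n \<le> \<bar>y m - y n\<bar>" if y: "strict_mono y" for y m n
  proof -
    show "r y n > 0"
      using strict_monoD[OF y, of n "Suc n"] strict_monoD[OF y, of "n - 1" n] by (auto simp: r_def)
    show "r y m + r y n \<le> \<bar>y m - y n\<bar>" if "m \<noteq> n"
      using r_less[OF y, of m n] r_less[OF y, of n m] that
      by (cases "m < n") (auto simp: abs_minus_commute add.commute)
  qed
  obtain x :: "nat \<Rightarrow> real" where x: "inj x" "range x \<subseteq> S"
    using infinite_countable_subset[OF assms] by blast
  obtain g :: "nat \<Rightarrow> nat" where g: "strict_mono g" "monoseq (\<lambda>n. x (g n))"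
    using seq_monosub[of x] by blast
  have inj: "x (g m) \<noteq> x (g n)" if "m < n" for m n
    using strict_monoD[OF g(1) that] injD[OF x(1)] by force
  define y where "y = (\<lambda>n. x (g n))"
  have "range y \<subseteq> S" using x(2) by (auto simp: y_def)
  have "(\<forall>m n. m < n \<longrightarrow> y m < y n) \<or> (\<forall>m n. m < n \<longrightarrow> y n < y m)"
    using g(2) inj unfolding monoseq_def y_def by (metis less_imp_le_nat order_le_less)
  then show ?thesis
  proof
    assume "\<forall>m n. m < n \<longrightarrow> y m < y n"
    then have "strict_mono y" by (simp add: strict_mono_def)
    then show ?thesis using r_mono[of y] \<open>range y \<subseteq> S\<close> by (intro that[of y "r y"]) auto
  next
    assume "\<forall>m n. m < n \<longrightarrow> y n < y m"
    then have "strict_mono (\<lambda>n. - y n)" by (simp add: strict_mono_def)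
    from r_mono[OF this] have "r (\<lambda>n. - y n) n > 0"
      "m \<noteq> n \<Longrightarrow> r (\<lambda>n. - y n) m + r (\<lambda>n. - y n) n \<le> \<bar>y m - y n\<bar>" for m n
      by (auto simp: abs_minus_commute)
    then show ?thesis using \<open>range y \<subseteq> S\<close> by (intro that[of y "r (\<lambda>n. - y n)"]) auto
  qed
qed

lemma fun_calc_zero:
  fixes h :: "'a::cstar_algebra"
  assumes "adj h = h"
  shows "fun_calc h (\<lambda>_. 0) = 0"
  using fun_calc_scale[OF assms cont_null_intros(2), of 0] by simp

lemma poly_elem_sum: "poly_elem h (sum q S) = (\<Sum>i\<in>S. poly_elem h (q i))"
  by (induction S rule: infinite_finite_induct) (simp_all add: poly_elem_def act_poly_add linear_mult_left)

lemma poly_elem_one: "poly_elem h 1 = h"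
  by (simp add: poly_elem_def one_pCons linear_mult_left)

section \<open>Finite spectrum and spectral projections modulo \<open>J\<close>\<close>

locale thin_ideal = closed_star_ideal J for J :: "'a::cstar_algebra set" +
  assumes orthogonal: "\<And>a :: nat \<Rightarrow> 'a. (\<And>n. adj (a n) = a n) \<Longrightarrow>
      (\<And>m n. m \<noteq> n \<Longrightarrow> a m * a n = 0) \<Longrightarrow> \<exists>n. a n \<in> J"
begin

text \<open>The nonzero spectrum of \<open>h\<close> modulo \<open>J\<close>.\<close>

definition spec :: "'a \<Rightarrow> real set"
  where "spec h = {\<kappa>. \<kappa> \<noteq> 0 \<and> (\<forall>f. cont_null f \<and> fun_calc h f \<in> J \<longrightarrow> f \<kappa> = 0)}"

text \<open>Disjoint tents around infinitely many spectral points would yield orthogonal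
  self-adjoint elements, none of them in \<open>J\<close> because each tent is nonzero at its own
  point. The factor \<open>t\<close> makes the tents vanish at 0.\<close>

lemma finite_spec:
  assumes h: "adj h = h"
  shows "finite (spec h)"
proof (rule ccontr)
  assume "infinite (spec h)"
  then obtain y r where y: "range y \<subseteq> spec h" and r: "\<And>n :: nat. r n > 0"
    and sep: "\<And>m n. m \<noteq> n \<Longrightarrow> r m + r n \<le> \<bar>y m - y n\<bar>"
    by (rule separated_sequence) blast
  define f where "f n t = t * max 0 (1 - \<bar>t - y n\<bar> / r n)" for n t
  have cf: "cont_null (f n)" for n
    using r[of n] by (auto simp: cont_null_def f_def[abs_def] intro!: continuous_intros)
  have "f m t * f n t = 0" if "m \<noteq> n" for m n t
  proof (rule ccontr)
    assume "\<not> ?thesis"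
    then have "max 0 (1 - \<bar>t - y m\<bar> / r m) \<noteq> 0" "max 0 (1 - \<bar>t - y n\<bar> / r n) \<noteq> 0"
      by (auto simp: f_def)
    then have "1 - \<bar>t - y m\<bar> / r m > 0" "1 - \<bar>t - y n\<bar> / r n > 0" by linarith+
    then have "\<bar>t - y m\<bar> < r m" "\<bar>t - y n\<bar> < r n" using r[of m] r[of n] by (auto simp: field_simps)
    then show False using sep[OF that] by linarith
  qed
  then have zero: "(\<lambda>t. f m t * f n t) = (\<lambda>_. 0)" if "m \<noteq> n" for m n using that by blast
  have "fun_calc h (f m) * fun_calc h (f n) = 0" if "m \<noteq> n" for m n
    using fun_calc_mult[OF h cf[of m] cf[of n]] unfolding zero[OF that] fun_calc_zero[OF h] by simp
  then obtain n where "fun_calc h (f n) \<in> J"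
    using orthogonal[of "\<lambda>n. fun_calc h (f n)"] adj_fun_calc[OF h cf] by blast
  moreover have "y n \<in> spec h" using y by blast
  ultimately have "f n (y n) = 0" "y n \<noteq> 0" using cf[of n] by (auto simp: spec_def)
  then show False by (simp add: f_def)
qed

lemma fun_calc_sum_in:
  assumes h: "adj h = h" and "finite T"
    and "\<And>t. t \<in> T \<Longrightarrow> cont_null (g t)" "\<And>t. t \<in> T \<Longrightarrow> fun_calc h (g t) \<in> J"
  shows "cont_null (\<lambda>s. \<Sum>t\<in>T. g t s) \<and> fun_calc h (\<lambda>s. \<Sum>t\<in>T. g t s) \<in> J"
  using assms(2-)
proof (induction T rule: finite_induct)
  case empty
  then show ?case using fun_calc_zero[OF h] by (simp add: cont_null_def J_intros(1))
next
  case (insert t T)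
  then show ?case
    by (simp add: fun_calc_add[OF h] cont_null_intros(3) J_intros(2))
qed

text \<open>
  A closed ideal of functions is determined by its common zeros: where \<open>f\<close> is not small,
  some nonnegative \<open>g\<close> in the ideal is bounded below, and \<open>f n g / (1 + n g)\<close> is close to \<open>f\<close>.
\<close>

lemma fun_calc_in_J:
  assumes h: "adj h = h" and f: "cont_null f" and zero: "\<And>\<kappa>. \<kappa> \<in> spec h \<Longrightarrow> f \<kappa> = 0"
  shows "fun_calc h f \<in> J"
proof (rule mem_of_approx)
  fix e :: real assume "e > 0"
  define R where "R = norm h + 1"
  have cf: "continuous_on UNIV f" using f by (simp add: cont_null_def)
  define K where "K = {-R..R} \<inter> {t. e \<le> \<bar>f t\<bar>}"
  have "closed {t. e \<le> \<bar>f t\<bar>}" by (intro closed_Collect_le continuous_intros cf)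
  then have "compact K" unfolding K_def by (intro compact_Int_closed compact_Icc)
  have "\<exists>g. cont_null g \<and> fun_calc h g \<in> J \<and> g t \<noteq> 0" if "t \<in> K" for t
  proof -
    have "f t \<noteq> 0" using that \<open>e > 0\<close> by (auto simp: K_def)
    then have "t \<noteq> 0" "t \<notin> spec h" using f zero by (auto simp: cont_null_def)
    then show ?thesis by (auto simp: spec_def)
  qed
  then obtain G where G: "\<And>t. t \<in> K \<Longrightarrow> cont_null (G t) \<and> fun_calc h (G t) \<in> J \<and> G t t \<noteq> 0"
    by metis
  have open_G: "open {s. G t s \<noteq> 0}" if "t \<in> K" for t
    using G[OF that] by (intro open_Collect_neq continuous_intros) (auto simp: cont_null_def)
  obtain T where T: "T \<subseteq> K" "finite T" "K \<subseteq> (\<Union>t\<in>T. {s. G t s \<noteq> 0})"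
    by (rule compactE_image[OF \<open>compact K\<close>, of K "\<lambda>t. {s. G t s \<noteq> 0}"]) (use open_G G in blast)+
  \<comment> \<open>Squares keep the sum nonnegative and positive wherever one of the
    \<open>G t\<close> is nonzero.\<close>
  define g where "g s = (\<Sum>t\<in>T. G t s * G t s)" for s
  have "cont_null (\<lambda>s. \<Sum>t\<in>T. G t s * G t s) \<and> fun_calc h (\<lambda>s. \<Sum>t\<in>T. G t s * G t s) \<in> J"
  proof (rule fun_calc_sum_in[OF h T(2)])
    fix t assume "t \<in> T"
    then have t: "cont_null (G t)" "fun_calc h (G t) \<in> J" using G T(1) by auto
    then show "cont_null (\<lambda>s. G t s * G t s)" by (simp add: cont_null_def continuous_on_mult)
    show "fun_calc h (\<lambda>s. G t s * G t s) \<in> J" using t by (simp add: fun_calc_mult[OF h] mult_left)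
  qed
  then have g: "cont_null g" "fun_calc h g \<in> J" unfolding g_def[abs_def] by auto
  have g0: "g s \<ge> 0" for s by (simp add: g_def sum_nonneg)
  have gpos: "g s > 0" if s: "s \<in> K" for s
  proof -
    obtain t where "t \<in> T" "G t s \<noteq> 0" using T(3) s by blast
    then have "0 < G t s * G t s" using not_real_square_gt_zero by blast
    also have "\<dots> \<le> g s" unfolding g_def
      by (rule member_le_sum[OF \<open>t \<in> T\<close>]) (use T(2) in auto)
    finally show ?thesis .
  qed
  have "\<exists>\<delta>>0. \<forall>s\<in>K. \<delta> \<le> g s"
  proof (cases "K = {}")
    case True
    then show ?thesis by (intro exI[of _ 1]) simp
  next
    case False
    have "continuous_on K g" using g(1) by (auto simp: cont_null_def intro: continuous_on_subset)
    from continuous_attains_inf[OF \<open>compact K\<close> False this] gpos show ?thesis by blast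
  qed
  then obtain \<delta> where \<delta>: "\<delta> > 0" "\<And>s. s \<in> K \<Longrightarrow> \<delta> \<le> g s" by blast
  obtain B where B: "\<And>t. t \<in> {-R..R} \<Longrightarrow> \<bar>f t\<bar> \<le> B"
    using bounded_cont_null[OF f, of "-R" R] unfolding bounded_iff real_norm_def by blast
  \<comment> \<open>On \<open>K\<close>, where \<open>g \<ge> \<delta>\<close>, this makes the error
    \<open>\<bar>f t\<bar> / (1 + n * g t)\<close> at most \<open>e\<close>; off \<open>K\<close>,
    \<open>f\<close> is already that small.\<close>
  define n where "n = \<bar>B\<bar> / (e * \<delta>)"
  have "n \<ge> 0" using \<open>e > 0\<close> \<delta>(1) by (simp add: n_def)
  have pos: "1 + n * g t > 0" for t using \<open>n \<ge> 0\<close> g0[of t] by (simp add: add_pos_nonneg)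
  define \<psi> where "\<psi> t = f t * (n / (1 + n * g t))" for t
  have "continuous_on UNIV (\<lambda>t. n / (1 + n * g t))"
    using g(1) pos by (intro continuous_intros) (auto simp: cont_null_def less_imp_neq[THEN not_sym])
  then have c\<psi>: "cont_null \<psi>" unfolding \<psi>_def by (intro cont_null_intros(5) f)
  have c\<psi>g: "cont_null (\<lambda>t. \<psi> t * g t)" using c\<psi> g(1) by (intro cont_null_intros(5)) (simp_all add: cont_null_def)
  have "fun_calc h (\<lambda>t. \<psi> t * g t) \<in> J"
    unfolding fun_calc_mult[OF h c\<psi> g(1)] by (intro mult_left g)
  moreover have "norm (fun_calc h f - fun_calc h (\<lambda>t. \<psi> t * g t)) \<le> e"
    unfolding fun_calc_diff[OF h f c\<psi>g, symmetric]
  proof (rule norm_fun_calc_le[OF h cont_null_intros(4)[OF f c\<psi>g]])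
    fix t assume "\<bar>t\<bar> \<le> norm h + 1"
    then have t: "t \<in> {-R..R}" by (auto simp: R_def)
    have "f t - \<psi> t * g t = f t / (1 + n * g t)"
      using pos[of t] by (simp add: \<psi>_def field_simps)
    then have eq: "\<bar>f t - \<psi> t * g t\<bar> = \<bar>f t\<bar> / (1 + n * g t)" by (simp only: abs_divide abs_of_pos[OF pos])
    show "\<bar>f t - \<psi> t * g t\<bar> \<le> e"
    proof (cases "t \<in> K")
      case True
      have "\<bar>f t\<bar> \<le> \<bar>B\<bar>" using B[OF t] by linarith
      also have "\<dots> = e * (n * \<delta>)" using \<open>e > 0\<close> \<delta>(1) by (simp add: n_def)
      also have "\<dots> \<le> e * (n * g t)" using \<delta>(2)[OF True] \<open>n \<ge> 0\<close> \<open>e > 0\<close> by (intro mult_left_mono) auto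
      also have "\<dots> \<le> e * (1 + n * g t)" using \<open>e > 0\<close> by simp
      finally show ?thesis unfolding eq using pos[of t] by (simp add: pos_divide_le_eq)
    next
      case False
      then have "\<bar>f t\<bar> \<le> e" using t by (auto simp: K_def)
      also have "e \<le> e * (1 + n * g t)" using \<open>e > 0\<close> \<open>n \<ge> 0\<close> g0[of t] by simp
      finally show ?thesis unfolding eq using pos[of t] by (simp add: pos_divide_le_eq)
    qed
  qed
  ultimately show "\<exists>y\<in>J. norm (fun_calc h f - y) \<le> e" by blast
qed

lemma poly_elem_in_J_iff:
  assumes h: "adj h = h"
  shows "poly_elem h q \<in> J \<longleftrightarrow> (\<forall>\<kappa>\<in>spec h. poly q \<kappa> = 0)"
proof
  assume "poly_elem h q \<in> J"
  then have "fun_calc h (\<lambda>t. t * poly q t) \<in> J" by (simp add: fun_calc_poly[OF h])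
  then show "\<forall>\<kappa>\<in>spec h. poly q \<kappa> = 0" using cont_null_intros(1)[of q] by (force simp: spec_def)
next
  assume "\<forall>\<kappa>\<in>spec h. poly q \<kappa> = 0"
  then have "fun_calc h (\<lambda>t. t * poly q t) \<in> J" by (intro fun_calc_in_J h cont_null_intros(1)) simp
  then show "poly_elem h q \<in> J" by (simp add: fun_calc_poly[OF h])
qed

text \<open>A representative of a nonzero projection of the quotient: idempotent modulo
  \<open>J\<close>, but exactly self-adjoint.\<close>

definition proj :: "'a \<Rightarrow> bool"
  where "proj e \<longleftrightarrow> adj e = e \<and> e * e - e \<in> J \<and> e \<notin> J"

text \<open>Lagrange interpolation on the finite spectrum modulo \<open>J\<close>. The last clause
  records that \<open>e \<kappa>\<close> is a polynomial in \<open>h\<close> without constant term,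
  so that properties of \<open>h\<close> expressible by an invariant subspace pass to it.\<close>

lemma spectral_decomposition:
  assumes h: "adj h = h"
  obtains S :: "real set" and e :: "real \<Rightarrow> 'a"
  where "finite S" "\<And>\<kappa>. \<kappa> \<in> S \<Longrightarrow> proj (e \<kappa>)"
    "\<And>\<kappa> \<mu>. \<kappa> \<in> S \<Longrightarrow> \<mu> \<in> S \<Longrightarrow> \<kappa> \<noteq> \<mu> \<Longrightarrow> e \<kappa> * e \<mu> \<in> J"
    "h - (\<Sum>\<kappa>\<in>S. \<kappa> *\<^sub>R e \<kappa>) \<in> J"
    "\<And>\<kappa> V. subspace V \<Longrightarrow> h \<in> V \<Longrightarrow> (\<And>y. y \<in> V \<Longrightarrow> h * y \<in> V) \<Longrightarrow> e \<kappa> \<in> V"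
proof -
  define S where "S = spec h"
  have fin: "finite S" unfolding S_def by (rule finite_spec[OF h])
  have nz: "\<kappa> \<noteq> 0" if "\<kappa> \<in> S" for \<kappa> using that by (simp add: S_def spec_def)
  define P where "P \<kappa> = (\<Prod>\<mu>\<in>S - {\<kappa>}. [:- \<mu>, 1:])" for \<kappa>
  \<comment> \<open>The extra \<open>\<kappa>\<close> in the denominator is due to
    \<open>poly_elem h q\<close> being the value of \<open>t q(t)\<close>.\<close>
  define q where "q \<kappa> = smult (1 / (\<kappa> * poly (P \<kappa>) \<kappa>)) (P \<kappa>)" for \<kappa>
  have "poly (P \<kappa>) \<kappa> \<noteq> 0" for \<kappa> using fin by (simp add: P_def poly_prod)
  then have q_same: "\<kappa> * poly (q \<kappa>) \<kappa> = 1" if "\<kappa> \<in> S" for \<kappa>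
    using nz[OF that] by (simp add: q_def)
  have "poly (P \<kappa>) \<mu> = 0" if "\<mu> \<in> S" "\<mu> \<noteq> \<kappa>" for \<kappa> \<mu>
    using fin that by (auto simp: P_def poly_prod intro!: prod_zero)
  then have q_other: "poly (q \<kappa>) \<mu> = 0" if "\<mu> \<in> S" "\<mu> \<noteq> \<kappa>" for \<kappa> \<mu>
    using that by (simp add: q_def)
  define e where "e \<kappa> = poly_elem h (q \<kappa>)" for \<kappa>
  have in_J: "poly_elem h p \<in> J \<longleftrightarrow> (\<forall>\<kappa>\<in>S. poly p \<kappa> = 0)" for p
    unfolding S_def by (rule poly_elem_in_J_iff[OF h])
  show ?thesis
  proof (rule that[of S e])
    show "proj (e \<kappa>)" if "\<kappa> \<in> S" for \<kappa>
      unfolding proj_def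
    proof (intro conjI)
      show "adj (e \<kappa>) = e \<kappa>"
        using adj_fun_calc[OF h cont_null_intros(1)] by (simp add: e_def fun_calc_poly[OF h])
      have "\<mu> * poly (q \<kappa>) \<mu> = 1 \<or> poly (q \<kappa>) \<mu> = 0" if "\<mu> \<in> S" for \<mu>
        using q_same q_other \<open>\<kappa> \<in> S\<close> that by metis
      then have "poly (pCons 0 (q \<kappa>) * q \<kappa> - q \<kappa>) \<mu> = 0" if "\<mu> \<in> S" for \<mu>
        using that by force
      then show "e \<kappa> * e \<kappa> - e \<kappa> \<in> J"
        unfolding e_def poly_elem_prod poly_elem_diff[symmetric] in_J by blast
      show "e \<kappa> \<notin> J" using q_same[OF that] that unfolding e_def in_J by force
    qed
    show "e \<kappa> * e \<mu> \<in> J" if "\<kappa> \<in> S" "\<mu> \<in> S" "\<kappa> \<noteq> \<mu>" for \<kappa> \<mu>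
      unfolding e_def poly_elem_prod in_J
    proof
      fix \<nu> assume "\<nu> \<in> S"
      then show "poly (pCons 0 (q \<kappa>) * q \<mu>) \<nu> = 0"
        using q_other[of \<nu> \<kappa>] q_other[of \<nu> \<mu>] that by (cases "\<nu> = \<kappa>") auto
    qed
    have "h - (\<Sum>\<kappa>\<in>S. \<kappa> *\<^sub>R e \<kappa>) = poly_elem h (1 - (\<Sum>\<kappa>\<in>S. smult \<kappa> (q \<kappa>)))"
      by (simp add: poly_elem_diff poly_elem_sum poly_elem_smult poly_elem_one e_def)
    also have "\<dots> \<in> J"
      unfolding in_J
    proof
      fix \<mu> assume "\<mu> \<in> S"
      have "(\<Sum>\<kappa>\<in>S. \<kappa> * poly (q \<kappa>) \<mu>) = (\<Sum>\<kappa>\<in>S. if \<kappa> = \<mu> then 1 else 0)"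
        using q_same q_other \<open>\<mu> \<in> S\<close> by (intro sum.cong) auto
      then show "poly (1 - (\<Sum>\<kappa>\<in>S. smult \<kappa> (q \<kappa>))) \<mu> = 0"
        using fin \<open>\<mu> \<in> S\<close> by (simp add: poly_sum)
    qed
    finally show "h - (\<Sum>\<kappa>\<in>S. \<kappa> *\<^sub>R e \<kappa>) \<in> J" .
    show "e \<kappa> \<in> V" if "subspace V" "h \<in> V" "\<And>y. y \<in> V \<Longrightarrow> h * y \<in> V" for \<kappa> V
      unfolding e_def by (rule poly_elem_in_subspace[OF that])
  qed (fact fin)
qed

text \<open>
  Otherwise a suitable series \<open>h = \<Sum> c\<^sub>n e\<^sub>n\<close> would have infinitely many \<open>c\<^sub>n\<close> in its spectrum.
\<close>

lemma no_orthogonal_sequence: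
  fixes e :: "nat \<Rightarrow> 'a"
  assumes e: "\<And>n. proj (e n)" and orth: "\<And>m n. m \<noteq> n \<Longrightarrow> e m * e n \<in> J"
  shows False
proof -
  \<comment> \<open>The denominator tames the norms of the representatives, on which there is no
    bound.\<close>
  define c where "c n = (1/2) ^ n / (1 + norm (e n))" for n
  have cpos: "c n > 0" and cle: "c n \<le> (1/2) ^ n" for n
    using norm_ge_zero[of "e n"] by (simp_all add: c_def add_pos_nonneg divide_le_eq)
  have sm: "summable (\<lambda>n. c n *\<^sub>R e n)"
  proof (rule summable_comparison_test'[where N = 0])
    show "summable (\<lambda>n. (1/2::real) ^ n)" by (rule summable_geometric) simp
    show "norm (c n *\<^sub>R e n) \<le> (1/2) ^ n" for n
      using norm_ge_zero[of "e n"] by (simp add: c_def add_pos_nonneg divide_simps)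
  qed
  define h where "h = (\<Sum>n. c n *\<^sub>R e n)"
  have hs: "(\<lambda>n. c n *\<^sub>R e n) sums h" unfolding h_def by (rule summable_sums[OF sm])
  have "(\<lambda>n. adj (c n *\<^sub>R e n)) sums adj h"
    by (rule bounded_linear.sums[OF bounded_linear_adj hs])
  moreover have "(\<lambda>n. adj (c n *\<^sub>R e n)) = (\<lambda>n. c n *\<^sub>R e n)" using e by (simp add: proj_def)
  ultimately have h: "adj h = h" using sums_unique2[OF _ hs] by metis
  \<comment> \<open>Modulo \<open>J\<close>, \<open>e m\<close> is an eigenvector of
    \<open>h\<close> for the eigenvalue \<open>c m\<close>; this carries over to polynomials in
    \<open>h\<close> and then to \<open>f(h)\<close>.\<close>
  have he: "h * e m - c m *\<^sub>R e m \<in> J" for m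
  proof -
    have lim: "(\<lambda>n. (c n *\<^sub>R e n) * e m - (if n = m then c m *\<^sub>R e m else 0)) sums (h * e m - c m *\<^sub>R e m)"
      by (intro sums_diff sums_mult2 hs sums_single)
    have "(c n *\<^sub>R e n) * e m - (if n = m then c m *\<^sub>R e m else 0) \<in> J" for n
      using orth[of n m] e[of m] subspace_scale[OF subspace, of "e m * e m - e m" "c m"]
      by (auto simp: proj_def J_intros scaleR_diff_right)
    then have partial: "(\<Sum>i<n. (c i *\<^sub>R e i) * e m - (if i = m then c m *\<^sub>R e m else 0)) \<in> J" for n
      by (rule J_intros(6))
    show ?thesis by (rule closed_sequentially[OF closed partial lim[unfolded sums_def]])
  qed
  have act: "act_elem h p (e m) - poly p (c m) *\<^sub>R e m \<in> J" for p m
  proof (induction p)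
    case (pCons a p)
    have "act_elem h (pCons a p) (e m) - poly (pCons a p) (c m) *\<^sub>R e m =
        h * (act_elem h p (e m) - poly p (c m) *\<^sub>R e m) + poly p (c m) *\<^sub>R (h * e m - c m *\<^sub>R e m)"
      by (simp add: linear_mult_left algebra_simps)
    then show ?case using pCons.IH he by (simp only: J_intros)
  qed (simp add: J_intros)
  have "c m \<in> spec h" for m
    unfolding spec_def
  proof (intro CollectI conjI allI impI)
    show "c m \<noteq> 0" using cpos[of m] by simp
    fix f assume f: "cont_null f \<and> fun_calc h f \<in> J"
    obtain q where q: "(\<lambda>n. poly_elem h (q n)) \<longlonglongrightarrow> fun_calc h f"
      "\<And>t. (\<lambda>n. t * poly (q n) t) \<longlonglongrightarrow> f t"
      by (rule fun_calc_sequence[OF h, of f]) (use f in blast)+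
    have lim: "(\<lambda>n. poly_elem h (q n) * e m - (c m * poly (q n) (c m)) *\<^sub>R e m) \<longlonglongrightarrow>
        fun_calc h f * e m - f (c m) *\<^sub>R e m"
      by (intro tendsto_intros q)
    have mem: "poly_elem h (q n) * e m - (c m * poly (q n) (c m)) *\<^sub>R e m \<in> J" for n
      using act[of "pCons 0 (q n)" m] by (simp only: poly_elem_mult) simp
    have "fun_calc h f * e m - f (c m) *\<^sub>R e m \<in> J"
      by (rule closed_sequentially[OF closed mem lim])
    from J_intros(3)[OF mult_right[of "fun_calc h f" "e m"] this] have "f (c m) *\<^sub>R e m \<in> J"
      using f by simp
    then have "inverse (f (c m)) *\<^sub>R f (c m) *\<^sub>R e m \<in> J" by (rule J_intros(5))
    then show "f (c m) = 0" using e[of m] by (cases "f (c m) = 0") (simp_all add: proj_def)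
  qed
  then have "range c \<subseteq> spec h" by blast
  then have fin: "finite (range c)" using finite_spec[OF h] by (rule finite_subset)
  \<comment> \<open>Positive numbers tending to 0 cannot take only finitely many values.\<close>
  have "Min (range c) > 0" using fin cpos by (simp add: Min_gr_iff)
  then have "\<exists>n. (1/2::real) ^ n < Min (range c)" by (intro real_arch_pow_inv) auto
  then obtain n where "(1/2::real) ^ n < Min (range c)" by blast
  moreover have "Min (range c) \<le> c n" using fin by simp
  ultimately show False using cle[of n] by linarith
qed

end

section \<open>The quotient by a thin ideal is finite-dimensional\<close>

context closed_star_ideal
begin

definition cong_J :: "'a \<Rightarrow> 'a \<Rightarrow> bool"  (infix "\<simeq>" 50)
  where "x \<simeq> y \<longleftrightarrow> x - y \<in> J"

lemma cong_refl [simp]: "x \<simeq> x"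
  by (simp add: cong_J_def J_intros)

lemma cong_sym: "x \<simeq> y \<Longrightarrow> y \<simeq> x"
  using J_intros(4)[of "x - y"] by (simp add: cong_J_def)

lemma cong_trans [trans]: "x \<simeq> y \<Longrightarrow> y \<simeq> z \<Longrightarrow> x \<simeq> z"
  using J_intros(2)[of "x - y" "y - z"] by (simp add: cong_J_def)

lemma cong_zero: "x \<simeq> 0 \<longleftrightarrow> x \<in> J"
  by (simp add: cong_J_def)

lemma cong_add: "x \<simeq> x' \<Longrightarrow> y \<simeq> y' \<Longrightarrow> x + y \<simeq> x' + y'"
  using J_intros(2)[of "x - x'" "y - y'"] by (simp add: cong_J_def algebra_simps)

lemma cong_diff: "x \<simeq> x' \<Longrightarrow> y \<simeq> y' \<Longrightarrow> x - y \<simeq> x' - y'"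
  using J_intros(3)[of "x - x'" "y - y'"] by (simp add: cong_J_def algebra_simps)

lemma cong_mult_left: "x \<simeq> y \<Longrightarrow> a * x \<simeq> a * y"
  using mult_left[of "x - y" a] by (simp add: cong_J_def algebra_simps)

lemma cong_mult_right: "x \<simeq> y \<Longrightarrow> x * a \<simeq> y * a"
  using mult_right[of "x - y" a] by (simp add: cong_J_def algebra_simps)

lemma cong_mult: "x \<simeq> x' \<Longrightarrow> y \<simeq> y' \<Longrightarrow> x * y \<simeq> x' * y'"
  by (rule cong_trans[OF cong_mult_right cong_mult_left])

lemma cong_scaleR: "x \<simeq> y \<Longrightarrow> c *\<^sub>R x \<simeq> c *\<^sub>R y"
  using J_intros(5)[of "x - y" c] by (simp add: cong_J_def algebra_simps)

lemma cong_scaleC: "x \<simeq> y \<Longrightarrow> c *\<^sub>C x \<simeq> c *\<^sub>C y"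
  using scaleC_closed[of "x - y" c] by (simp add: cong_J_def scaleC_diff_right)

lemma cong_adj: "x \<simeq> y \<Longrightarrow> adj x \<simeq> adj y"
  using adj_closed[of "x - y"] by (simp add: cong_J_def)

lemma cong_sum: "(\<And>i. i \<in> I \<Longrightarrow> f i \<simeq> g i) \<Longrightarrow> sum f I \<simeq> sum g I"
  using J_intros(6)[of I "\<lambda>i. f i - g i"] by (simp add: cong_J_def sum_subtractf)

end

context thin_ideal
begin

section \<open>Minimal projections modulo \<open>J\<close> and their corners\<close>

lemma proj_cong: "proj e \<longleftrightarrow> adj e = e \<and> e * e \<simeq> e \<and> \<not> e \<simeq> 0"
  by (simp add: proj_def cong_J_def)

text \<open>Minimality is phrased as a one-dimensional corner rather than as absence of smaller
  projections; its failure hands over an element \<open>e * x * e\<close> to decompose.\<close>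

definition minimal_proj :: "'a \<Rightarrow> bool"
  where "minimal_proj e \<longleftrightarrow> proj e \<and> (\<forall>x. adj x = x \<longrightarrow> (\<exists>c. e * x * e \<simeq> c *\<^sub>R e))"

lemma proj_commute:
  assumes "adj e = e" "adj q = q" "e * q \<simeq> q"
  shows "q * e \<simeq> q"
  using cong_adj[OF assms(3)] by (simp add: assms)

lemma proj_orthogonal_commute:
  assumes "adj e = e" "adj q = q" "e * q \<simeq> 0"
  shows "q * e \<simeq> 0"
  using cong_adj[OF assms(3)] by (simp add: assms)

text \<open>The spectral projections of an \<open>e * x * e\<close> that is no multiple of
  \<open>e\<close> lie below \<open>e\<close>. Were all of them congruent to \<open>e\<close>, the
  decomposition would make \<open>e * x * e\<close> a multiple of \<open>e\<close> after
  all.\<close>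

lemma smaller_proj:
  assumes e: "proj e" "\<not> minimal_proj e"
  obtains q where "proj q" "e * q \<simeq> q" "\<not> q \<simeq> e"
proof -
  obtain x where x: "adj x = x" "\<And>c. \<not> e * x * e \<simeq> c *\<^sub>R e"
    using e by (auto simp: minimal_proj_def)
  define h where "h = e * x * e"
  have ee: "adj e = e" "e * e \<simeq> e" "\<not> e \<simeq> 0" using e by (auto simp: proj_cong)
  have h: "adj h = h" by (simp add: h_def ee x mult.assoc)
  obtain S p where p: "finite S" "\<And>\<kappa>. \<kappa> \<in> S \<Longrightarrow> proj (p \<kappa>)"
    "\<And>\<kappa> \<mu>. \<kappa> \<in> S \<Longrightarrow> \<mu> \<in> S \<Longrightarrow> \<kappa> \<noteq> \<mu> \<Longrightarrow> p \<kappa> * p \<mu> \<in> J"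
    "h - (\<Sum>\<kappa>\<in>S. \<kappa> *\<^sub>R p \<kappa>) \<in> J"
    "\<And>\<kappa> V. subspace V \<Longrightarrow> h \<in> V \<Longrightarrow> (\<And>y. y \<in> V \<Longrightarrow> h * y \<in> V) \<Longrightarrow> p \<kappa> \<in> V"
    by (rule spectral_decomposition[OF h]) blast
  have below: "e * p \<kappa> \<simeq> p \<kappa>" for \<kappa>
  proof -
    define V where "V = {y. e * y \<simeq> y}"
    have "p \<kappa> \<in> V"
    proof (rule p(5))
      show "subspace V"
        unfolding subspace_def V_def
        by (auto simp: distrib_left intro: cong_add cong_scaleR)
      have eh: "e * h \<simeq> h"
        using cong_mult_right[OF ee(2), of "x * e"] by (simp add: h_def mult.assoc)
      then show "h \<in> V" by (simp add: V_def)
      show "h * y \<in> V" for y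
        using cong_mult_right[OF eh, of y] by (simp add: V_def mult.assoc)
    qed
    then show ?thesis by (simp add: V_def)
  qed
  have "\<exists>\<kappa>\<in>S. \<not> p \<kappa> \<simeq> e"
  proof (rule ccontr)
    assume "\<not> ?thesis"
    then have all: "p \<kappa> \<simeq> e" if "\<kappa> \<in> S" for \<kappa> using that by blast
    have eq: "\<kappa> = \<mu>" if "\<kappa> \<in> S" "\<mu> \<in> S" for \<kappa> \<mu>
    proof (rule ccontr)
      assume "\<kappa> \<noteq> \<mu>"
      then have "p \<kappa> * p \<mu> \<simeq> 0" using p(3) that by (simp add: cong_zero)
      moreover have "e * e \<simeq> p \<kappa> * p \<mu>" by (intro cong_mult cong_sym[OF all] that)
      ultimately have "e \<simeq> 0" using ee(2) cong_sym cong_trans by blast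
      then show False using ee(3) by blast
    qed
    have "h \<simeq> (\<Sum>\<kappa>\<in>S. \<kappa> *\<^sub>R p \<kappa>)" using p(4) by (simp add: cong_J_def)
    also have "\<dots> \<simeq> (\<Sum>\<kappa>\<in>S. \<kappa> *\<^sub>R e)" by (intro cong_sum cong_scaleR all)
    finally show False using x(2)[of "\<Sum>S"] by (simp add: h_def scaleR_sum_left)
  qed
  then show ?thesis using that p(2) below by blast
qed

text \<open>Otherwise no projection below \<open>e\<close> is minimal, and repeated shrinking gives
  a strictly decreasing chain; the differences of its neighbours are infinitely many orthogonal
  projections.\<close>

lemma minimal_proj_below:
  assumes "proj e"
  obtains f where "minimal_proj f" "e * f \<simeq> f"
proof (rule ccontr)
  assume none: "\<not> thesis"
  define D where "D = {d. proj d \<and> (\<forall>f. minimal_proj f \<longrightarrow> \<not> d * f \<simeq> f)}"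
  have "e \<in> D" using assms none that by (auto simp: D_def)
  have step: "\<exists>q. q \<in> D \<and> d * q \<simeq> q \<and> \<not> q \<simeq> d" if "d \<in> D" for d
  proof -
    have d: "adj d = d" "d * d \<simeq> d" "proj d" using that by (auto simp: D_def proj_cong)
    then have "\<not> minimal_proj d" using that by (auto simp: D_def)
    then obtain q where q: "proj q" "d * q \<simeq> q" "\<not> q \<simeq> d"
      using smaller_proj[OF d(3)] by blast
    have "\<not> q * f \<simeq> f" if f: "minimal_proj f" for f
    proof
      assume qf: "q * f \<simeq> f"
      have "d * f \<simeq> d * (q * f)" by (intro cong_mult_left cong_sym[OF qf])
      also have "d * (q * f) = (d * q) * f" by (simp add: mult.assoc)
      also have "(d * q) * f \<simeq> q * f" by (intro cong_mult_right q)
      also note qf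
      finally show False using \<open>d \<in> D\<close> f by (auto simp: D_def)
    qed
    then show ?thesis using q by (auto simp: D_def)
  qed
  have "\<exists>E. \<forall>n. E n \<in> D \<and> E n * E (Suc n) \<simeq> E (Suc n) \<and> \<not> E (Suc n) \<simeq> E n"
    by (rule dependent_nat_choice) (use \<open>e \<in> D\<close> step in auto)
  then obtain E where E: "\<And>n. E n \<in> D" "\<And>n. E n * E (Suc n) \<simeq> E (Suc n)" "\<And>n. \<not> E (Suc n) \<simeq> E n"
    by blast
  have adjE: "adj (E n) = E n" and EE: "E n * E n \<simeq> E n" for n
    using E(1)[of n] by (auto simp: D_def proj_cong)
  have mono: "E m * E n \<simeq> E n" if "m \<le> n" for m n
    using that
  proof (induction n rule: dec_induct)
    case (step n)
    have "E m * E (Suc n) \<simeq> E m * (E n * E (Suc n))" by (intro cong_mult_left cong_sym[OF E(2)])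
    also have "E m * (E n * E (Suc n)) = (E m * E n) * E (Suc n)" by (simp add: mult.assoc)
    also have "\<dots> \<simeq> E n * E (Suc n)" by (intro cong_mult_right step.IH)
    also note E(2)
    finally show ?case .
  qed (rule EE)
  have comm: "E (Suc n) * E n \<simeq> E (Suc n)" for n by (rule proj_commute[OF adjE adjE E(2)])
  define d where "d n = E n - E (Suc n)" for n
  have adjd: "adj (d n) = d n" for n by (simp add: d_def adjE)
  have "proj (d n)" for n
    unfolding proj_cong
  proof (intro conjI)
    have "d n * d n = (E n * E n - E n * E (Suc n)) - (E (Suc n) * E n - E (Suc n) * E (Suc n))"
      by (simp add: d_def algebra_simps)
    also have "\<dots> \<simeq> (E n - E (Suc n)) - (E (Suc n) - E (Suc n))"
      by (intro cong_diff EE E(2) comm)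
    finally show "d n * d n \<simeq> d n" by (simp add: d_def)
    show "\<not> d n \<simeq> 0" using E(3)[of n] cong_sym by (auto simp: d_def cong_J_def[of _ 0] cong_J_def[of "E n"])
  qed (rule adjd)
  moreover have less: "d m * d n \<simeq> 0" if "m < n" for m n
  proof -
    have "d m * E k \<simeq> E k - E k" if "m < k" for k
      unfolding d_def left_diff_distrib using that by (intro cong_diff mono) auto
    then have "d m * E k \<simeq> 0" if "m < k" for k using that by simp
    then have "d m * E n - d m * E (Suc n) \<simeq> 0 - 0" using that by (intro cong_diff) auto
    then show ?thesis by (simp add: d_def[of n] right_diff_distrib)
  qed
  moreover have "d m * d n \<in> J" if "m \<noteq> n" for m n
    using less[of m n] proj_orthogonal_commute[OF adjd adjd less[of n m]] that
    by (auto simp: cong_zero neq_iff)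
  ultimately show False using no_orthogonal_sequence[of d] by blast
qed

text \<open>Zorn's lemma; finiteness comes from \<open>no_orthogonal_sequence\<close>. A projection
  \<open>q\<close> orthogonal to the family would dominate a minimal projection by which the family
  could be enlarged.\<close>

lemma maximal_orthogonal_family:
  obtains M where "finite M" "\<And>e. e \<in> M \<Longrightarrow> minimal_proj e"
    "\<And>e f. e \<in> M \<Longrightarrow> f \<in> M \<Longrightarrow> e \<noteq> f \<Longrightarrow> e * f \<simeq> 0"
    "\<And>q. proj q \<Longrightarrow> \<exists>e\<in>M. \<not> q * e \<simeq> 0"
proof -
  define \<A> where "\<A> = {M. (\<forall>e\<in>M. minimal_proj e) \<and> (\<forall>e\<in>M. \<forall>f\<in>M. e \<noteq> f \<longrightarrow> e * f \<simeq> 0)}"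
  have "\<exists>M\<in>\<A>. \<forall>X\<in>\<A>. M \<subseteq> X \<longrightarrow> X = M"
  proof (rule subset_Zorn_nonempty)
    show "\<A> \<noteq> {}" by (auto simp: \<A>_def)
    fix \<C> assume "\<C> \<noteq> {}" and chain: "subset.chain \<A> \<C>"
    have sub: "M \<in> \<A>" if "M \<in> \<C>" for M using chain that by (auto simp: subset.chain_def)
    have "e * f \<simeq> 0" if "e \<in> X" "X \<in> \<C>" "f \<in> Y" "Y \<in> \<C>" "e \<noteq> f" for e f X Y
    proof -
      have "X \<subseteq> Y \<or> Y \<subseteq> X" using chain that by (auto simp: subset_chain_def)
      then show ?thesis using that sub[of X] sub[of Y] by (auto simp: \<A>_def)
    qed
    then show "\<Union>\<C> \<in> \<A>" using sub by (auto simp: \<A>_def)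
  qed
  then obtain M where M: "M \<in> \<A>" "\<And>X. X \<in> \<A> \<Longrightarrow> M \<subseteq> X \<Longrightarrow> X = M" by blast
  have min: "minimal_proj e" if "e \<in> M" for e using M(1) that by (auto simp: \<A>_def)
  have orth: "e * f \<simeq> 0" if "e \<in> M" "f \<in> M" "e \<noteq> f" for e f using M(1) that by (auto simp: \<A>_def)
  show ?thesis
  proof (rule that[of M])
    show "finite M"
    proof (rule ccontr)
      assume "infinite M"
      then obtain g :: "nat \<Rightarrow> 'a" where g: "inj g" "range g \<subseteq> M"
        using infinite_countable_subset by blast
      show False
      proof (rule no_orthogonal_sequence[of g])
        show "proj (g n)" for n using min[of "g n"] g(2) by (auto simp: minimal_proj_def)
        show "g m * g n \<in> J" if "m \<noteq> n" for m n
          using orth[of "g m" "g n"] g that by (auto simp: cong_zero inj_eq)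
      qed
    qed
    show "\<exists>e\<in>M. \<not> q * e \<simeq> 0" if q: "proj q" for q
    proof (rule ccontr)
      assume "\<not> ?thesis"
      then have qe: "q * e \<simeq> 0" if "e \<in> M" for e using that by blast
      obtain f where f: "minimal_proj f" "q * f \<simeq> f" using minimal_proj_below[OF q] by blast
      have adjs: "adj q = q" "adj f = f" "\<not> f \<simeq> 0" using q f by (auto simp: proj_cong minimal_proj_def)
      have fe: "f * e \<simeq> 0" if "e \<in> M" for e
      proof -
        have "f * e \<simeq> (f * q) * e"
          by (intro cong_mult_right cong_sym[OF proj_commute[OF adjs(1,2) f(2)]])
        also have "(f * q) * e = f * (q * e)" by (simp add: mult.assoc)
        also have "\<dots> \<simeq> f * 0" by (intro cong_mult_left qe that)
        finally show ?thesis by simp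
      qed
      have ef: "e * f \<simeq> 0" if "e \<in> M" for e
        using proj_orthogonal_commute[OF adjs(2) _ fe[OF that]] min[OF that]
        by (auto simp: minimal_proj_def proj_cong)
      have "insert f M \<in> \<A>" using f(1) min orth ef fe by (auto simp: \<A>_def)
      then have "f \<in> M" using M(2)[of "insert f M"] by blast
      then have "q * f \<simeq> 0" by (rule qe)
      then show False using adjs(3) cong_trans[OF cong_sym[OF f(2)]] by blast
    qed
  qed (use min orth in auto)
qed

text \<open>The remainder \<open>y\<close> annihilates \<open>M\<close> from the left modulo
  \<open>J\<close>, hence so do the spectral projections of \<open>adj y * y\<close>. Maximality
  allows none of these, so \<open>adj y * y\<close>, and with it \<open>y\<close>, is in
  \<open>J\<close>.\<close>

lemma complement_in_J:
  assumes M: "finite M" "\<And>e. e \<in> M \<Longrightarrow> minimal_proj e"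
    "\<And>e f. e \<in> M \<Longrightarrow> f \<in> M \<Longrightarrow> e \<noteq> f \<Longrightarrow> e * f \<simeq> 0"
    "\<And>q. proj q \<Longrightarrow> \<exists>e\<in>M. \<not> q * e \<simeq> 0"
  shows "x \<simeq> x * \<Sum>M"
proof (rule ccontr)
  assume contra: "\<not> ?thesis"
  define y where "y = x - x * \<Sum>M"
  have "y \<notin> J" using contra by (simp add: y_def cong_J_def)
  have yf: "y * f \<simeq> 0" if "f \<in> M" for f
  proof -
    have "\<Sum>M * f = (\<Sum>e\<in>M. e * f)" by (rule sum_distrib_right)
    also have "\<dots> \<simeq> (\<Sum>e\<in>M. if e = f then f else 0)"
      using M(2)[OF that] M(3)[OF _ that] by (intro cong_sum) (auto simp: minimal_proj_def proj_cong)
    also have "\<dots> = f" using M(1) that by simp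
    finally have "x * f - x * (\<Sum>M * f) \<simeq> x * f - x * f" by (intro cong_diff cong_mult_left cong_refl)
    then show ?thesis by (simp add: y_def algebra_simps)
  qed
  define h where "h = adj y * y"
  have h: "adj h = h" by (simp add: h_def)
  have "h \<notin> J" using \<open>y \<notin> J\<close> mem_of_adj_mult[of y] unfolding h_def by blast
  obtain S p where p: "finite S" "\<And>\<kappa>. \<kappa> \<in> S \<Longrightarrow> proj (p \<kappa>)"
    "h - (\<Sum>\<kappa>\<in>S. \<kappa> *\<^sub>R p \<kappa>) \<in> J"
    "\<And>\<kappa> V. subspace V \<Longrightarrow> h \<in> V \<Longrightarrow> (\<And>y. y \<in> V \<Longrightarrow> h * y \<in> V) \<Longrightarrow> p \<kappa> \<in> V"
    by (rule spectral_decomposition[OF h]) blast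
  have "S \<noteq> {}" using p(3) \<open>h \<notin> J\<close> by auto
  then obtain \<kappa> where "\<kappa> \<in> S" by blast
  then obtain f where f: "f \<in> M" "\<not> p \<kappa> * f \<simeq> 0" using M(4) p(2) by blast
  define V where "V = {z. z * f \<in> J}"
  have "p \<kappa> \<in> V"
  proof (rule p(4))
    show "subspace V" unfolding subspace_def V_def by (auto simp: distrib_right intro: J_intros)
    show "h \<in> V" using yf[OF f(1)] mult_left[of "y * f" "adj y"] by (simp add: V_def h_def cong_zero mult.assoc)
    show "h * z \<in> V" if "z \<in> V" for z using that by (simp add: V_def mult.assoc mult_left)
  qed
  then show False using f(2) by (simp add: V_def cong_zero)
qed

lemma minimal_proj_complex:
  assumes "minimal_proj e"
  obtains c where "e * z * e \<simeq> c *\<^sub>C e"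
proof -
  obtain x y where z: "z = x + \<i> *\<^sub>C y" "adj x = x" "adj y = y"
    by (rule cartesian_decomposition)
  obtain a b where "e * x * e \<simeq> a *\<^sub>R e" "e * y * e \<simeq> b *\<^sub>R e"
    using assms z unfolding minimal_proj_def by blast
  then have "e * x * e + \<i> *\<^sub>C (e * y * e) \<simeq> a *\<^sub>R e + \<i> *\<^sub>C (b *\<^sub>R e)"
    by (intro cong_add cong_scaleC)
  then have "e * z * e \<simeq> (complex_of_real a + \<i> * complex_of_real b) *\<^sub>C e"
    by (simp add: z(1) distrib_left distrib_right mult_scaleC_left mult_scaleC_right
        scaleR_scaleC scaleC_scaleC scaleC_add_left)
  then show ?thesis by (rule that)
qed

text \<open>Fix \<open>v = e * x * f\<close> outside \<open>J\<close>. Minimality of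
  \<open>f\<close> gives \<open>adj v * v \<simeq> b *\<^sub>R f\<close> with
  \<open>b \<noteq> 0\<close>, that of \<open>e\<close> gives
  \<open>w * adj v \<simeq> c *\<^sub>C e\<close> for each \<open>w\<close> in the corner; comparing
  both in \<open>w * adj v * v\<close> makes \<open>w\<close> a multiple of
  \<open>v\<close>.\<close>

lemma corner_one_dimensional:
  assumes e: "minimal_proj e" and f: "minimal_proj f"
  obtains v where "\<And>x. \<exists>c. e * x * f \<simeq> c *\<^sub>C v"
proof (cases "\<forall>x. e * x * f \<simeq> 0")
  case True
  then have "\<exists>c. e * x * f \<simeq> c *\<^sub>C 0" for x by (intro exI[of _ 0]) simp
  then show ?thesis by (rule that)
next
  case False
  then obtain x where x: "\<not> e * x * f \<simeq> 0" by blast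
  define v where "v = e * x * f"
  have e': "adj e = e" "e * e \<simeq> e" and f': "adj f = f" "f * f \<simeq> f"
    using e f by (auto simp: minimal_proj_def proj_cong)
  have ev: "e * v \<simeq> v" using cong_mult_right[OF e'(2), of "x * f"] by (simp add: v_def mult.assoc)
  have adj_v: "adj v = f * adj x * e" by (simp add: v_def e' f' mult.assoc)
  have "adj (adj x * e * e * x) = adj x * e * e * x" by (simp add: e' mult.assoc)
  then obtain b where "f * (adj x * e * e * x) * f \<simeq> b *\<^sub>R f"
    using f unfolding minimal_proj_def by blast
  then have vv: "adj v * v \<simeq> b *\<^sub>R f" by (simp add: v_def e' f' mult.assoc)
  have "b \<noteq> 0"
  proof
    assume "b = 0"
    then have "v \<in> J" using vv mem_of_adj_mult[of v] by (simp add: cong_zero)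
    then show False using x by (simp add: v_def cong_zero)
  qed
  have "\<exists>c. e * y * f \<simeq> c *\<^sub>C v" for y
  proof -
    define w where "w = e * y * f"
    have wf: "w * f \<simeq> w" using cong_mult_left[OF f'(2), of "e * y"] by (simp add: w_def mult.assoc)
    obtain c where "e * (y * f * f * adj x) * e \<simeq> c *\<^sub>C e"
      by (rule minimal_proj_complex[OF e])
    then have wv: "w * adj v \<simeq> c *\<^sub>C e" by (simp add: w_def adj_v mult.assoc)
    have "b *\<^sub>R w \<simeq> b *\<^sub>R (w * f)" by (intro cong_scaleR cong_sym[OF wf])
    also have "\<dots> = w * (b *\<^sub>R f)" by simp
    also have "\<dots> \<simeq> w * (adj v * v)" by (intro cong_mult_left cong_sym[OF vv])
    also have "\<dots> = (w * adj v) * v" by (simp add: mult.assoc)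
    also have "\<dots> \<simeq> (c *\<^sub>C e) * v" by (intro cong_mult_right wv)
    also have "\<dots> = c *\<^sub>C (e * v)" by (rule mult_scaleC_left)
    also have "\<dots> \<simeq> c *\<^sub>C v" by (intro cong_scaleC ev)
    finally have "inverse b *\<^sub>R (b *\<^sub>R w) \<simeq> inverse b *\<^sub>R (c *\<^sub>C v)" by (rule cong_scaleR)
    then have "w \<simeq> (complex_of_real (inverse b) * c) *\<^sub>C v"
      using \<open>b \<noteq> 0\<close> by (simp add: scaleR_scaleC scaleC_scaleC)
    then show ?thesis unfolding w_def by blast
  qed
  then show ?thesis by (rule that)
qed

theorem finite_dimensional_quotient:
  obtains M v where "finite M" "\<And>x. x - (\<Sum>e\<in>M. \<Sum>f\<in>M. e * x * f) \<in> J"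
    "\<And>e f x. e \<in> M \<Longrightarrow> f \<in> M \<Longrightarrow> \<exists>c. e * x * f - c *\<^sub>C v e f \<in> J"
proof -
  obtain M where M: "finite M" "\<And>e. e \<in> M \<Longrightarrow> minimal_proj e"
    "\<And>e f. e \<in> M \<Longrightarrow> f \<in> M \<Longrightarrow> e \<noteq> f \<Longrightarrow> e * f \<simeq> 0"
    "\<And>q. proj q \<Longrightarrow> \<exists>e\<in>M. \<not> q * e \<simeq> 0"
    by (rule maximal_orthogonal_family) blast
  have right: "x \<simeq> x * \<Sum>M" for x by (rule complement_in_J[OF M])
  have "adj (\<Sum>M) = \<Sum>M"
    using M(2) by (simp add: adj_sum minimal_proj_def proj_def)
  then have left: "x \<simeq> \<Sum>M * x" for x using cong_adj[OF right[of "adj x"]] by simp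
  have "x \<simeq> (\<Sum>e\<in>M. \<Sum>f\<in>M. e * x * f)" for x
  proof -
    have "x \<simeq> \<Sum>M * (x * \<Sum>M)" using left[of x] cong_mult_left[OF right] by (rule cong_trans)
    also have "\<dots> = (\<Sum>e\<in>M. e * (x * \<Sum>M))" by (rule sum_distrib_right)
    also have "\<dots> = (\<Sum>e\<in>M. \<Sum>f\<in>M. e * x * f)"
      by (simp add: sum_distrib_left mult.assoc)
    finally show ?thesis .
  qed
  moreover have "\<exists>v. \<forall>x. \<exists>c. e * x * f \<simeq> c *\<^sub>C v" if "e \<in> M" "f \<in> M" for e f
    using corner_one_dimensional[OF M(2)[OF that(1)] M(2)[OF that(2)]] by metis
  then obtain v where "\<And>e f x. e \<in> M \<Longrightarrow> f \<in> M \<Longrightarrow> \<exists>c. e * x * f \<simeq> c *\<^sub>C v e f" by metis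
  ultimately show ?thesis using that[OF M(1)] unfolding cong_J_def by blast
qed

end

section \<open>Generalized derivations of the third type are bounded\<close>

lemma bounded_linear_bound:
  "bounded_linear f \<Longrightarrow> \<exists>C\<ge>0. \<forall>z. norm (f z) \<le> C * norm z"
  by (metis bounded_linear.nonneg_bounded mult.commute)

lemma bounded_linearI_linear:
  assumes "linear f" "\<And>z. norm (f z) \<le> C * norm z"
  shows "bounded_linear f"
  using assms
  by (intro bounded_linear_intro[where K = C]) (simp_all add: linear_add linear_scale mult.commute)

lemma linear_mult_right: "linear (\<lambda>z. z * (t :: 'a::real_normed_algebra))"
  by (intro linearI) (simp_all add: distrib_right)

text \<open>Along a convergent sequence of parameters the operators converge pointwise, so they have
  a common bound, which the limit inherits.\<close>

lemma closed_bounded_operators: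
  fixes \<beta> :: "'a::banach \<Rightarrow> 'b::banach \<Rightarrow> 'c::real_normed_vector"
  assumes lin: "\<And>t. linear (\<beta> t)" and cont: "\<And>z. continuous_on UNIV (\<lambda>t. \<beta> t z)"
  shows "closed {t. \<exists>C. \<forall>z. norm (\<beta> t z) \<le> C * norm z}"
  unfolding closed_sequential_limits
proof (intro allI impI, elim conjE)
  fix s l
  assume s: "\<forall>n. s n \<in> {t. \<exists>C. \<forall>z. norm (\<beta> t z) \<le> C * norm z}" and l: "s \<longlonglongrightarrow> l"
  have lim: "(\<lambda>n. \<beta> (s n) z) \<longlonglongrightarrow> \<beta> l z" for z
    using cont[of z] l by (auto simp: continuous_on_eq_continuous_at intro: isCont_tendsto_compose)
  have "\<exists>C\<ge>0. \<forall>n\<in>UNIV. \<forall>z\<in>UNIV. norm (\<beta> (s n) z) \<le> C * norm z"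
  proof (rule uniform_boundedness)
    show "\<exists>C. \<forall>z\<in>UNIV. norm (\<beta> (s n) z) \<le> C * norm z" for n using s by simp
    show "\<exists>C. \<forall>n\<in>UNIV. norm (\<beta> (s n) z) \<le> C" for z
      using convergent_imp_Bseq[OF convergentI[OF lim[of z]]] by (auto simp: Bseq_def)
  qed (simp_all add: linear_add[OF lin] linear_scale[OF lin])
  then obtain C where C: "\<And>n z. norm (\<beta> (s n) z) \<le> C * norm z" by blast
  have "norm (\<beta> l z) \<le> C * norm z" for z
    by (rule Lim_bounded[OF tendsto_norm[OF lim], of 0]) (use C in blast)
  then show "l \<in> {t. \<exists>C. \<forall>z. norm (\<beta> t z) \<le> C * norm z}" by blast
qed

text \<open>Choose \<open>x n\<close> of norm \<open>(1/2) ^ n\<close> at which \<open>f n\<close>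
  exceeds \<open>\<bar>p n\<bar> + q * real n\<close>. A constant \<open>k\<close> depending on the
  whole sequence but not on \<open>n\<close> is beaten as soon as \<open>n \<ge> k\<close>.\<close>

lemma gliding_hump:
  fixes f :: "nat \<Rightarrow> 'a::real_normed_vector \<Rightarrow> 'b::real_normed_vector"
  assumes scale: "\<And>n c z. f n (c *\<^sub>R z) = c *\<^sub>R f n z"
    and unbounded: "\<And>n. \<not> (\<exists>C. \<forall>z. norm (f n z) \<le> C * norm z)"
    and bound: "\<And>x. (\<And>n. norm (x n) \<le> (1/2) ^ n) \<Longrightarrow> \<exists>k. \<forall>n. norm (f n (x n)) \<le> p n + q * k"
    and "q \<ge> 0"
  shows False
proof -
  have "\<exists>z. norm z \<le> (1/2) ^ n \<and> norm (f n z) > \<bar>p n\<bar> + q * real n" for n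
  proof -
    define B where "B = \<bar>p n\<bar> + q * real n"
    obtain z where z: "norm (f n z) > (B * 2 ^ n) * norm z" using unbounded[of n] by (meson not_le)
    have "z \<noteq> 0" using z scale[of n 0 0] by auto
    define c where "c = (1/2) ^ n / norm z"
    have "c > 0" using \<open>z \<noteq> 0\<close> by (simp add: c_def)
    have "norm (c *\<^sub>R z) = (1/2) ^ n" using \<open>z \<noteq> 0\<close> by (simp add: c_def)
    moreover have "c * ((B * 2 ^ n) * norm z) < c * norm (f n z)"
      using z \<open>c > 0\<close> by (rule mult_strict_left_mono)
    then have "B < norm (f n (c *\<^sub>R z))"
      using \<open>z \<noteq> 0\<close> \<open>c > 0\<close> by (simp add: scale) (simp add: c_def power_one_over field_simps)
    ultimately show ?thesis by (intro exI[of _ "c *\<^sub>R z"]) (simp add: B_def)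
  qed
  then obtain x where x: "\<And>n. norm (x n) \<le> (1/2) ^ n" "\<And>n. norm (f n (x n)) > \<bar>p n\<bar> + q * real n"
    by metis
  obtain k where k: "\<And>n. norm (f n (x n)) \<le> p n + q * k" using bound[OF x(1)] by blast
  obtain n :: nat where "k \<le> real n" using real_arch_simple by blast
  then have "q * k \<le> q * real n" using \<open>q \<ge> 0\<close> by (rule mult_left_mono)
  then show False using k[of n] x(2)[of n] abs_ge_self[of "p n"] by linarith
qed

lemma orthogonal_series:
  fixes a x :: "nat \<Rightarrow> 'a::complex_banach_algebra"
  assumes a: "\<And>n. norm (a n) \<le> 1" and x: "\<And>n. norm (x n) \<le> (1/2) ^ n"
  shows "(\<lambda>n. a n * x n) sums (\<Sum>n. a n * x n)" "norm (\<Sum>n. a n * x n) \<le> 2"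
    "(\<lambda>n. x n * a n) sums (\<Sum>n. x n * a n)" "norm (\<Sum>n. x n * a n) \<le> 2"
proof -
  have geo: "(\<lambda>n. (1/2::real) ^ n) sums 2" using geometric_sums[of "1/2::real"] by simp
  have *: "y sums suminf y \<and> norm (suminf y) \<le> 2" if "\<And>n. norm (y n) \<le> (1/2) ^ n" for y :: "nat \<Rightarrow> 'a"
    using summable_comparison_test'[OF sums_summable[OF geo], of 0 y] that
      norm_suminf_le[OF that sums_summable[OF geo]] sums_unique[OF geo] by (auto intro: summable_sums)
  have "norm (a n * x n) \<le> (1/2) ^ n" "norm (x n * a n) \<le> (1/2) ^ n" for n
    using norm_mult_ineq[of "a n" "x n"] norm_mult_ineq[of "x n" "a n"] mult_mono[OF a[of n] x[of n]]
    by (simp_all add: mult.commute)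
  then show "(\<lambda>n. a n * x n) sums (\<Sum>n. a n * x n)" "norm (\<Sum>n. a n * x n) \<le> 2"
    "(\<lambda>n. x n * a n) sums (\<Sum>n. x n * a n)" "norm (\<Sum>n. x n * a n) \<le> 2"
    using *[of "\<lambda>n. a n * x n"] *[of "\<lambda>n. x n * a n"] by auto
qed

lemma clinear_imp_linear:
  fixes f :: "'a::complex_normed_vector \<Rightarrow> 'b::complex_normed_vector"
  assumes "clinear f"
  shows "linear f"
  by (intro linearI) (simp_all add: clinear_add[OF assms] clinear_scaleC[OF assms] scaleR_scaleC)

context banach_bimodule
begin

lemma bounded_linear_lact: "bounded_linear (lact a)"
proof -
  obtain K where K: "\<And>a x. norm (lact a x) \<le> K * norm a * norm x" using lact_bound by blast
  show ?thesis
    by (rule bounded_linear_intro[where K = "K * norm a"])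
      (use K[of a] in \<open>simp_all add: linear_add[OF clinear_imp_linear[OF lact_linear_right]]
        linear_scale[OF clinear_imp_linear[OF lact_linear_right]] mult.commute\<close>)
qed

lemma bounded_linear_lact_left: "bounded_linear (\<lambda>a. lact a x)"
proof -
  obtain K where K: "\<And>a x. norm (lact a x) \<le> K * norm a * norm x" using lact_bound by blast
  show ?thesis
    by (rule bounded_linear_intro[where K = "K * norm x"])
      (use K[of _ x] in \<open>simp_all add: linear_add[OF clinear_imp_linear[OF lact_linear_left]]
        linear_scale[OF clinear_imp_linear[OF lact_linear_left]] mult_ac\<close>)
qed

lemma bounded_linear_ract: "bounded_linear (ract x)"
proof -
  obtain K where K: "\<And>a x. norm (ract x a) \<le> K * norm x * norm a" using ract_bound by blast
  show ?thesis
    by (rule bounded_linear_intro[where K = "K * norm x"])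
      (use K[of x] in \<open>simp_all add: linear_add[OF clinear_imp_linear[OF ract_linear_right]]
        linear_scale[OF clinear_imp_linear[OF ract_linear_right]] mult.commute\<close>)
qed

lemma bounded_linear_ract_left: "bounded_linear (\<lambda>x. ract x a)"
proof -
  obtain K where K: "\<And>a x. norm (ract x a) \<le> K * norm x * norm a" using ract_bound by blast
  show ?thesis
    by (rule bounded_linear_intro[where K = "K * norm a"])
      (use K[of _ a] in \<open>simp_all add: linear_add[OF clinear_imp_linear[OF ract_linear_left]]
        linear_scale[OF clinear_imp_linear[OF ract_linear_left]] mult_ac\<close>)
qed

lemmas lact_linear_simps = linear_add[OF bounded_linear.linear[OF bounded_linear_lact]]
  linear_diff[OF bounded_linear.linear[OF bounded_linear_lact]]
  linear_add[OF bounded_linear.linear[OF bounded_linear_lact_left]]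
lemmas ract_linear_simps = linear_add[OF bounded_linear.linear[OF bounded_linear_ract]]
  linear_diff[OF bounded_linear.linear[OF bounded_linear_ract_left]]
  linear_add[OF bounded_linear.linear[OF bounded_linear_ract_left]]

end

section \<open>The triple identity and the ideal on which multiplication tames
  \<open>F\<close>\<close>

locale third_type_derivation = banach_bimodule lact ract
  for lact :: "'a::cstar_algebra \<Rightarrow> 'm::{complex_normed_vector, banach} \<Rightarrow> 'm"
    and ract :: "'m \<Rightarrow> 'a \<Rightarrow> 'm" +
  fixes F G H :: "'a \<Rightarrow> 'm"
  assumes clinear_F: "clinear F"
    and F_mult: "F (a * b) = ract (G a) b + lact a (H b)"
begin

lemma linear_F: "linear F" by (rule clinear_imp_linear[OF clinear_F])

lemmas F_simps = linear_0[OF linear_F] linear_add[OF linear_F] linear_diff[OF linear_F]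
  linear_scale[OF linear_F] linear_sum[OF linear_F] clinear_scaleC[OF clinear_F]

text \<open>
  Comparing the two ways of splitting a triple product eliminates \<open>G\<close> and \<open>H\<close>, first for
  \<open>x = b c\<close>; every element is a sum of such products.
\<close>

lemma F_triple: "F (a * x * d) = ract (F (a * x)) d + lact a (F (x * d)) - lact a (ract (F x) d)"
proof -
  have prod: "F (a * (b * c) * d) =
      ract (F (a * (b * c))) d + lact a (F (b * c * d)) - lact a (ract (F (b * c)) d)" for b c
  proof -
    \<comment> \<open>The right-hand side is a right module map in \<open>y\<close>, although
      \<open>H\<close> alone is not. Comparing \<open>y = c * d\<close> with \<open>y = c\<close>
      followed by the action of \<open>d\<close> gives the equation below.\<close>
    have "lact a (H (b * y)) - lact a (lact b (H y)) = ract (G (a * b)) y - ract (ract (G a) b) y" for y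
      using F_mult[of "a * b" y] F_mult[of a "b * y"]
      by (simp add: mult.assoc lact_mult ract_mult algebra_simps)
    from this[of "c * d"] arg_cong[OF this[of c], of "\<lambda>m. ract m d"]
    have *: "lact a (H (b * (c * d))) - lact a (lact b (H (c * d))) =
        lact a (ract (H (b * c)) d) - lact a (lact b (ract (H c) d))"
      by (simp add: ract_linear_simps lact_ract ract_mult)
    have "F (a * (b * c) * d) = ract (ract (G a) (b * c)) d + lact a (H (b * (c * d)))"
      using F_mult[of a "b * (c * d)"] by (simp add: mult.assoc ract_mult)
    moreover have "ract (F (a * (b * c))) d = ract (ract (G a) (b * c)) d + lact a (ract (H (b * c)) d)"
      by (simp add: F_mult[of a "b * c"] ract_linear_simps lact_ract)
    moreover have "lact a (F (b * c * d)) = lact a (ract (ract (G b) c) d) + lact a (lact b (H (c * d)))"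
      using F_mult[of b "c * d"] by (simp add: mult.assoc ract_mult lact_linear_simps)
    moreover have "lact a (ract (F (b * c)) d) = lact a (ract (ract (G b) c) d) + lact a (lact b (ract (H c) d))"
      by (simp add: F_mult[of b c] ract_linear_simps lact_linear_simps lact_ract)
    ultimately show ?thesis using * by (simp add: algebra_simps)
  qed
  obtain b c b' c' where "x = b * c + b' * c'" by (rule sum_of_products)
  then show ?thesis
    using prod[of b c] prod[of b' c']
    by (simp add: distrib_left distrib_right F_simps ract_linear_simps lact_linear_simps)
qed

definition J_left :: "'a set"
  where "J_left = {t. \<exists>C. \<forall>z. norm (F (t * z)) \<le> C * norm z}"

definition J_right :: "'a set"
  where "J_right = {t. \<exists>C. \<forall>z. norm (F (z * t)) \<le> C * norm z}"

lemma linear_F_mult: "linear (\<lambda>z. F (t * z))" "linear (\<lambda>z. F (z * t))"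
  using linear_compose[OF linear_mult_left linear_F] linear_compose[OF linear_mult_right linear_F]
  by (simp_all add: o_def)

lemma J_leftD: "t \<in> J_left \<Longrightarrow> bounded_linear (\<lambda>z. F (t * z))"
  unfolding J_left_def using bounded_linearI_linear[OF linear_F_mult(1)] by blast

lemma J_leftI: "bounded_linear (\<lambda>z. F (t * z)) \<Longrightarrow> t \<in> J_left"
  using bounded_linear_bound[of "\<lambda>z. F (t * z)"] by (auto simp: J_left_def)

lemma J_rightD: "t \<in> J_right \<Longrightarrow> bounded_linear (\<lambda>z. F (z * t))"
  unfolding J_right_def using bounded_linearI_linear[OF linear_F_mult(2)] by blast

lemma J_rightI: "bounded_linear (\<lambda>z. F (z * t)) \<Longrightarrow> t \<in> J_right"
  using bounded_linear_bound[of "\<lambda>z. F (z * t)"] by (auto simp: J_right_def)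

text \<open>\<open>F (t * z)\<close> is not known to be continuous in \<open>t\<close>, which
  closedness of \<open>J_left\<close> would require. It differs from \<open>lact t (H z)\<close> by
  a term bounded in \<open>z\<close>, and that expression is continuous in \<open>t\<close>, and
  linear in \<open>z\<close> even though \<open>H\<close> need not be.\<close>

lemma J_left_iff: "t \<in> J_left \<longleftrightarrow> (\<exists>C. \<forall>z. norm (lact t (H z)) \<le> C * norm z)" (is "_ \<longleftrightarrow> ?R")
  and linear_lact_H: "linear (\<lambda>z. lact t (H z))"
proof -
  have eq: "lact t (H z) = F (t * z) - ract (G t) z" for z by (simp add: F_mult)
  show lin: "linear (\<lambda>z. lact t (H z))"
    unfolding eq by (intro linear_compose_sub linear_F_mult bounded_linear.linear[OF bounded_linear_ract])
  show "t \<in> J_left \<longleftrightarrow> ?R"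
  proof
    assume "t \<in> J_left"
    then have "bounded_linear (\<lambda>z. lact t (H z))"
      unfolding eq by (intro bounded_linear_sub J_leftD bounded_linear_ract)
    then show ?R using bounded_linear_bound by blast
  next
    assume ?R
    then have "bounded_linear (\<lambda>z. lact t (H z))"
      using bounded_linearI_linear[OF lin] by blast
    then have "bounded_linear (\<lambda>z. lact t (H z) + ract (G t) z)"
      by (intro bounded_linear_add bounded_linear_ract)
    then show "t \<in> J_left" unfolding eq by (intro J_leftI) simp
  qed
qed

lemma J_right_iff: "t \<in> J_right \<longleftrightarrow> (\<exists>C. \<forall>z. norm (ract (G z) t) \<le> C * norm z)" (is "_ \<longleftrightarrow> ?R")
  and linear_ract_G: "linear (\<lambda>z. ract (G z) t)"
proof -
  have eq: "ract (G z) t = F (z * t) - lact z (H t)" for z by (simp add: F_mult)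
  show lin: "linear (\<lambda>z. ract (G z) t)"
    unfolding eq by (intro linear_compose_sub linear_F_mult bounded_linear.linear[OF bounded_linear_lact_left])
  show "t \<in> J_right \<longleftrightarrow> ?R"
  proof
    assume "t \<in> J_right"
    then have "bounded_linear (\<lambda>z. ract (G z) t)"
      unfolding eq by (intro bounded_linear_sub J_rightD bounded_linear_lact_left)
    then show ?R using bounded_linear_bound by blast
  next
    assume ?R
    then have "bounded_linear (\<lambda>z. ract (G z) t)"
      using bounded_linearI_linear[OF lin] by blast
    then have "bounded_linear (\<lambda>z. ract (G z) t + lact z (H t))"
      by (intro bounded_linear_add bounded_linear_lact_left)
    then show "t \<in> J_right" unfolding eq by (intro J_rightI) simp
  qed
qed

lemma closed_J_left: "closed J_left"
  using closed_bounded_operators[of "\<lambda>t z. lact t (H z)"] linear_lact_H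
    linear_continuous_on[OF bounded_linear_lact_left]
  unfolding J_left_iff[symmetric] by simp

lemma closed_J_right: "closed J_right"
  using closed_bounded_operators[of "\<lambda>t z. ract (G z) t"] linear_ract_G
    linear_continuous_on[OF bounded_linear_ract]
  unfolding J_right_iff[symmetric] by simp

end

lemma bounded_linear_scaleC: "bounded_linear (\<lambda>x :: 'a::complex_normed_vector. c *\<^sub>C x)"
  by (rule bounded_linear_intro[where K = "cmod c"])
    (simp_all add: scaleC_add_right scaleC_scaleR norm_scaleC mult.commute)

text \<open>The coefficient of \<open>v\<close> modulo \<open>J\<close> is continuous: a ball of
  radius \<open>d\<close> around \<open>v\<close> misses \<open>J\<close>, and rescaling
  \<open>w\<close> by the inverse of \<open>c\<close> lands at distance
  \<open>norm w / cmod c\<close> from \<open>v\<close>.\<close>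

lemma one_dimensional_bound:
  fixes J :: "'a::complex_normed_vector set"
  assumes J: "closed J" "v \<notin> J" "\<And>c x. x \<in> J \<Longrightarrow> c *\<^sub>C x \<in> J"
  shows "\<exists>d>0. \<forall>c w. w - c *\<^sub>C v \<in> J \<longrightarrow> cmod c * d \<le> norm w"
proof -
  have "open (- J)" using J(1) by (simp add: open_Compl)
  then obtain d where d: "d > 0" "\<And>y. dist y v < d \<Longrightarrow> y \<notin> J"
    using J(2) unfolding open_dist by (metis Compl_iff)
  have "cmod c * d \<le> norm w" if w: "w - c *\<^sub>C v \<in> J" for c w
  proof (cases "c = 0")
    case False
    have "(- inverse c) *\<^sub>C (w - c *\<^sub>C v) = v - inverse c *\<^sub>C w"
      using False by (simp add: scaleC_minus_left scaleC_diff_right scaleC_scaleC)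
    then have "v - inverse c *\<^sub>C w \<in> J" using J(3)[OF w, of "- inverse c"] by simp
    then have "d \<le> dist (v - inverse c *\<^sub>C w) v" using d(2) not_less by blast
    also have "\<dots> = norm w / cmod c"
      by (simp add: dist_norm norm_scaleC norm_inverse divide_inverse mult.commute)
    finally show ?thesis using False by (simp add: field_simps)
  qed simp
  then show ?thesis using d(1) by blast
qed

context third_type_derivation
begin

lemma J_left_closure:
  "0 \<in> J_left" "s \<in> J_left \<Longrightarrow> t \<in> J_left \<Longrightarrow> s + t \<in> J_left"
  "t \<in> J_left \<Longrightarrow> c *\<^sub>C t \<in> J_left" "t \<in> J_left \<Longrightarrow> s * t \<in> J_left" "t \<in> J_left \<Longrightarrow> t * s \<in> J_left"
proof -
  show "0 \<in> J_left" by (rule J_leftI) (simp add: F_simps)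
  show "s + t \<in> J_left" if "s \<in> J_left" "t \<in> J_left"
    by (rule J_leftI) (simp add: distrib_right F_simps bounded_linear_add J_leftD that)
  show "c *\<^sub>C t \<in> J_left" if "t \<in> J_left"
    by (rule J_leftI)
      (simp add: mult_scaleC_left F_simps bounded_linear_compose[OF bounded_linear_scaleC J_leftD[OF that]])
  \<comment> \<open>The extra factor is on the wrong side of \<open>t\<close>; the triple identity
    reduces \<open>F (s * t * z)\<close> to \<open>F (t * z)\<close> and terms bounded in
    \<open>z\<close>.\<close>
  show "s * t \<in> J_left" if "t \<in> J_left"
    by (rule J_leftI, subst F_triple)
      (intro bounded_linear_sub bounded_linear_add bounded_linear_ract
        bounded_linear_compose[OF bounded_linear_lact J_leftD[OF that]]
        bounded_linear_compose[OF bounded_linear_lact bounded_linear_ract])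
  show "t * s \<in> J_left" if "t \<in> J_left"
    by (rule J_leftI)
      (simp add: mult.assoc bounded_linear_compose[OF J_leftD[OF that] bounded_linear_mult_right])
qed

lemma J_right_closure:
  "0 \<in> J_right" "s \<in> J_right \<Longrightarrow> t \<in> J_right \<Longrightarrow> s + t \<in> J_right"
  "t \<in> J_right \<Longrightarrow> c *\<^sub>C t \<in> J_right" "t \<in> J_right \<Longrightarrow> s * t \<in> J_right" "t \<in> J_right \<Longrightarrow> t * s \<in> J_right"
proof -
  show "0 \<in> J_right" by (rule J_rightI) (simp add: F_simps)
  show "s + t \<in> J_right" if "s \<in> J_right" "t \<in> J_right"
    by (rule J_rightI) (simp add: distrib_left F_simps bounded_linear_add J_rightD that)
  show "c *\<^sub>C t \<in> J_right" if "t \<in> J_right"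
    by (rule J_rightI)
      (simp add: mult_scaleC_right F_simps bounded_linear_compose[OF bounded_linear_scaleC J_rightD[OF that]])
  show "s * t \<in> J_right" if "t \<in> J_right"
    by (rule J_rightI)
      (simp add: mult.assoc[symmetric] bounded_linear_compose[OF J_rightD[OF that] bounded_linear_mult_left])
  have *: "F (z * (t * s)) = ract (F (z * t)) s + lact z (F (t * s)) - lact z (ract (F t) s)" for z
    using F_triple[of z t s] by (simp add: mult.assoc)
  show "t * s \<in> J_right" if "t \<in> J_right"
    by (rule J_rightI, subst *)
      (intro bounded_linear_sub bounded_linear_add bounded_linear_lact_left
        bounded_linear_compose[OF bounded_linear_ract_left J_rightD[OF that]])
qed

definition J_cont :: "'a set"
  where "J_cont = {t. t \<in> J_left \<and> t \<in> J_right \<and> adj t \<in> J_left \<and> adj t \<in> J_right}"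

sublocale closed_star_ideal J_cont
proof
  show "subspace J_cont"
    unfolding subspace_def J_cont_def
    by (simp add: J_left_closure J_right_closure scaleR_scaleC adj_scaleC)
  have "closed (J_left \<inter> J_right \<inter> adj -` (J_left \<inter> J_right))"
    by (intro closed_Int closed_J_left closed_J_right continuous_closed_vimage)
      (simp add: linear_continuous_at[OF bounded_linear_adj])
  moreover have "J_left \<inter> J_right \<inter> adj -` (J_left \<inter> J_right) = J_cont"
    by (auto simp: J_cont_def)
  ultimately show "closed J_cont" by simp
qed (simp_all add: J_cont_def J_left_closure J_right_closure adj_scaleC)

section \<open>Orthogonal sequences meet the ideal\<close>

lemma orthogonal_J_left:
  fixes a :: "nat \<Rightarrow> 'a"
  assumes orth: "\<And>m n. m \<noteq> n \<Longrightarrow> a m * a n = 0" and a: "\<And>n. norm (a n) \<le> 1"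
  shows "\<exists>n. a n * a n \<in> J_left"
proof (rule ccontr)
  assume none: "\<not> ?thesis"
  obtain K where K: "K \<ge> 0" "\<And>a x. norm (lact a x) \<le> K * norm a * norm x" using lact_bound by blast
  obtain L where L: "L \<ge> 0" "\<And>a x. norm (ract x a) \<le> L * norm x * norm a" using ract_bound by blast
  show False
  \<comment> \<open>\<open>p n\<close> collects what depends on \<open>a n\<close> alone, with 2
    bounding the norm of the series; \<open>norm (H s)\<close> will be the constant of the whole
    sequence.\<close>
  proof (rule gliding_hump[where f = "\<lambda>n z. F (a n * a n * z)" and p = "\<lambda>n. L * norm (G (a n)) * 2" and q = K])
    show "\<not> (\<exists>C. \<forall>z. norm (F (a n * a n * z)) \<le> C * norm z)" for n
      using none unfolding J_left_def by blast
    show "F (a n * a n * (c *\<^sub>R z)) = c *\<^sub>R F (a n * a n * z)" for n c z by (simp add: F_simps)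
    fix x :: "nat \<Rightarrow> 'a" assume x: "\<And>n. norm (x n) \<le> (1/2) ^ n"
    define s where "s = (\<Sum>n. a n * x n)"
    have s: "(\<lambda>n. a n * x n) sums s" "norm s \<le> 2"
      using orthogonal_series[OF a x] by (simp_all add: s_def)
    have "norm (F (a n * a n * x n)) \<le> L * norm (G (a n)) * 2 + K * norm (H s)" for n
    proof -
      have "(\<lambda>m. a n * (a m * x m)) = (\<lambda>m. if m = n then a n * a n * x n else 0)"
        using orth by (auto simp: mult.assoc[symmetric])
      then have "a n * s = a n * a n * x n"
        using sums_unique2[OF sums_mult[OF s(1), of "a n"]] sums_single[of n "\<lambda>_. a n * a n * x n"] by simp
      then have "norm (F (a n * a n * x n)) = norm (ract (G (a n)) s + lact (a n) (H s))"
        using F_mult[of "a n" s] by simp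
      also have "\<dots> \<le> L * norm (G (a n)) * norm s + K * norm (a n) * norm (H s)"
        by (intro order_trans[OF norm_triangle_ineq] add_mono K L)
      also have "\<dots> \<le> L * norm (G (a n)) * 2 + K * 1 * norm (H s)"
        using K(1) L(1) a[of n] s(2) by (intro add_mono mult_mono mult_left_mono mult_right_mono) auto
      finally show ?thesis by simp
    qed
    then show "\<exists>k. \<forall>n. norm (F (a n * a n * x n)) \<le> L * norm (G (a n)) * 2 + K * k" by blast
  qed (rule K(1))
qed

lemma orthogonal_J_right:
  fixes a :: "nat \<Rightarrow> 'a"
  assumes orth: "\<And>m n. m \<noteq> n \<Longrightarrow> a m * a n = 0" and a: "\<And>n. norm (a n) \<le> 1"
  shows "\<exists>n. a n * a n \<in> J_right"
proof (rule ccontr)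
  assume none: "\<not> ?thesis"
  obtain K where K: "K \<ge> 0" "\<And>a x. norm (lact a x) \<le> K * norm a * norm x" using lact_bound by blast
  obtain L where L: "L \<ge> 0" "\<And>a x. norm (ract x a) \<le> L * norm x * norm a" using ract_bound by blast
  show False
  proof (rule gliding_hump[where f = "\<lambda>n z. F (z * (a n * a n))" and p = "\<lambda>n. K * 2 * norm (H (a n))" and q = L])
    show "\<not> (\<exists>C. \<forall>z. norm (F (z * (a n * a n))) \<le> C * norm z)" for n
      using none unfolding J_right_def by blast
    show "F ((c *\<^sub>R z) * (a n * a n)) = c *\<^sub>R F (z * (a n * a n))" for n c z by (simp add: F_simps)
    fix x :: "nat \<Rightarrow> 'a" assume x: "\<And>n. norm (x n) \<le> (1/2) ^ n"
    define s where "s = (\<Sum>n. x n * a n)"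
    have s: "(\<lambda>n. x n * a n) sums s" "norm s \<le> 2"
      using orthogonal_series[OF a x] by (simp_all add: s_def)
    have "norm (F (x n * (a n * a n))) \<le> K * 2 * norm (H (a n)) + L * norm (G s)" for n
    proof -
      have "(\<lambda>m. (x m * a m) * a n) = (\<lambda>m. if m = n then x n * (a n * a n) else 0)"
        using orth by (auto simp: mult.assoc)
      then have "s * a n = x n * (a n * a n)"
        using sums_unique2[OF sums_mult2[OF s(1), of "a n"]] sums_single[of n "\<lambda>_. x n * (a n * a n)"] by simp
      then have "norm (F (x n * (a n * a n))) = norm (lact s (H (a n)) + ract (G s) (a n))"
        using F_mult[of s "a n"] by (simp add: add.commute)
      also have "\<dots> \<le> K * norm s * norm (H (a n)) + L * norm (G s) * norm (a n)"
        by (intro order_trans[OF norm_triangle_ineq] add_mono K L)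
      also have "\<dots> \<le> K * 2 * norm (H (a n)) + L * norm (G s) * 1"
        using K(1) L(1) a[of n] s(2) by (intro add_mono mult_mono mult_left_mono mult_right_mono) auto
      finally show ?thesis by simp
    qed
    then show "\<exists>k. \<forall>n. norm (F (x n * (a n * a n))) \<le> K * 2 * norm (H (a n)) + L * k" by blast
  qed (rule L(1))
qed

sublocale thin_ideal J_cont
proof
  fix a :: "nat \<Rightarrow> 'a"
  assume sa: "\<And>n. adj (a n) = a n" and orth: "\<And>m n. m \<noteq> n \<Longrightarrow> a m * a n = 0"
  show "\<exists>n. a n \<in> J_cont"
  proof (rule ccontr)
    assume none: "\<not> ?thesis"
    \<comment> \<open>The \<open>1 +\<close> gives norm at most 1 without dividing by zero.\<close>
    define b where "b n = (1 / (1 + norm (a n))) *\<^sub>R a n" for n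
    have b1: "norm (b n) \<le> 1" for n
      using norm_ge_zero[of "a n"] by (simp add: b_def divide_simps add_pos_nonneg)
    have borth: "b m * b n = 0" if "m \<noteq> n" for m n using orth[OF that] by (simp add: b_def)
    have bsa: "adj (b n) = b n" for n by (simp add: b_def sa)
    have "b n * b n \<notin> J_cont" for n
    proof
      assume "b n * b n \<in> J_cont"
      then have "b n \<in> J_cont" using mem_of_mult_adj[of "b n"] by (simp add: bsa)
      then have "(1 + norm (a n)) *\<^sub>R b n \<in> J_cont" by (rule J_intros(5))
      moreover have "1 + norm (a n) \<noteq> 0" using norm_ge_zero[of "a n"] by linarith
      ultimately show False using none by (simp add: b_def)
    qed
    \<comment> \<open>As \<open>b n * b n\<close> is self-adjoint, the adjoint conditions repeat the
      others, so each \<open>n\<close> fails on the left or on the right; infinitely many fail on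
      the same side.\<close>
    then have "UNIV = {n. b n * b n \<notin> J_left} \<union> {n. b n * b n \<notin> J_right}"
      by (auto simp: J_cont_def bsa)
    then have "infinite {n. b n * b n \<notin> J_left} \<or> infinite {n. b n * b n \<notin> J_right}"
      by (metis finite_UnI infinite_UNIV_nat)
    then show False
    proof
      assume "infinite {n. b n * b n \<notin> J_left}"
      then obtain r :: "nat \<Rightarrow> nat" where r: "strict_mono r" "\<And>n. r n \<in> {n. b n * b n \<notin> J_left}"
        using infinite_enumerate by blast
      show False
        using orthogonal_J_left[of "\<lambda>n. b (r n)"] r borth b1 by (auto simp: strict_mono_eq)
    next
      assume "infinite {n. b n * b n \<notin> J_right}"
      then obtain r :: "nat \<Rightarrow> nat" where r: "strict_mono r" "\<And>n. r n \<in> {n. b n * b n \<notin> J_right}"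
        using infinite_enumerate by blast
      show False
        using orthogonal_J_right[of "\<lambda>n. b (r n)"] r borth b1 by (auto simp: strict_mono_eq)
    qed
  qed
qed

text \<open>
  On \<open>J_cont\<close> the bilinear map \<open>(t, z) \<mapsto> F (t z)\<close> is separately and hence jointly bounded,
  and self-adjoint elements \<open>w\<close> factor as \<open>w = u v\<close> with control of the norms.
\<close>

lemma bounded_on_J_cont: "\<exists>C\<ge>0. \<forall>w\<in>J_cont. norm (F w) \<le> C * norm w"
proof -
  define I where "I = {t \<in> J_cont. norm t \<le> 1}"
  have "\<exists>C\<ge>0. \<forall>t\<in>I. \<forall>z\<in>J_cont. norm (F (t * z)) \<le> C * norm z"
  proof (rule uniform_boundedness[OF subspace closed])
    show "\<exists>C. \<forall>z\<in>J_cont. norm (F (t * z)) \<le> C * norm z" if "t \<in> I" for t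
      using that unfolding I_def J_cont_def J_left_def by blast
    show "\<exists>C. \<forall>t\<in>I. norm (F (t * z)) \<le> C" if z: "z \<in> J_cont" for z
    proof -
      have "bounded_linear (\<lambda>t. F (t * z))" using z by (intro J_rightD) (simp add: J_cont_def)
      then obtain C where C: "C \<ge> 0" "\<And>t. norm (F (t * z)) \<le> C * norm t"
        using bounded_linear_bound by blast
      have "norm (F (t * z)) \<le> C" if "t \<in> I" for t
        using C(2)[of t] mult_left_mono[of "norm t" 1 C] C(1) that by (simp add: I_def)
      then show ?thesis by blast
    qed
  qed (simp_all add: distrib_left F_simps)
  then obtain C where C: "C \<ge> 0" "\<And>t z. t \<in> I \<Longrightarrow> z \<in> J_cont \<Longrightarrow> norm (F (t * z)) \<le> C * norm z"
    by blast
  \<comment> \<open>Both factors of \<open>w\<close> have norm at most 2. Halving \<open>u\<close>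
    puts it into \<open>I\<close>, and undoing this doubles the bound \<open>C * 2\<close>.\<close>
  have unit: "norm (F w) \<le> 4 * C" if w: "w \<in> J_cont" "adj w = w" "norm w \<le> 1" for w
  proof -
    obtain u v where uv: "w = u * v" "u \<in> J_cont" "v \<in> J_cont"
      "norm u \<le> sqrt (norm w + 1)" "norm v \<le> sqrt (norm w + 1)"
      by (rule self_adjoint_factorization[OF w(2) subspace closed w(1) mult_left]) blast+
    have "sqrt (norm w + 1) \<le> sqrt (2\<^sup>2)" using w(3) by (intro real_sqrt_le_mono) simp
    then have n2: "norm u \<le> 2" "norm v \<le> 2" using uv by simp_all
    then have "(1/2) *\<^sub>R u \<in> I" using uv(2) by (simp add: I_def J_intros)
    then have "norm (F (((1/2) *\<^sub>R u) * v)) \<le> C * norm v" using uv(3) by (rule C(2))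
    also have "\<dots> \<le> C * 2" using n2(2) C(1) by (rule mult_left_mono)
    finally show ?thesis by (simp add: uv(1) F_simps)
  qed
  have sa: "norm (F w) \<le> 4 * C * norm w" if w: "w \<in> J_cont" "adj w = w" for w
  proof (cases "w = 0")
    case False
    have "norm (F ((1 / norm w) *\<^sub>R w)) \<le> 4 * C"
      using w False by (intro unit) (simp_all add: J_intros)
    then show ?thesis using False by (simp add: F_simps field_simps)
  qed (simp add: F_simps)
  have "norm (F w) \<le> 8 * C * norm w" if w: "w \<in> J_cont" for w
  proof -
    obtain y z where yz: "w = y + \<i> *\<^sub>C z" "adj y = y" "adj z = z"
      "y = (1/2) *\<^sub>R (w + adj w)" "z = (1/2) *\<^sub>R ((- \<i>) *\<^sub>C (w - adj w))"
      by (rule cartesian_decomposition)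
    have mem: "y \<in> J_cont" "z \<in> J_cont" unfolding yz(4,5) by (intro J_intros w)+
    have "norm y \<le> norm w" "norm z \<le> norm w"
      unfolding yz(4,5) using norm_triangle_ineq[of w "adj w"] norm_triangle_ineq4[of w "adj w"]
      by (simp_all add: norm_scaleC)
    then have "4 * C * norm y \<le> 4 * C * norm w" "4 * C * norm z \<le> 4 * C * norm w"
      using C(1) by (simp_all add: mult_left_mono)
    moreover have "norm (F w) \<le> norm (F y) + norm (F z)"
      unfolding yz(1) F_simps using norm_triangle_ineq[of "F y" "\<i> *\<^sub>C F z"] by (simp add: norm_scaleC)
    ultimately show ?thesis using sa[OF mem(1) yz(2)] sa[OF mem(2) yz(3)] by linarith
  qed
  then show ?thesis using C(1) by (intro exI[of _ "8 * C"]) simp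
qed

theorem bounded_linear_F: "bounded_linear F"
proof -
  obtain C where C: "C \<ge> 0" "\<And>w. w \<in> J_cont \<Longrightarrow> norm (F w) \<le> C * norm w"
    using bounded_on_J_cont by blast
  obtain M v where M: "finite M" "\<And>x. x - (\<Sum>e\<in>M. \<Sum>f\<in>M. e * x * f) \<in> J_cont"
    "\<And>e f x. e \<in> M \<Longrightarrow> f \<in> M \<Longrightarrow> \<exists>c. e * x * f - c *\<^sub>C v e f \<in> J_cont"
    by (rule finite_dimensional_quotient) blast
  define E where "E x = (\<Sum>e\<in>M. \<Sum>f\<in>M. e * x * f)" for x
  have bl_efx: "bounded_linear (\<lambda>x. e * x * f)" for e f :: 'a
    by (rule bounded_linear_compose[OF bounded_linear_mult_left bounded_linear_mult_right])
  have corner: "\<exists>B. \<forall>x. norm (F (e * x * f)) \<le> B * norm x" if ef: "e \<in> M" "f \<in> M" for e f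
  proof -
    obtain D where D: "D \<ge> 0" "\<And>x. norm (e * x * f) \<le> D * norm x"
      using bounded_linear_bound[OF bl_efx] by blast
    \<comment> \<open>Either the generator \<open>v e f\<close>, and with it the corner, lies in
      \<open>J_cont\<close>, or its coefficient is bounded by the norm of the element; in both cases
      the bound on \<open>J_cont\<close> extends to the corner.\<close>
    have "\<exists>B\<ge>0. \<forall>x. norm (F (e * x * f)) \<le> B * norm (e * x * f)"
    proof (cases "v e f \<in> J_cont")
      case True
      have "e * x * f \<in> J_cont" for x
      proof -
        obtain c where "e * x * f - c *\<^sub>C v e f \<in> J_cont" using M(3)[OF ef] by blast
        then have "(e * x * f - c *\<^sub>C v e f) + c *\<^sub>C v e f \<in> J_cont"
          using True by (intro J_intros(2) scaleC_closed)
        then show ?thesis by simp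
      qed
      then show ?thesis using C by blast
    next
      case False
      obtain d where d: "d > 0" "\<And>c w. w - c *\<^sub>C v e f \<in> J_cont \<Longrightarrow> cmod c * d \<le> norm w"
        using one_dimensional_bound[OF closed False scaleC_closed] by blast
      have "norm (F w) \<le> (C * (1 + norm (v e f) / d) + norm (F (v e f)) / d) * norm w"
        if c: "w - c *\<^sub>C v e f \<in> J_cont" for w c
      proof -
        have cd: "cmod c \<le> norm w / d" using d(2)[OF c] d(1) by (simp add: field_simps)
        have "F w = F (w - c *\<^sub>C v e f) + c *\<^sub>C F (v e f)" by (simp add: F_simps)
        then have "norm (F w) \<le> norm (F (w - c *\<^sub>C v e f)) + cmod c * norm (F (v e f))"
          by (metis norm_scaleC norm_triangle_ineq)
        also have "norm (F (w - c *\<^sub>C v e f)) \<le> C * norm (w - c *\<^sub>C v e f)" by (rule C(2)[OF c])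
        also have "norm (w - c *\<^sub>C v e f) \<le> norm w + cmod c * norm (v e f)"
          using norm_triangle_ineq4[of w "c *\<^sub>C v e f"] by (simp add: norm_scaleC)
        finally have "norm (F w) \<le> C * (norm w + cmod c * norm (v e f)) + cmod c * norm (F (v e f))"
          using C(1) by (simp add: mult_left_mono)
        also have "\<dots> \<le> C * (norm w + norm w / d * norm (v e f)) + norm w / d * norm (F (v e f))"
          using C(1) cd by (intro add_mono mult_left_mono mult_right_mono order_refl) auto
        also have "\<dots> = (C * (1 + norm (v e f) / d) + norm (F (v e f)) / d) * norm w"
          by (simp add: algebra_simps)
        finally show ?thesis .
      qed
      moreover have "C * (1 + norm (v e f) / d) + norm (F (v e f)) / d \<ge> 0"
        using C(1) d(1) by simp
      ultimately show ?thesis using M(3)[OF ef] by blast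
    qed
    then obtain B where B: "B \<ge> 0" "\<And>x. norm (F (e * x * f)) \<le> B * norm (e * x * f)" by blast
    have "norm (F (e * x * f)) \<le> (B * D) * norm x" for x
      using B(2)[of x] mult_left_mono[OF D(2)[of x] B(1)] by (simp add: mult.assoc)
    then show ?thesis by blast
  qed
  have bl_corner: "bounded_linear (\<lambda>x. F (e * x * f))" if ef: "e \<in> M" "f \<in> M" for e f
    using corner[OF ef] linear_compose[OF bounded_linear.linear[OF bl_efx] linear_F]
      bounded_linearI_linear[of "\<lambda>x. F (e * x * f)"]
    by (auto simp: o_def)
  have bl_E: "bounded_linear E"
    unfolding E_def by (intro bounded_linear_sum bl_efx)
  then have bl_res: "bounded_linear (\<lambda>x. x - E x)" by (intro bounded_linear_sub bounded_linear_ident)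
  then obtain D where D: "D \<ge> 0" "\<And>x. norm (x - E x) \<le> D * norm x"
    using bounded_linear_bound by blast
  have "bounded_linear (\<lambda>x. F (x - E x))"
  proof (rule bounded_linearI_linear)
    show "linear (\<lambda>x. F (x - E x))"
      using linear_compose[OF bounded_linear.linear[OF bl_res] linear_F] by (simp add: o_def)
    show "norm (F (x - E x)) \<le> (C * D) * norm x" for x
      using C(2)[OF M(2)[of x]] mult_left_mono[OF D(2)[of x] C(1)] by (simp add: E_def mult.assoc)
  qed
  then have bl: "bounded_linear (\<lambda>x. F (x - E x) + (\<Sum>e\<in>M. \<Sum>f\<in>M. F (e * x * f)))"
    by (intro bounded_linear_add bounded_linear_sum bl_corner)
  have "F = (\<lambda>x. F (x - E x) + (\<Sum>e\<in>M. \<Sum>f\<in>M. F (e * x * f)))"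
    by (rule ext) (simp add: E_def F_simps)
  then show ?thesis by (rule ssubst[of _ _ bounded_linear]) (rule bl)
qed

end

section \<open>The element of the bidual\<close>

text \<open>The Banach-Alaoglu argument: the evaluations lie in a product of discs, compact by
  Tychonoff's theorem, and a cluster point there is again linear and bounded. It has the right value
  at every \<open>\<phi>\<close> for which the limit exists.\<close>

lemma bidual_cluster_point:
  fixes x :: "'i \<Rightarrow> 'm::complex_normed_vector"
  assumes "\<F> \<noteq> bot" and B: "\<And>i. norm (x i) \<le> B"
  obtains \<xi> :: "'m cdual cdual"
  where "\<And>\<phi> l. ((\<lambda>i. cdual_apply \<phi> (x i)) \<longlongrightarrow> l) \<F> \<Longrightarrow> cdual_apply \<xi> \<phi> = l"
proof -
  define \<Phi> where "\<Phi> i = (\<lambda>\<phi> :: 'm cdual. cdual_apply \<phi> (x i))" for i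
  define K where "K = (\<Pi>\<^sub>E \<phi>\<in>UNIV. cball (0 :: complex) (norm (\<phi> :: 'm cdual) * B))"
  have "compactin (product_topology (\<lambda>_. euclidean) UNIV) K"
    unfolding K_def compactin_PiE by simp
  then have "compact K" by (simp add: euclidean_product_topology)
  have \<Phi>K: "\<Phi> i \<in> K" for i
    using order_trans[OF norm_cdual_apply mult_left_mono[OF B norm_ge_zero]]
    by (auto simp: \<Phi>_def K_def PiE_def)
  have "\<exists>\<zeta>\<in>K. inf (nhds \<zeta>) (filtermap \<Phi> \<F>) \<noteq> bot"
    using \<open>compact K\<close> assms(1) \<Phi>K unfolding compact_filter
    by (simp add: filtermap_bot_iff eventually_filtermap)
  then obtain \<zeta> where \<zeta>: "\<zeta> \<in> K" "inf (nhds \<zeta>) (filtermap \<Phi> \<F>) \<noteq> bot" by blast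
  \<comment> \<open>This filter replaces a convergent subnet: it refines the image filter and
    converges to \<open>\<zeta>\<close>.\<close>
  define \<H> where "\<H> = inf (nhds \<zeta>) (filtermap \<Phi> \<F>)"
  have \<H>: "\<H> \<noteq> bot" "\<H> \<le> nhds \<zeta>" "\<H> \<le> filtermap \<Phi> \<F>" using \<zeta> by (simp_all add: \<H>_def)
  have eval: "((\<lambda>y. y \<phi>) \<longlongrightarrow> \<zeta> \<phi>) \<H>" for \<phi>
  proof (rule tendsto_mono[OF \<H>(2)], rule topological_tendstoI)
    fix S assume "open S" "\<zeta> \<phi> \<in> S"
    moreover have "open ((\<lambda>y :: 'm cdual \<Rightarrow> complex. y \<phi>) -` S)"
      by (rule open_vimage[OF \<open>open S\<close>]) simp
    ultimately show "\<forall>\<^sub>F y in nhds \<zeta>. y \<phi> \<in> S"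
      unfolding eventually_nhds by (intro exI[of _ "(\<lambda>y. y \<phi>) -` S"]) auto
  qed
  have eventually_\<H>: "eventually P \<H>" if "\<And>i. P (\<Phi> i)" for P
    by (rule filter_leD[OF \<H>(3)]) (simp add: eventually_filtermap that)
  have eq: "\<zeta> \<phi> = l" if "((\<lambda>y. y \<phi>) \<longlongrightarrow> l) (filtermap \<Phi> \<F>)" for \<phi> l
    by (rule tendsto_unique[OF \<H>(1) eval tendsto_mono[OF \<H>(3) that]])
  have add: "\<zeta> (\<phi> + \<psi>) = \<zeta> \<phi> + \<zeta> \<psi>" for \<phi> \<psi>
  proof (rule tendsto_unique[OF \<H>(1) eval])
    show "((\<lambda>y. y (\<phi> + \<psi>)) \<longlongrightarrow> \<zeta> \<phi> + \<zeta> \<psi>) \<H>"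
      by (rule Lim_transform_eventually[OF tendsto_add[OF eval eval] eventually_\<H>])
        (simp add: \<Phi>_def cdual_apply_plus)
  qed
  have scale: "\<zeta> (c *\<^sub>C \<phi>) = c * \<zeta> \<phi>" for c \<phi>
  proof (rule tendsto_unique[OF \<H>(1) eval])
    show "((\<lambda>y. y (c *\<^sub>C \<phi>)) \<longlongrightarrow> c * \<zeta> \<phi>) \<H>"
      by (rule Lim_transform_eventually[OF tendsto_mult_left[OF eval] eventually_\<H>])
        (simp add: \<Phi>_def scaleC_cdual_apply)
  qed
  have bound: "cmod (\<zeta> \<phi>) \<le> norm \<phi> * B" for \<phi>
    using \<zeta>(1) by (auto simp: K_def PiE_def Pi_def)
  have "cdual_apply (Abs_cdual \<zeta>) = \<zeta>" by (rule Abs_cdual_apply[OF add scale bound])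
  then show ?thesis
    using eq by (intro that[of "Abs_cdual \<zeta>"]) (simp add: \<Phi>_def filterlim_filtermap)
qed

text \<open>A pair \<open>(a, n)\<close> in the index set demands precision
  \<open>1 / (n + 1)\<close> at \<open>a\<close>, and finite sets of demands are directed by
  inclusion. Infinite sets get the value 0, so the norm bound holds for every index.\<close>

lemma approximate_unit_net:
  obtains e :: "('a \<times> nat) set \<Rightarrow> 'a::cstar_algebra"
  where "\<And>X. norm (e X) \<le> 8"
    "\<And>a. ((\<lambda>X. e X * a) \<longlongrightarrow> a) (finite_subsets_at_top UNIV)"
    "\<And>a. ((\<lambda>X. a * e X) \<longlongrightarrow> a) (finite_subsets_at_top UNIV)"
proof -
  have "\<exists>e. norm e \<le> 8 \<and> (finite X \<longrightarrow> (\<forall>(a, n)\<in>X. norm (a - e * a) \<le> inverse (real (Suc n))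
      \<and> norm (a - a * e) \<le> inverse (real (Suc n))))" for X :: "('a \<times> nat) set"
  proof (cases "finite X")
    case True
    define N where "N = Max (insert 0 (snd ` X))"
    obtain e where e: "norm e \<le> 8"
      "\<And>a. a \<in> fst ` X \<Longrightarrow> norm (a - e * a) \<le> inverse (real (Suc N)) \<and> norm (a - a * e) \<le> inverse (real (Suc N))"
      using approximate_unit[of "fst ` X" "inverse (real (Suc N))"] True by auto
    have "norm (a - e * a) \<le> inverse (real (Suc n)) \<and> norm (a - a * e) \<le> inverse (real (Suc n))"
      if "(a, n) \<in> X" for a n
    proof -
      have "n \<le> N" unfolding N_def using True that by (intro Max_ge) force+
      then have "inverse (real (Suc N)) \<le> inverse (real (Suc n))" by simp
      moreover have "a \<in> fst ` X" using that by force
      ultimately show ?thesis using e(2)[of a] by linarith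
    qed
    then show ?thesis using e(1) by blast
  next
    case False
    then show ?thesis by (intro exI[of _ 0]) simp
  qed
  then obtain e :: "('a \<times> nat) set \<Rightarrow> 'a" where e: "\<And>X. norm (e X) \<le> 8"
    "\<And>X a n. finite X \<Longrightarrow> (a, n) \<in> X \<Longrightarrow> norm (a - e X * a) \<le> inverse (real (Suc n))
      \<and> norm (a - a * e X) \<le> inverse (real (Suc n))"
    by (metis (no_types, lifting) case_prodD)
  have lim: "(f \<longlongrightarrow> a) (finite_subsets_at_top UNIV)"
    if f: "\<And>X n. finite X \<Longrightarrow> (a, n) \<in> X \<Longrightarrow> norm (a - f X) \<le> inverse (real (Suc n))"
    for f :: "('a \<times> nat) set \<Rightarrow> 'a" and a
  proof (rule tendstoI)
    fix r :: real assume "r > 0"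
    then obtain n where n: "inverse (real (Suc n)) < r" using reals_Archimedean by blast
    show "\<forall>\<^sub>F X in finite_subsets_at_top UNIV. dist (f X) a < r"
      unfolding eventually_finite_subsets_at_top
    proof (intro exI[of _ "{(a, n)}"] conjI allI impI)
      fix X :: "('a \<times> nat) set"
      assume "finite X \<and> {(a, n)} \<subseteq> X \<and> X \<subseteq> UNIV"
      then have "norm (a - f X) \<le> inverse (real (Suc n))" by (intro f) auto
      then show "dist (f X) a < r" using n by (simp add: dist_norm norm_minus_commute)
    qed simp_all
  qed
  show ?thesis
  proof (rule that[of e])
    show "((\<lambda>X. e X * a) \<longlongrightarrow> a) (finite_subsets_at_top UNIV)" for a by (rule lim) (use e(2) in blast)
    show "((\<lambda>X. a * e X) \<longlongrightarrow> a) (finite_subsets_at_top UNIV)" for a by (rule lim) (use e(2) in blast)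
  qed (rule e(1))
qed

text \<open>With \<open>x = e X\<close> the triple identity expresses
  \<open>lact a (ract (F (e X)) b)\<close> by terms that converge because \<open>F\<close> is
  continuous, the limit being \<open>ract (F a) b + lact a (F b) - F (a * b)\<close>. The cluster
  point \<open>\<xi>\<close> of the \<open>F (e X)\<close> must therefore satisfy the required
  equation.\<close>

theorem (in third_type_derivation) second_type: "generalized_derivation_second lact ract F"
proof -
  obtain e :: "('a \<times> nat) set \<Rightarrow> 'a" where e: "\<And>X. norm (e X) \<le> 8"
    "\<And>a. ((\<lambda>X. e X * a) \<longlongrightarrow> a) (finite_subsets_at_top UNIV)"
    "\<And>a. ((\<lambda>X. a * e X) \<longlongrightarrow> a) (finite_subsets_at_top UNIV)"
    by (rule approximate_unit_net) blast
  obtain C where C: "C \<ge> 0" "\<And>x. norm (F x) \<le> C * norm x"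
    using bounded_linear_bound[OF bounded_linear_F] by blast
  have "norm (F (e X)) \<le> C * 8" for X
    using C(2)[of "e X"] mult_left_mono[OF e(1)[of X] C(1)] by linarith
  then obtain \<xi> :: "'m cdual cdual" where \<xi>:
    "\<And>\<phi> l. ((\<lambda>X. cdual_apply \<phi> (F (e X))) \<longlongrightarrow> l) (finite_subsets_at_top UNIV) \<Longrightarrow> cdual_apply \<xi> \<phi> = l"
    by (rule bidual_cluster_point[where x = "\<lambda>X. F (e X)", OF finite_subsets_at_top_neq_bot[of UNIV]]) blast
  have "bidual_embed (F (a * b)) = bidual_embed (ract (F a) b) + bidual_embed (lact a (F b))
      - bidual_lact lact a (bidual_ract ract \<xi> b)" for a b
  proof (rule cdual_eqI)
    fix \<phi> :: "'m cdual"
    \<comment> \<open>Both actions are moved onto the functional, so that convergence against the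
      single functional \<open>\<psi>\<close> determines the value of \<open>\<xi>\<close>.\<close>
    define \<psi> where "\<psi> = dual_lact ract b (dual_ract lact \<phi> a)"
    have \<psi>: "cdual_apply \<psi> m = cdual_apply \<phi> (lact a (ract m b))" for m
      by (simp add: \<psi>_def dual_lact_apply dual_ract_apply)
    have "((\<lambda>X. a * (e X * b)) \<longlongrightarrow> a * b) (finite_subsets_at_top UNIV)"
      by (intro tendsto_intros e)
    then have lim: "((\<lambda>X. F (a * e X * b)) \<longlongrightarrow> F (a * b)) (finite_subsets_at_top UNIV)"
      by (intro bounded_linear.tendsto[OF bounded_linear_F]) (simp add: mult.assoc)
    have "lact a (ract (F x) b) = ract (F (a * x)) b + lact a (F (x * b)) - F (a * x * b)" for x
      using F_triple[of a x b] by (simp add: algebra_simps)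
    then have "((\<lambda>X. lact a (ract (F (e X)) b)) \<longlongrightarrow> ract (F a) b + lact a (F b) - F (a * b))
        (finite_subsets_at_top UNIV)"
      by (simp only:) (intro tendsto_add tendsto_diff lim e
        bounded_linear.tendsto[OF bounded_linear_ract_left] bounded_linear.tendsto[OF bounded_linear_lact]
        bounded_linear.tendsto[OF bounded_linear_F])
    then have "((\<lambda>X. cdual_apply \<psi> (F (e X))) \<longlongrightarrow>
        cdual_apply \<phi> (ract (F a) b + lact a (F b) - F (a * b))) (finite_subsets_at_top UNIV)"
      unfolding \<psi> by (rule bounded_linear.tendsto[OF cdual_apply_bounded_linear])
    then have "cdual_apply \<xi> \<psi> = cdual_apply \<phi> (ract (F a) b + lact a (F b) - F (a * b))" by (rule \<xi>)
    then have "cdual_apply \<xi> \<psi> = cdual_apply \<phi> (ract (F a) b) + cdual_apply \<phi> (lact a (F b)) - cdual_apply \<phi> (F (a * b))"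
      by (simp add: linear_diff[OF bounded_linear.linear[OF cdual_apply_bounded_linear]] cdual_apply_add)
    then show "cdual_apply (bidual_embed (F (a * b))) \<phi> = cdual_apply (bidual_embed (ract (F a) b)
        + bidual_embed (lact a (F b)) - bidual_lact lact a (bidual_ract ract \<xi> b)) \<phi>"
      by (simp add: cdual_apply_plus cdual_apply_minus bidual_embed_apply bidual_lact_apply bidual_ract_apply \<psi>_def)
  qed
  then show ?thesis unfolding generalized_derivation_second_def using clinear_F by blast
qed

theorem theorem2p8:
  fixes lact :: "'a::cstar_algebra \<Rightarrow> 'm::{complex_normed_vector, banach} \<Rightarrow> 'm"
    and ract :: "'m \<Rightarrow> 'a \<Rightarrow> 'm"
    and F :: "'a \<Rightarrow> 'm"
  assumes "banach_bimodule lact ract"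
    and "generalized_derivation_third lact ract F"
  shows "continuous_on UNIV F \<and> generalized_derivation_second lact ract F"
proof -
  obtain G H where "clinear F" "\<And>a b. F (a * b) = ract (G a) b + lact a (H b)"
    using assms(2) unfolding generalized_derivation_third_def by blast
  then interpret third_type_derivation lact ract F G H
    using assms(1) by (intro third_type_derivation.intro third_type_derivation_axioms.intro)
  show ?thesis using linear_continuous_on[OF bounded_linear_F] second_type by blast
qed

end
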